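(* For a Lipschitz function $a:\mathbb{R}^n\to\mathbb{R}$, let $\gamma_a(dx)=\frac1{Z_a}e^{-a(x)-|x|^2/2}dx$ ($Z_a$ a normalizing constant) and $\gamma=\gamma_0$ the standard Gaussian. For all Lipschitz functions $a,b:\mathbb{R}^n\to\mathbb{R}$ with Lipschitz constants $L_a,L_b$, the Brenier map $T_{a,b}$ from $\gamma_a$ to $\gamma_b$ satisfies \[ -8L+|x-y|\le|T_{a,b}(x)-T_{a,b}(y)|\le 8L+|x-y|,\qquad\forall x,y\in\mathbb{R}^n, \] where $L=\max(L_a,L_b)$. In particular, the Brenier map $T_a$ from $\gamma$ to $\gamma_a$ satisfies $-8L_a+|x-y|\le|T_a(x)-T_a(y)|\le 8L_a+|x-y|$ for all $x,y$, and if $a$ is even then $-8L_a+|x|\le|T_a(x)|\le 8L_a+|x|$ for all $x\in\mathbb{R}^n$.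
   Context: The Brenier map from $\mu$ to $\nu$ is the gradient of a convex function pushing $\mu$ onto $\nu$, optimal for the quadratic transport cost. *)

theory Defs
  imports "HOL-Analysis.Analysis"
begin

definition gauss_Z :: "('a::euclidean_space \<Rightarrow> real) \<Rightarrow> real" where
  "gauss_Z a = (\<integral>x. exp (- a x - (norm x)\<^sup>2 / 2) \<partial>lborel)"

definition gauss_tilt :: "('a::euclidean_space \<Rightarrow> real) \<Rightarrow> 'a measure" where
  "gauss_tilt a = density lborel (\<lambda>x. ennreal (exp (- a x - (norm x)\<^sup>2 / 2) / gauss_Z a))"

definition brenier_map ::
  "'a::euclidean_space measure \<Rightarrow> 'a measure \<Rightarrow> ('a \<Rightarrow> real) \<Rightarrow> ('a \<Rightarrow> 'a) \<Rightarrow> bool" where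
  "brenier_map \<mu> \<nu> \<phi> T \<longleftrightarrow>
     convex_on UNIV \<phi> \<and>
     T \<in> borel_measurable borel \<and>
     (AE x in \<mu>. (\<phi> has_derivative (\<lambda>h. T x \<bullet> h)) (at x)) \<and>
     distr \<mu> borel T = \<nu>"

end

theory Submission
  imports Defs
begin

text \<open>
  Let \<open>T = \<nabla>\<phi>\<close> transport \<open>exp (- V)\<close> to \<open>exp (- W)\<close>. Fix \<open>t\<close> and a vector \<open>z\<close> of length \<open>r\<close> and
  consider the gap \<open>F x = (1 - t) \<phi> x + t \<phi> (x + z) - \<phi> (x + t z)\<close>. Alexandrov's theorem gives the
  Monge-Ampere equation \<open>det (D\<^sup>2 \<phi>) = exp (W (T x) - V x)\<close> almost everywhere, and the logarithmic
  concavity of the determinant bounds from below the mass of the gradient image of the function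
  \<open>(1 - t) \<phi> x + t \<phi> (x + z)\<close> over a superlevel set of \<open>F\<close>. That image is contained in the one of
  \<open>x \<mapsto> \<phi> (x + t z)\<close>, so the two masses can be compared. If \<open>|T (x + z) - T x| > r + 4 L\<close> on the
  superlevel set, the shape of \<open>V\<close> and \<open>W\<close> makes the contained set the heavier one,
  a contradiction. Combined with the convexity of \<open>F\<close> in \<open>z\<close> this yields \<open>F \<le> t (1 - t) (r\<^sup>2 / 2 + 4 L r)\<close>, with no regularity theory.
  Letting \<open>t\<close> tend to \<open>0\<close> and adding the two expansions at \<open>x\<close> and \<open>y\<close> gives the upper bound; the
  lower bound is dual, from the same estimate for the Legendre transform, whose gradient is the
  inverse transport. For even weights the transport is odd by uniqueness, and the pair
  \<open>x\<close>, \<open>- x\<close> gives the last claim.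
\<close>

section \<open>Subgradients of convex functions\<close>

text \<open>A maximum principle for the gap would need a maximum point of F and two derivatives of
  \<phi> there. With second derivatives only almost everywhere, the pointwise argument becomes a
  comparison of masses on a set of positive measure. A superlevel set of F may be unbounded;
  multiplying the interpolated function by 1 - \<epsilon> bounds it, because \<phi> grows at least
  quadratically and F at most linearly. Both growth rates come from Gaussian tails. Origin of 4 L:
  with s = |T (x + z) - T x| and in units of t (1 - t), the convexity defect of W is at least s^2/2
  - 2 L s, that of V at most r^2/2 + 2 L r, and the difference is (s + r)(s - r - 4 L)/2. Origin of
  8 L: optimising expansions with linear term 4 L r gives (s - 4 L)^2 \<le> s |x - y| for slopes at
  distance s, whence s \<le> |x - y| + 8 L. Subgradients replace gradients because they exist at
  every point and are exchanged by the Legendre transform.\<close>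

definition subgrad :: "('a::real_inner \<Rightarrow> real) \<Rightarrow> 'a \<Rightarrow> 'a \<Rightarrow> bool" where
  "subgrad \<phi> x p \<longleftrightarrow> (\<forall>w. \<phi> x + p \<bullet> (w - x) \<le> \<phi> w)"

lemma subgradD: "subgrad \<phi> x p \<Longrightarrow> \<phi> x + p \<bullet> (w - x) \<le> \<phi> w"
  by (simp add: subgrad_def)

lemma subgrad_monotone:
  assumes "subgrad \<phi> x p" "subgrad \<phi> y q"
  shows "0 \<le> (p - q) \<bullet> (x - y)"
  using subgradD[OF assms(1), of y] subgradD[OF assms(2), of x]
  by (simp add: inner_simps)

lemma convex_on_UNIV_isCont:
  fixes \<phi> :: "'a::euclidean_space \<Rightarrow> real"
  assumes "convex_on UNIV \<phi>"
  shows "continuous_on UNIV \<phi>" "isCont \<phi> x"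
proof -
  show "continuous_on UNIV \<phi>"
    using convex_on_continuous[OF open_UNIV assms] .
  then show "isCont \<phi> x"
    by (simp add: continuous_on_eq_continuous_at)
qed

text \<open>Separate \<open>(x, \<phi> x)\<close> from the strict epigraph. Since \<phi> is finite
  everywhere the hyperplane cannot be vertical, so the last component \<open>c\<close> of its normal
  \<open>(q, c)\<close> is negative and dividing by it gives the slope.\<close>

lemma subgrad_exists:
  fixes \<phi> :: "'a::euclidean_space \<Rightarrow> real"
  assumes cv: "convex_on UNIV \<phi>"
  obtains p where "subgrad \<phi> x p"
proof -
  define S where "S = {v :: 'a \<times> real. \<phi> (fst v) < snd v}"
  have cS: "convex S"
  proof (rule convexI)
    fix v w :: "'a \<times> real" and u s :: real
    assume v: "v \<in> S" and w: "w \<in> S" and us: "0 \<le> u" "0 \<le> s" "u + s = 1"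
    have "\<phi> (u *\<^sub>R fst v + s *\<^sub>R fst w) \<le> u * \<phi> (fst v) + s * \<phi> (fst w)"
      using cv us by (auto simp: convex_on_def)
    also have "\<dots> < u * snd v + s * snd w"
    proof (cases "u = 0")
      case True then show ?thesis using us w by (simp add: S_def)
    next
      case False
      then have "u * \<phi> (fst v) < u * snd v" using us v by (simp add: S_def)
      moreover have "s * \<phi> (fst w) \<le> s * snd w" using us w by (simp add: S_def mult_left_mono)
      ultimately show ?thesis by linarith
    qed
    finally show "u *\<^sub>R v + s *\<^sub>R w \<in> S" by (simp add: S_def)
  qed
  have "(x, \<phi> x + 1) \<in> S" by (simp add: S_def)
  moreover have "S \<inter> {(x, \<phi> x)} = {}" by (auto simp: S_def)
  ultimately obtain a b where ab: "a \<noteq> 0" "\<forall>v\<in>S. a \<bullet> v \<le> b" "\<forall>v\<in>{(x, \<phi> x)}. b \<le> a \<bullet> v"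
    using separating_hyperplane_sets[OF cS convex_singleton[of "(x, \<phi> x)"]] by blast
  obtain q c where a: "a = (q, c)" by (cases a)
  have le: "q \<bullet> w + c * s \<le> q \<bullet> x + c * \<phi> x" if "\<phi> w < s" for w s
  proof -
    have "a \<bullet> (w, s) \<le> b" using ab(2) that by (auto simp: S_def)
    moreover have "b \<le> a \<bullet> (x, \<phi> x)" using ab(3) by auto
    ultimately show ?thesis by (simp add: a)
  qed
  have "c \<le> 0" using le[of x "\<phi> x + 1"] by (simp add: algebra_simps)
  moreover have "c \<noteq> 0"
  proof
    assume "c = 0"
    have "q \<bullet> (x + q) \<le> q \<bullet> x" using le[of "x + q" "\<phi> (x+q) + 1"] \<open>c = 0\<close> by simp
    then have "(norm q)\<^sup>2 \<le> 0" unfolding power2_norm_eq_inner by (simp add: inner_add_right)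
    then have "q = 0" by simp
    then show False using ab(1) a \<open>c = 0\<close> by (simp add: zero_prod_def)
  qed
  ultimately have c: "c < 0" by simp
  have "subgrad \<phi> x (- (1/c) *\<^sub>R q)"
    unfolding subgrad_def
  proof
    fix w
    show "\<phi> x + (- (1 / c) *\<^sub>R q) \<bullet> (w - x) \<le> \<phi> w"
    proof (rule field_le_epsilon)
      fix e :: real assume "0 < e"
      have "q \<bullet> w + c * (\<phi> w + e) \<le> q \<bullet> x + c * \<phi> x" using le[of w "\<phi> w + e"] \<open>0 < e\<close> by simp
      then have "c * (\<phi> w + e) \<le> c * (\<phi> x - (q \<bullet> (w - x)) / c)"
        using c by (simp add: inner_diff_right right_diff_distrib diff_divide_distrib)
      then have "\<phi> x - (q \<bullet> (w - x)) / c \<le> \<phi> w + e"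
        using c by (simp add: mult_le_cancel_left)
      then show "\<phi> x + (- (1 / c) *\<^sub>R q) \<bullet> (w - x) \<le> \<phi> w + e" by simp
    qed
  qed
  then show thesis using that by blast
qed

text \<open>Subtracting the affine function with slope \<open>q\<close> leaves a function that is
  minimal at \<open>x\<close>, so its derivative \<open>p - q\<close> vanishes.\<close>

lemma subgrad_of_has_derivative:
  fixes \<phi> :: "'a::euclidean_space \<Rightarrow> real"
  assumes cv: "convex_on UNIV \<phi>" and d: "(\<phi> has_derivative (\<lambda>h. p \<bullet> h)) (at x)"
    and q: "subgrad \<phi> x q"
  shows "q = p"
proof -
  define g where "g w = \<phi> w - q \<bullet> (w - x)" for w
  have "(g has_derivative (\<lambda>h. p \<bullet> h - q \<bullet> h)) (at x)"
    unfolding g_def by (auto intro!: derivative_eq_intros d)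
  moreover have "g x \<le> g w" for w using subgradD[OF q, of w] by (simp add: g_def)
  ultimately have "(\<lambda>h. p \<bullet> h - q \<bullet> h) = (\<lambda>h. 0)"
    using differential_zero_maxmin[of x UNIV g] by auto
  then have "p \<bullet> (p - q) - q \<bullet> (p - q) = 0" by metis
  then have "(p - q) \<bullet> (p - q) = 0" by (simp add: inner_simps)
  then show ?thesis by simp
qed

lemma has_derivative_subgrad:
  fixes \<phi> :: "'a::euclidean_space \<Rightarrow> real"
  assumes cv: "convex_on UNIV \<phi>" and d: "(\<phi> has_derivative (\<lambda>h. p \<bullet> h)) (at x)"
  shows "subgrad \<phi> x p"
  by (metis subgrad_exists[OF cv] subgrad_of_has_derivative[OF cv d])

text \<open>Test the subgradient inequality in the direction \<open>q - p\<close>.\<close>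
lemma subgrad_continuous:
  fixes \<phi> :: "'a::euclidean_space \<Rightarrow> real"
  assumes cv: "convex_on UNIV \<phi>" and d: "(\<phi> has_derivative (\<lambda>h. p \<bullet> h)) (at x)" and e: "0 < e"
  obtains d where "0 < d" "\<And>w q. dist w x < d \<Longrightarrow> subgrad \<phi> w q \<Longrightarrow> norm (q - p) \<le> e"
proof -
  obtain r where r: "0 < r" "\<And>w. norm (w - x) < r \<Longrightarrow> norm (\<phi> w - \<phi> x - p \<bullet> (w - x)) \<le> e/4 * norm (w - x)"
    using d e unfolding has_derivative_at_alt by (metis divide_pos_pos zero_less_numeral)
  define s where "s = r/2"
  have s: "0 < s" "s < r" using r by (auto simp: s_def)
  define d where "d = min (s/2) (e * s / (16 * (norm p + 1)))"
  have d0: "0 < d" using s e by (simp add: d_def add_nonneg_pos)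
  have "norm (q - p) \<le> e" if "dist w x < d" "subgrad \<phi> w q" for w q
  proof (cases "q = p")
    case False
    define u where "u = (s / norm (q - p)) *\<^sub>R (q - p)"
    have nu: "norm u = s" using s False by (simp add: u_def)
    have inu: "(q - p) \<bullet> u = s * norm (q - p)" using False
      by (simp add: u_def dot_square_norm power2_eq_square)
    have "\<bar>\<phi> (x + u) - \<phi> x - p \<bullet> u\<bar> \<le> e/4 * s" using r(2)[of "x + u"] nu s by simp
    then have up: "\<phi> (x + u) \<le> \<phi> x + p \<bullet> u + e/4 * s" by linarith
    have lo: "\<phi> w + q \<bullet> (x + u - w) \<le> \<phi> (x + u)" using subgradD[OF that(2)] by blast
    have gx: "\<phi> x + p \<bullet> (w - x) \<le> \<phi> w"
      using subgradD[OF has_derivative_subgrad[OF cv assms(2)]] by blast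
    have nw: "norm (w - x) < d" using that by (simp add: dist_norm)
    have "norm (w - x) \<le> s/2" using nw by (simp add: d_def)
    then have c1: "\<bar>(q - p) \<bullet> (w - x)\<bar> \<le> norm (q - p) * (s/2)"
      using Cauchy_Schwarz_ineq2[of "q - p" "w - x"] mult_left_mono[OF _ norm_ge_zero, of "norm (w - x)" "s/2" "q - p"] by linarith
    have "q \<bullet> (x + u - w) = (q - p) \<bullet> u - (q - p) \<bullet> (w - x) + p \<bullet> u - p \<bullet> (w - x)"
      by (simp add: inner_simps)
    then have "(q - p) \<bullet> u \<le> (q - p) \<bullet> (w - x) + e/4 * s"
      using up lo gx by linarith
    then have "s * norm (q - p) \<le> norm (q - p) * (s/2) + e/4 * s" using c1 inu by linarith
    then have "s * norm (q - p) \<le> s * (e/2)" by (simp add: algebra_simps)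
    then show ?thesis using s e by simp
  qed (use e in auto)
  then show thesis using that d0 by blast
qed

text \<open>The point is the minimiser of \<open>\<phi> x + (norm (x - z))\<^sup>2 / 2\<close>. This
  is the surjectivity of id + \<partial>\<phi>, on which the resolvent rests.\<close>

lemma subgrad_minimizer:
  fixes \<phi> :: "'a::euclidean_space \<Rightarrow> real"
  assumes cv: "convex_on UNIV \<phi>"
  obtains x where "subgrad \<phi> x (z - x)"
proof -
  obtain p where p: "subgrad \<phi> 0 p" using subgrad_exists[OF cv] .
  define g where "g x = \<phi> x + (norm (x - z))\<^sup>2 / 2" for x
  have cg: "continuous_on UNIV g" unfolding g_def
    by (intro continuous_intros convex_on_UNIV_isCont[OF cv]) auto
  \<comment> \<open>Completing the square in the affine lower bound at \<open>0\<close> centres the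
    quadratic part at \<open>q\<close>; outside a large ball around \<open>q\<close> the value of
    \<open>g\<close> exceeds \<open>g 0\<close>.\<close>
  define q where "q = z - p"
  have low: "g x \<ge> \<phi> 0 + (norm (x - q))\<^sup>2 / 2 + ((norm z)\<^sup>2 - (norm q)\<^sup>2)/2" for x
  proof -
    have "\<phi> 0 + p \<bullet> x \<le> \<phi> x" using subgradD[OF p, of x] by simp
    moreover have "p \<bullet> x + (norm (x - z))\<^sup>2 / 2 = (norm (x - q))\<^sup>2 / 2 + ((norm z)\<^sup>2 - (norm q)\<^sup>2)/2"
      unfolding q_def power2_norm_eq_inner by (simp add: inner_simps inner_commute field_simps)
    ultimately show ?thesis by (simp add: g_def)
  qed
  define R where "R = norm (0 - q) + sqrt (2 * \<bar>g 0 - \<phi> 0 - ((norm z)\<^sup>2 - (norm q)\<^sup>2)/2\<bar>) + 1"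
  have R0: "R > 0" unfolding R_def by (simp add: add_nonneg_pos)
  obtain x where x: "x \<in> cball q R" "\<And>w. w \<in> cball q R \<Longrightarrow> g x \<le> g w"
    using continuous_attains_inf[of "cball q R" g] continuous_on_subset[OF cg] R0 by auto
  have "0 \<in> cball q R" by (simp add: R_def dist_norm)
  have min: "g x \<le> g w" for w
  proof (cases "w \<in> cball q R")
    case False
    then have "norm (w - q) > R" by (simp add: dist_norm norm_minus_commute)
    then have "sqrt (2 * \<bar>g 0 - \<phi> 0 - ((norm z)\<^sup>2 - (norm q)\<^sup>2)/2\<bar>) \<le> norm (w - q)"
      unfolding R_def using norm_ge_zero[of "0 - q"] by linarith
    from power_mono[OF this, of 2] have "(norm (w - q))\<^sup>2 \<ge> 2 * \<bar>g 0 - \<phi> 0 - ((norm z)\<^sup>2 - (norm q)\<^sup>2)/2\<bar>"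
      by (simp del: diff_0)
    moreover have "g 0 - \<phi> 0 - ((norm z)\<^sup>2 - (norm q)\<^sup>2)/2 \<le> \<bar>g 0 - \<phi> 0 - ((norm z)\<^sup>2 - (norm q)\<^sup>2)/2\<bar>"
      by (rule abs_ge_self)
    ultimately have "g 0 \<le> g w" using low[of w] by (simp add: field_simps)
    then show ?thesis using x(2)[OF \<open>0 \<in> cball q R\<close>] by linarith
  qed (use x in auto)
  have "subgrad \<phi> x (z - x)"
    unfolding subgrad_def
  proof
    fix w
    \<comment> \<open>Compare \<open>x\<close> with the point at fraction \<open>s\<close> of the
      way to \<open>w\<close>: after division by \<open>s\<close> the quadratic term is still of
      order \<open>s\<close> and disappears in the limit.\<close>
    have key: "\<phi> x + (z - x) \<bullet> (w - x) \<le> \<phi> w + s * (norm (w - x))\<^sup>2" if s: "0 < s" "s < 1" for s :: real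
    proof -
      have "\<phi> (x + s *\<^sub>R (w - x)) = \<phi> ((1 - s) *\<^sub>R x + s *\<^sub>R w)" by (simp add: algebra_simps)
      also have "\<dots> \<le> (1 - s) * \<phi> x + s * \<phi> w" using cv s by (auto simp: convex_on_def)
      finally have 1: "\<phi> (x + s *\<^sub>R (w - x)) \<le> (1 - s) * \<phi> x + s * \<phi> w" .
      have 2: "(norm (x + s *\<^sub>R (w - x) - z))\<^sup>2 = (norm (x - z))\<^sup>2 - 2 * s * ((z - x) \<bullet> (w - x)) + s\<^sup>2 * (norm (w - x))\<^sup>2"
        unfolding power2_norm_eq_inner by (simp add: inner_simps inner_commute power2_eq_square algebra_simps)
      have "g x \<le> g (x + s *\<^sub>R (w - x))" by (rule min)
      then have "\<phi> x \<le> (1 - s) * \<phi> x + s * \<phi> w - s * ((z - x) \<bullet> (w - x)) + s\<^sup>2 * (norm (w - x))\<^sup>2 / 2"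
        using 1 2 unfolding g_def by (simp add: field_simps)
      then have "s * (\<phi> x + (z - x) \<bullet> (w - x)) \<le> s * (\<phi> w + s * (norm (w - x))\<^sup>2 / 2)"
        by (simp add: algebra_simps power2_eq_square)
      then have "\<phi> x + (z - x) \<bullet> (w - x) \<le> \<phi> w + s * (norm (w - x))\<^sup>2 / 2"
        using s by simp
      moreover have "0 \<le> s * (norm (w - x))\<^sup>2" using s by simp
      ultimately show ?thesis by simp
    qed
    show "\<phi> x + (z - x) \<bullet> (w - x) \<le> \<phi> w"
    proof (rule field_le_epsilon)
      fix e :: real assume e: "0 < e"
      define s where "s = min (1/2) (e / ((norm (w - x))\<^sup>2 + 1))"
      have s: "0 < s" "s < 1" using e by (auto simp: s_def add_nonneg_pos)
      have "s * (norm (w - x))\<^sup>2 \<le> s * ((norm (w - x))\<^sup>2 + 1)" using s by simp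
      also have "\<dots> \<le> e / ((norm (w - x))\<^sup>2 + 1) * ((norm (w - x))\<^sup>2 + 1)"
        by (rule mult_right_mono) (auto simp: s_def)
      also have "\<dots> = e" by (simp add: add_nonneg_eq_0_iff)
      finally show "\<phi> x + (z - x) \<bullet> (w - x) \<le> \<phi> w + e" using key[OF s] by linarith
    qed
  qed
  then show thesis using that by blast
qed

section \<open>Rademacher's theorem\<close>

lemma AE_lborel_not_in_negligible:
  assumes "negligible N"
  shows "AE x in lborel. x \<notin> N"
  using AE_not_in[of N lebesgue] assms unfolding AE_completion_iff negligible_iff_null_sets .

text \<open>A Cauchy condition replaces the existence of a limit because, for continuous
  \<open>f\<close>, it is built from closed conditions by countable unions and intersections, hence
  Borel.\<close>

definition slopes_cauchy :: "('a::real_normed_vector \<Rightarrow> real) \<Rightarrow> 'a \<Rightarrow> 'a \<Rightarrow> bool" where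
  "slopes_cauchy f v x \<longleftrightarrow> (\<forall>e>0. \<exists>d>0. \<forall>s t. 0 < s \<longrightarrow> s < d \<longrightarrow> 0 < t \<longrightarrow> t < d \<longrightarrow>
      \<bar>(f (x + s *\<^sub>R v) - f x) / s - (f (x + t *\<^sub>R v) - f x) / t\<bar> \<le> e)"

lemma slopes_cauchyI:
  assumes "((\<lambda>s. (f (x + s *\<^sub>R v) - f x) / s) \<longlongrightarrow> l) (at_right 0)"
  shows "slopes_cauchy f v x"
  unfolding slopes_cauchy_def
proof (intro allI impI)
  fix e :: real assume "0 < e"
  then have "\<forall>\<^sub>F s in at_right 0. dist ((f (x + s *\<^sub>R v) - f x) / s) l < e/2"
    by (intro tendstoD[OF assms]) simp
  then obtain d where d: "0 < d" "\<And>s. 0 < s \<Longrightarrow> s < d \<Longrightarrow> dist ((f (x + s *\<^sub>R v) - f x) / s) l < e/2"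
    unfolding eventually_at_right_field by auto
  show "\<exists>d>0. \<forall>s t. 0 < s \<longrightarrow> s < d \<longrightarrow> 0 < t \<longrightarrow> t < d \<longrightarrow>
      \<bar>(f (x + s *\<^sub>R v) - f x) / s - (f (x + t *\<^sub>R v) - f x) / t\<bar> \<le> e"
  proof (intro exI conjI allI impI)
    fix s t assume "0 < s" "s < d" "0 < t" "t < d"
    then show "\<bar>(f (x + s *\<^sub>R v) - f x) / s - (f (x + t *\<^sub>R v) - f x) / t\<bar> \<le> e"
      using d(2)[of s] d(2)[of t] unfolding dist_real_def by linarith
  qed (use d in auto)
qed

definition slope_seq :: "('a::real_normed_vector \<Rightarrow> real) \<Rightarrow> 'a \<Rightarrow> nat \<Rightarrow> 'a \<Rightarrow> real" where
  "slope_seq f v n x = (f (x + (1 / Suc n) *\<^sub>R v) - f x) / (1 / Suc n)"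

text \<open>The limit runs along the steps \<open>1 / Suc n\<close>, so measurability passes to it;
  where the sequence diverges, \<open>lim\<close> has an unspecified value.\<close>

definition right_slope :: "('a::real_normed_vector \<Rightarrow> real) \<Rightarrow> 'a \<Rightarrow> 'a \<Rightarrow> real" where
  "right_slope f v x = lim (\<lambda>n. slope_seq f v n x)"

lemma slopes_cauchyD:
  assumes "slopes_cauchy f v x"
  shows "((\<lambda>s. (f (x + s *\<^sub>R v) - f x) / s) \<longlongrightarrow> right_slope f v x) (at_right 0)"
    "(\<lambda>n. slope_seq f v n x) \<longlonglongrightarrow> right_slope f v x"
proof -
  let ?q = "\<lambda>s. (f (x + s *\<^sub>R v) - f x) / s"
  have ev: "\<exists>N. \<forall>n\<ge>N. 1 / real (Suc n) < d" if "0 < d" for d :: real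
  proof -
    have "(\<lambda>n. 1 / real (Suc n)) \<longlonglongrightarrow> 0" using LIMSEQ_inverse_real_of_nat by (simp add: inverse_eq_divide)
    then have "\<forall>\<^sub>F n in sequentially. 1 / real (Suc n) < d" using that order_tendstoD(2) by blast
    then show ?thesis by (simp add: eventually_sequentially)
  qed
  have "Cauchy (\<lambda>n. slope_seq f v n x)"
  proof (rule metric_CauchyI)
    fix e :: real assume "0 < e"
    then obtain d where d: "0 < d" "\<And>s t. 0 < s \<Longrightarrow> s < d \<Longrightarrow> 0 < t \<Longrightarrow> t < d \<Longrightarrow> \<bar>?q s - ?q t\<bar> \<le> e/2"
      using assms[unfolded slopes_cauchy_def, rule_format, of "e/2"] by auto
    obtain N where N: "\<And>n. n \<ge> N \<Longrightarrow> 1 / real (Suc n) < d" using ev[OF d(1)] by blast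
    show "\<exists>M. \<forall>m\<ge>M. \<forall>n\<ge>M. dist (slope_seq f v m x) (slope_seq f v n x) < e"
    proof (intro exI allI impI)
      fix m n assume "N \<le> m" "N \<le> n"
      then have "\<bar>?q (1 / Suc m) - ?q (1 / Suc n)\<bar> \<le> e/2" by (intro d N) auto
      then show "dist (slope_seq f v m x) (slope_seq f v n x) < e"
        using \<open>0 < e\<close> by (simp add: slope_seq_def dist_real_def)
    qed
  qed
  then show lim: "(\<lambda>n. slope_seq f v n x) \<longlonglongrightarrow> right_slope f v x"
    unfolding right_slope_def by (simp add: Cauchy_convergent_iff convergent_LIMSEQ_iff)
  show "(?q \<longlongrightarrow> right_slope f v x) (at_right 0)"
  proof (rule tendstoI)
    fix e :: real assume "0 < e"
    then obtain d where d: "0 < d" "\<And>s t. 0 < s \<Longrightarrow> s < d \<Longrightarrow> 0 < t \<Longrightarrow> t < d \<Longrightarrow> \<bar>?q s - ?q t\<bar> \<le> e/2"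
      using assms[unfolded slopes_cauchy_def, rule_format, of "e/2"] by auto
    obtain N where N: "\<And>n. n \<ge> N \<Longrightarrow> 1 / real (Suc n) < d" using ev[OF d(1)] by blast
    have "dist (?q s) (right_slope f v x) < e" if s: "0 < s" "s < d" for s
    proof -
      have "(\<lambda>n. \<bar>?q s - slope_seq f v n x\<bar>) \<longlonglongrightarrow> \<bar>?q s - right_slope f v x\<bar>"
        by (intro tendsto_intros lim)
      moreover have "\<forall>n\<ge>N. \<bar>?q s - slope_seq f v n x\<bar> \<le> e/2"
        unfolding slope_seq_def by (intro allI impI d N s) auto
      ultimately have "\<bar>?q s - right_slope f v x\<bar> \<le> e/2" by (meson LIMSEQ_le_const2)
      then show ?thesis using \<open>0 < e\<close> by (simp add: dist_real_def)
    qed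
    then show "\<forall>\<^sub>F s in at_right 0. dist (?q s) (right_slope f v x) < e"
      unfolding eventually_at_right_field using d by auto
  qed
qed

text \<open>Both \<open>(s + f s) / 2\<close> and \<open>(s - f s) / 2\<close> are nondecreasing and
  they add up to \<open>s\<close>, so their Stieltjes measures add up to Lebesgue measure.\<close>

lemma interval_measure_le_lborel:
  fixes f :: "real \<Rightarrow> real"
  assumes "1-lipschitz_on UNIV f" and A: "A \<in> sets borel"
  shows "emeasure (interval_measure (\<lambda>s. (s + f s) / 2)) A \<le> emeasure lborel A"
proof -
  define g where "g s = (s + f s) / 2" for s
  define g' where "g' s = (s - f s) / 2" for s
  have lip: "\<bar>f x - f y\<bar> \<le> \<bar>x - y\<bar>" for x y
    using lipschitz_onD[OF assms(1), of x y] by (simp add: dist_real_def)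
  have mono: "g x \<le> g y" "g' x \<le> g' y" if "x \<le> y" for x y
    using lip[of x y] that unfolding g_def g'_def by (auto simp: field_simps)
  have cf: "continuous_on UNIV f" using assms(1) by (rule lipschitz_on_continuous_on)
  have cont: "continuous_on UNIV g" "continuous_on UNIV g'"
    unfolding g_def g'_def by (intro continuous_intros cf; simp)+
  let ?M = "interval_measure g" and ?M' = "interval_measure g'"
  define B where "B = measure_of UNIV (sets borel) (\<lambda>A. emeasure ?M A + emeasure ?M' A)"
  have sB: "sets B = sets borel" unfolding B_def
    using sets.sigma_sets_eq[of "borel :: real measure"] by (simp add: sets_measure_of_conv)
  have eB: "emeasure B A = emeasure ?M A + emeasure ?M' A" if "A \<in> sets borel" for A
    unfolding B_def
  proof (rule emeasure_measure_of_sigma)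
    show "sigma_algebra UNIV (sets borel)" using sets.sigma_algebra_axioms[of borel] by simp
    show "positive (sets borel) (\<lambda>A. emeasure ?M A + emeasure ?M' A)" by (simp add: positive_def)
    show "countably_additive (sets borel) (\<lambda>A. emeasure ?M A + emeasure ?M' A)"
    proof (rule countably_additiveI)
      fix A :: "nat \<Rightarrow> real set" assume "range A \<subseteq> sets borel" "disjoint_family A" "\<Union> (range A) \<in> sets borel"
      then show "(\<Sum>i. emeasure ?M (A i) + emeasure ?M' (A i)) = emeasure ?M (\<Union> (range A)) + emeasure ?M' (\<Union> (range A))"
        by (simp add: suminf_add[symmetric] suminf_emeasure)
    qed
  qed (use that in auto)
  have box: "emeasure (interval_measure h) {l<..<u} = h u - h l"
    if h: "\<And>x y. x \<le> y \<Longrightarrow> h x \<le> h y" "continuous_on UNIV h" and "l \<le> u" for h :: "real \<Rightarrow> real" and l u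
  proof (cases "l < u")
    case True
    have "emeasure (interval_measure h) {l<..u} = emeasure (interval_measure h) ({l<..<u} \<union> {u..u})"
      using True by (intro arg_cong[where f="emeasure (interval_measure h)"]) auto
    also have "\<dots> = emeasure (interval_measure h) {l<..<u} + emeasure (interval_measure h) {u..u}"
      by (rule plus_emeasure[symmetric]) auto
    also have "emeasure (interval_measure h) {u..u} = 0"
      by (subst emeasure_interval_measure_Icc) (use h in auto)
    also have "emeasure (interval_measure h) {l<..u} = h u - h l"
      using h True by (subst emeasure_interval_measure_Ioc) (auto simp: continuous_on_eq_continuous_within intro: continuous_within_subset)
    finally show ?thesis by simp
  qed (use \<open>l \<le> u\<close> in simp)
  have "lborel = B"
  proof (rule lborel_eqI)
    fix l u :: real assume "\<And>b. b \<in> Basis \<Longrightarrow> l \<bullet> b \<le> u \<bullet> b"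
    then have lu: "l \<le> u" by simp
    have "emeasure B {l<..<u} = ennreal (g u - g l) + ennreal (g' u - g' l)"
      by (subst eB) (auto simp: box mono cont lu)
    also have "\<dots> = ennreal (g u - g l + (g' u - g' l))"
      using mono[OF lu] by (simp add: ennreal_plus)
    also have "g u - g l + (g' u - g' l) = u - l" by (simp add: g_def g'_def field_simps)
    finally show "emeasure B (box l u) = ennreal (\<Prod>b\<in>Basis. (u - l) \<bullet> b)" by simp
  qed (use sB in simp)
  then have "emeasure lborel A = emeasure ?M A + emeasure ?M' A" using eB[OF A] by simp
  then show ?thesis unfolding g_def[abs_def] by (simp add: le_iff_add)
qed

text \<open>The domination above gives absolute continuity, and Radon-Nikodym a density
  \<open>k\<close> of the Stieltjes measure of \<open>(s + f s) / 2\<close>. As \<open>f\<close> is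
  twice this function minus the identity, its density is 2 k - 1.\<close>

lemma lipschitz_real_has_density:
  fixes f :: "real \<Rightarrow> real"
  assumes lip: "1-lipschitz_on UNIV f"
  obtains r where "\<And>a b. a \<le> b \<Longrightarrow> (r has_integral (f b - f a)) {a..b}"
proof -
  define g where "g s = (s + f s) / 2" for s
  have l: "\<bar>f x - f y\<bar> \<le> \<bar>x - y\<bar>" for x y
    using lipschitz_onD[OF lip, of x y] by (simp add: dist_real_def)
  have mono: "g x \<le> g y" if "x \<le> y" for x y
    using l[of x y] that unfolding g_def by (auto simp: field_simps)
  have cf: "continuous_on UNIV f" using lip by (rule lipschitz_on_continuous_on)
  have cont: "continuous_on UNIV g" unfolding g_def by (intro continuous_intros cf) auto
  let ?M = "interval_measure g"
  have "absolutely_continuous lborel ?M"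
    unfolding absolutely_continuous_def
  proof
    fix A :: "real set" assume "A \<in> null_sets lborel"
    then show "A \<in> null_sets ?M"
      using interval_measure_le_lborel[OF lip, of A] unfolding null_sets_def g_def[abs_def, symmetric] by auto
  qed
  then obtain k where k: "k \<in> borel_measurable lborel" "density lborel k = ?M"
    using sigma_finite_measure.Radon_Nikodym[OF sigma_finite_lborel, of ?M] by auto
  have kint: "(\<integral>\<^sup>+x. k x * indicator {a..b} x \<partial>lborel) = ennreal (g b - g a)" if "a \<le> b" for a b
  proof -
    have "(\<integral>\<^sup>+x. k x * indicator {a..b} x \<partial>lborel) = emeasure ?M {a..b}"
      unfolding k(2)[symmetric] using k(1) by (subst emeasure_density) auto
    also have "\<dots> = ennreal (g b - g a)" using that mono cont by (rule emeasure_interval_measure_Icc)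
    finally show ?thesis .
  qed
  have fin: "AE x in lborel. k x * indicator {a..b} x \<noteq> \<infinity>" if "a \<le> b" for a b
    by (rule nn_integral_PInf_AE) (use k kint[OF that] in auto)
  have kr: "((\<lambda>x. enn2real (k x)) has_integral (g b - g a)) {a..b}" if "a \<le> b" for a b
  proof -
    have "(\<integral>\<^sup>+x. ennreal (enn2real (k x) * indicator {a..b} x) \<partial>lborel) = (\<integral>\<^sup>+x. k x * indicator {a..b} x \<partial>lborel)"
      using fin[OF that]
      by (intro nn_integral_cong_AE, eventually_elim) (auto simp: indicator_def less_top)
    then have "((\<lambda>x. enn2real (k x) * indicator {a..b} x) has_integral (g b - g a)) UNIV"
      using k(1) mono[OF that] kint[OF that]
      by (intro nn_integral_has_integral) auto
    moreover have "(\<lambda>x. enn2real (k x) * indicator {a..b} x) = (\<lambda>x. if x \<in> {a..b} then enn2real (k x) else 0)"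
      by auto
    ultimately show ?thesis by (simp only: has_integral_restrict_UNIV)
  qed
  have "((\<lambda>x. 2 * enn2real (k x) - 1) has_integral (f b - f a)) {a..b}" if "a \<le> b" for a b
  proof -
    have "((\<lambda>x. 2 * enn2real (k x) - 1) has_integral (2 * (g b - g a) - measure lborel {a..b} *\<^sub>R 1)) {a..b}"
      using has_integral_const_real[of "1::real" a b]
      by (intro has_integral_diff has_integral_mult_right kr that) auto
    moreover have "2 * (g b - g a) - measure lborel {a..b} *\<^sub>R 1 = f b - f a"
      using that by (simp add: g_def field_simps)
    ultimately show ?thesis by simp
  qed
  then show thesis using that by blast
qed

lemma AE_slopes_cauchy_real:
  fixes f :: "real \<Rightarrow> real"
  assumes lip: "C-lipschitz_on UNIV f"
  shows "AE s in lborel. slopes_cauchy f 1 s"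
proof -
  \<comment> \<open>Adding 1 keeps the rescaling meaningful for \<open>C = 0\<close>.\<close>
  define K where "K = C + 1"
  have K: "K > 0" using lipschitz_on_nonneg[OF lip] by (simp add: K_def)
  define F where "F s = f s / K" for s
  have "1-lipschitz_on UNIV F"
  proof (rule lipschitz_onI)
    fix x y :: real
    have "dist (f x) (f y) \<le> C * dist x y" by (rule lipschitz_onD[OF lip]) auto
    also have "\<dots> \<le> K * dist x y" by (simp add: K_def mult_right_mono)
    finally show "dist (F x) (F y) \<le> 1 * dist x y"
      using K unfolding F_def dist_real_def by (simp add: diff_divide_distrib[symmetric] pos_divide_le_eq mult.commute)
  qed auto
  then obtain r where r: "\<And>a b. a \<le> b \<Longrightarrow> (r has_integral (F b - F a)) {a..b}"
    by (erule lipschitz_real_has_density)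
  have "r integrable_on cbox a b" for a b :: real
    using r[of a b] by (cases "a \<le> b") (auto simp: integrable_on_def)
  \<comment> \<open>Lebesgue differentiation: the averages of \<open>r\<close> over short intervals
    to the right of \<open>x\<close> are right slopes of \<open>F\<close>, and they converge off a
    null set.\<close>
  from integrable_ccontinuous_explicit[OF this] obtain N where N: "negligible N"
    "\<And>x e. \<lbrakk>x \<notin> N; 0 < e\<rbrakk> \<Longrightarrow> \<exists>d>0. \<forall>h. 0 < h \<and> h < d \<longrightarrow>
       norm(integral (cbox x (x + h *\<^sub>R One)) r /\<^sub>R h ^ DIM(real) - r x) < e" by blast
  have "slopes_cauchy f 1 x" if xN: "x \<notin> N" for x
  proof (rule slopes_cauchyI)
    have "((\<lambda>s. (F (x + s) - F x) / s) \<longlongrightarrow> r x) (at_right 0)"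
    proof (rule tendstoI)
      fix e :: real assume "0 < e"
      then obtain d where d: "0 < d" "\<And>h. 0 < h \<Longrightarrow> h < d \<Longrightarrow> norm(integral {x..x + h} r /\<^sub>R h - r x) < e"
        using N(2)[OF xN] by force
      have "dist ((F (x + s) - F x) / s) (r x) < e" if s: "0 < s" "s < d" for s
        using d(2)[OF s] integral_unique[OF r[of x "x + s"]] s by (simp add: dist_real_def divide_inverse mult.commute)
      then show "\<forall>\<^sub>F s in at_right 0. dist ((F (x + s) - F x) / s) (r x) < e"
        unfolding eventually_at_right_field using d by auto
    qed
    then have "((\<lambda>s. K * ((F (x + s) - F x) / s)) \<longlongrightarrow> K * r x) (at_right 0)" by (intro tendsto_intros)
    moreover have "(\<lambda>s. K * ((F (x + s) - F x) / s)) = (\<lambda>s. (f (x + s *\<^sub>R 1) - f x) / s)"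
      using K by (simp add: F_def diff_divide_distrib[symmetric])
    ultimately show "((\<lambda>s. (f (x + s *\<^sub>R 1) - f x) / s) \<longlongrightarrow> K * r x) (at_right 0)" by (simp only:)
  qed
  then show ?thesis
    using AE_lborel_not_in_negligible[OF N(1)] by auto
qed

text \<open>For a fixed tolerance and a fixed radius the condition is an intersection of closed
  sets, over uncountably many \<open>s\<close> and \<open>t\<close>; countability is required of
  tolerances and radii only.\<close>

lemma sets_slopes_cauchy:
  fixes f :: "'a::euclidean_space \<Rightarrow> real"
  assumes cf: "continuous_on UNIV f"
  shows "{x. slopes_cauchy f v x} \<in> sets borel"
proof -
  define B where "B k m = (\<Inter>s\<in>{0<..<1 / Suc m}. \<Inter>t\<in>{0<..<1 / Suc m}.
     {x. \<bar>(f (x + s *\<^sub>R v) - f x) / s - (f (x + t *\<^sub>R v) - f x) / t\<bar> \<le> 1 / Suc k})" for k m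
  have "closed (B k m)" for k m
    unfolding B_def by (intro closed_INT ballI closed_Collect_le continuous_intros
       continuous_on_compose2[OF cf]) auto
  then have "(\<Inter>k. \<Union>m. B k m) \<in> sets borel" by (auto intro!: sets.countable_INT sets.countable_UN)
  also have "(\<Inter>k. \<Union>m. B k m) = {x. slopes_cauchy f v x}"
  proof (intro set_eqI iffI)
    fix x assume x: "x \<in> (\<Inter>k. \<Union>m. B k m)"
    show "x \<in> {x. slopes_cauchy f v x}"
      unfolding mem_Collect_eq slopes_cauchy_def
    proof (intro allI impI)
      fix e :: real assume "0 < e"
      then obtain k where k: "1 / real (Suc k) < e" using nat_approx_posE by blast
      from x obtain m where m: "x \<in> B k m" by auto
      show "\<exists>d>0. \<forall>s t. 0 < s \<longrightarrow> s < d \<longrightarrow> 0 < t \<longrightarrow> t < d \<longrightarrow>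
          \<bar>(f (x + s *\<^sub>R v) - f x) / s - (f (x + t *\<^sub>R v) - f x) / t\<bar> \<le> e"
        using m k by (intro exI[of _ "1 / real (Suc m)"]) (force simp: B_def)
    qed
  next
    fix x assume x: "x \<in> {x. slopes_cauchy f v x}"
    have "\<exists>m. x \<in> B k m" for k
    proof -
      have "0 < 1 / real (Suc k)" by simp
      then obtain d where d: "0 < d" "\<And>s t. 0 < s \<Longrightarrow> s < d \<Longrightarrow> 0 < t \<Longrightarrow> t < d \<Longrightarrow>
         \<bar>(f (x + s *\<^sub>R v) - f x) / s - (f (x + t *\<^sub>R v) - f x) / t\<bar> \<le> 1 / real (Suc k)"
        using x unfolding mem_Collect_eq slopes_cauchy_def by blast
      obtain m where m: "1 / real (Suc m) < d" using d(1) nat_approx_posE by blast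
      show ?thesis unfolding B_def using d(2) m by (intro exI[of _ m]) auto
    qed
    then show "x \<in> (\<Inter>k. \<Union>m. B k m)" by auto
  qed
  finally show ?thesis .
qed

lemma AE_lborel_translate:
  fixes c :: "'a::euclidean_space"
  assumes "AE x in lborel. P (x + c)"
  shows "AE x in lborel. P x"
proof -
  from assms obtain N where N: "{x. \<not> P (x + c)} \<subseteq> N" "N \<in> null_sets lborel"
    unfolding eventually_ae_filter by auto
  have "N \<in> null_sets (distr lborel borel ((+) (- c)))" using N(2) by (subst lborel_distr_plus)
  then have "(+) (- c) -` N \<in> null_sets lborel" by (subst (asm) null_sets_distr_iff) auto
  moreover have "{x \<in> space lborel. \<not> P x} \<subseteq> (+) (- c) -` N"
  proof
    fix x assume "x \<in> {x \<in> space lborel. \<not> P x}"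
    then have "\<not> P ((x - c) + c)" by simp
    then show "x \<in> (+) (- c) -` N" using N(1) by auto
  qed
  ultimately show ?thesis by (rule AE_I')
qed

text \<open>Fubini in the product of the space with a line parallel to \<open>v\<close> reduces this to one variable.\<close>
lemma AE_slopes_cauchy:
  fixes f :: "'a::euclidean_space \<Rightarrow> real"
  assumes lip: "C-lipschitz_on UNIV f"
  shows "AE x in lborel. slopes_cauchy f v x"
proof -
  have cf: "continuous_on UNIV f" using lip by (rule lipschitz_on_continuous_on)
  note [measurable] = sets_slopes_cauchy[OF cf, of v]
  have "AE s in lborel. slopes_cauchy f v (x + s *\<^sub>R v)" for x
  proof -
    have "(C * norm v)-lipschitz_on UNIV (\<lambda>s. f (x + s *\<^sub>R v))"
    proof (rule lipschitz_onI)
      fix s t :: real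
      have "dist (f (x + s *\<^sub>R v)) (f (x + t *\<^sub>R v)) \<le> C * dist (x + s *\<^sub>R v) (x + t *\<^sub>R v)"
        by (rule lipschitz_onD[OF lip]) auto
      also have "\<dots> = C * norm v * dist s t"
        by (simp add: dist_norm scaleR_diff_left[symmetric])
      finally show "dist (f (x + s *\<^sub>R v)) (f (x + t *\<^sub>R v)) \<le> C * norm v * dist s t" .
    qed (simp add: lipschitz_on_nonneg[OF lip])
    from AE_slopes_cauchy_real[OF this] show ?thesis
      by eventually_elim (simp add: slopes_cauchy_def algebra_simps)
  qed
  then have 1: "AE x in lborel. AE s in lborel. slopes_cauchy f v (x + s *\<^sub>R v)" by simp
  have "{z :: 'a \<times> real. slopes_cauchy f v (fst z + snd z *\<^sub>R v)} = (\<lambda>z. fst z + snd z *\<^sub>R v) -` {x. slopes_cauchy f v x} \<inter> space borel"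
    by auto
  also have "\<dots> \<in> sets borel"
    by (rule measurable_sets[OF _ sets_slopes_cauchy[OF cf]])
       (intro borel_measurable_continuous_onI continuous_intros)
  finally have "{z \<in> space (lborel \<Otimes>\<^sub>M lborel) :: ('a \<times> real) set. slopes_cauchy f v (fst z + snd z *\<^sub>R v)}
     \<in> sets (lborel \<Otimes>\<^sub>M lborel)"
    unfolding lborel_prod by simp
  from lborel_pair.AE_commute[OF this] 1
  have "AE s in lborel. AE x in lborel. slopes_cauchy f v (x + s *\<^sub>R v)" by simp
  then have "\<exists>s::real. AE x in lborel. slopes_cauchy f v (x + s *\<^sub>R v)"
    using eventually_happens'[of "ae_filter (lborel :: real measure)"] by (simp add: ae_filter_eq_bot_iff)
  then show ?thesis using AE_lborel_translate by blast
qed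

lemma slope_seq_bound:
  assumes lip: "C-lipschitz_on UNIV f"
  shows "\<bar>slope_seq f v n x\<bar> \<le> C * norm v"
proof -
  have "\<bar>f (x + (1 / Suc n) *\<^sub>R v) - f x\<bar> \<le> C * norm ((1 / Suc n) *\<^sub>R v)"
    using lipschitz_onD[OF lip, of "x + (1 / Suc n) *\<^sub>R v" x] by (simp add: dist_norm)
  also have "\<dots> = C * norm v * (1 / Suc n)" by simp
  finally have *: "\<bar>f (x + (1 / Suc n) *\<^sub>R v) - f x\<bar> \<le> C * norm v * (1 / Suc n)" .
  have "\<bar>slope_seq f v n x\<bar> = \<bar>f (x + (1 / Suc n) *\<^sub>R v) - f x\<bar> * Suc n"
    by (simp add: slope_seq_def abs_mult)
  also have "\<dots> \<le> C * norm v * (1 / Suc n) * Suc n"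
    using * by (intro mult_right_mono) auto
  finally show ?thesis by simp
qed

text \<open>Lebesgue differentiation over cubes with corner \<open>x\<close>: all averages are zero,
  and off a null set they converge to \<open>g x\<close>.\<close>

lemma AE_zero_of_box_integrals:
  fixes g :: "'a::euclidean_space \<Rightarrow> real"
  assumes "\<And>a b. (g has_integral 0) (cbox a b)"
  shows "AE x in lborel. g x = 0"
proof -
  have "g integrable_on cbox a b" for a b using assms by (auto simp: integrable_on_def)
  from integrable_ccontinuous_explicit[OF this] obtain N where N: "negligible N"
    "\<And>x e. \<lbrakk>x \<notin> N; 0 < e\<rbrakk> \<Longrightarrow> \<exists>d>0. \<forall>h. 0 < h \<and> h < d \<longrightarrow>
       norm(integral (cbox x (x + h *\<^sub>R One)) g /\<^sub>R h ^ DIM('a) - g x) < e" by blast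
  have "g x = 0" if xN: "x \<notin> N" for x
  proof (rule ccontr)
    assume "g x \<noteq> 0"
    then obtain d where "d > 0" "\<forall>h. 0 < h \<and> h < d \<longrightarrow>
       norm(integral (cbox x (x + h *\<^sub>R One)) g /\<^sub>R h ^ DIM('a) - g x) < \<bar>g x\<bar>"
      using N(2)[OF xN, of "\<bar>g x\<bar>"] by auto
    then have "norm(integral (cbox x (x + (d/2) *\<^sub>R One)) g /\<^sub>R (d/2) ^ DIM('a) - g x) < \<bar>g x\<bar>" by simp
    then show False using integral_unique[OF assms] by simp
  qed
  then show ?thesis
    using AE_lborel_not_in_negligible[OF N(1)] by auto
qed

text \<open>Integrating \<open>slope_seq f (v + w) n x = slope_seq f v n (x + w / Suc n) + slope_seq f w n x\<close> over a box and
  moving the translation to the box gives additivity after passing to the limit.\<close>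
lemma AE_right_slope_add:
  fixes f :: "'a::euclidean_space \<Rightarrow> real"
  assumes lip: "C-lipschitz_on UNIV f"
  shows "AE x in lborel. right_slope f (v + w) x = right_slope f v x + right_slope f w x"
proof -
  have cf: "continuous_on UNIV f" using lip by (rule lipschitz_on_continuous_on)
  have cs: "continuous_on UNIV (slope_seq f v n)" for v n
    unfolding slope_seq_def[abs_def] by (intro continuous_intros continuous_on_compose2[OF cf]) auto
  have ms[measurable]: "slope_seq f v n \<in> borel_measurable borel" for v n
    by (rule borel_measurable_continuous_onI[OF cs])
  have mr[measurable]: "right_slope f v \<in> borel_measurable borel" for v
    unfolding right_slope_def[abs_def] by (rule borel_measurable_lim_metric) (rule ms)
  have lim: "AE x in lborel. (\<lambda>n. slope_seq f v n x) \<longlonglongrightarrow> right_slope f v x" for v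
    using AE_slopes_cauchy[OF lip, of v] by eventually_elim (rule slopes_cauchyD)
  have C0: "0 \<le> C" by (rule lipschitz_on_nonneg[OF lip])
  have bd: "AE x in lborel. \<bar>right_slope f v x\<bar> \<le> C * norm v" for v
    using lim[of v]
  proof eventually_elim
    case (elim x)
    then have "(\<lambda>n. \<bar>slope_seq f v n x\<bar>) \<longlonglongrightarrow> \<bar>right_slope f v x\<bar>" by (intro tendsto_intros)
    then show ?case by (rule LIMSEQ_le_const2) (use slope_seq_bound[OF lip] in blast)
  qed
  have box0: "((\<lambda>x. right_slope f (v + w) x - right_slope f v x - right_slope f w x) has_integral 0) (cbox a b)" for a b
  proof -
    define I where "I x = (indicator (cbox a b) x :: real)" for x
    define s where "s n = 1 / real (Suc n)" for n
    have s0: "s \<longlonglongrightarrow> 0" unfolding s_def using LIMSEQ_inverse_real_of_nat by (simp add: inverse_eq_divide)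
    have s1: "0 < s n" "s n \<le> 1" for n by (auto simp: s_def)
    have [measurable]: "I \<in> borel_measurable borel" unfolding I_def by measurable
    have intI: "integrable lborel (\<lambda>x. indicator S x * (K::real))" if "bounded S" "S \<in> sets borel" for S :: "'a set" and K
      using emeasure_bounded_finite[OF that(1)] that(2) by (intro integrable_mult_left integrable_real_indicator) auto
    have int0: "integrable lborel (\<lambda>x. I x * right_slope f u x)" for u
    proof (rule Bochner_Integration.integrable_bound)
      show "integrable lborel (\<lambda>x. indicator (cbox a b) x * (C * norm u))" by (rule intI) (auto simp: bounded_cbox)
      show "AE x in lborel. norm (I x * right_slope f u x) \<le> norm (indicator (cbox a b) x * (C * norm u))"
        using bd[of u] by eventually_elim (use C0 in \<open>auto simp: I_def indicator_def\<close>)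
    qed simp
    have lim1: "(\<lambda>n. \<integral>x. I x * slope_seq f u n x \<partial>lborel) \<longlonglongrightarrow> (\<integral>x. I x * right_slope f u x \<partial>lborel)"
       "integrable lborel (\<lambda>x. I x * slope_seq f u n x)" for u n
    proof -
      have i: "integrable lborel (\<lambda>x. indicator (cbox a b) x * (C * norm u))" by (rule intI) (auto simp: bounded_cbox)
      have b: "AE x in lborel. norm (I x * slope_seq f u n x) \<le> indicator (cbox a b) x * (C * norm u)" for n
        using slope_seq_bound[OF lip, of u] by (auto simp: I_def indicator_def)
      have l: "AE x in lborel. (\<lambda>n. I x * slope_seq f u n x) \<longlonglongrightarrow> I x * right_slope f u x"
        using lim[of u] by eventually_elim (intro tendsto_intros)
      show "(\<lambda>n. \<integral>x. I x * slope_seq f u n x \<partial>lborel) \<longlonglongrightarrow> (\<integral>x. I x * right_slope f u x \<partial>lborel)"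
        by (rule integral_dominated_convergence[OF _ _ i l b]) auto
      show "integrable lborel (\<lambda>x. I x * slope_seq f u n x)"
        by (rule integrable_dominated_convergence2[OF _ _ i l b]) auto
    qed
    obtain R where R: "\<And>x. x \<in> cbox a b \<Longrightarrow> norm x \<le> R"
      using bounded_cbox[of a b] by (auto simp: bounded_iff)
    \<comment> \<open>The indicators of the shifted boxes converge to that of the box except on its
      boundary, which is negligible.\<close>
    have frontier: "AE x in lborel. x \<notin> cbox a b - box a b"
      by (rule AE_lborel_not_in_negligible[OF negligible_frontier_interval])
    have lim2: "(\<lambda>n. \<integral>x. I (x - s n *\<^sub>R w) * slope_seq f v n x \<partial>lborel) \<longlonglongrightarrow> (\<integral>x. I x * right_slope f v x \<partial>lborel)"
      "integrable lborel (\<lambda>x. I (x - s n *\<^sub>R w) * slope_seq f v n x)" for n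
    proof -
      \<comment> \<open>The ball of radius \<open>R + norm w\<close> contains all the shifted boxes
        because \<open>s n \<le> 1\<close>, so the bound is uniform in \<open>n\<close>.\<close>
      let ?D = "\<lambda>x. indicator (cball (0::'a) (R + norm w)) x * (C * norm v)"
      have i: "integrable lborel ?D" by (rule intI) (auto simp: bounded_cball)
      have b: "AE x in lborel. norm (I (x - s n *\<^sub>R w) * slope_seq f v n x) \<le> ?D x" for n
      proof (rule AE_I2)
        fix x
        have "norm x \<le> R + norm w" if "x - s n *\<^sub>R w \<in> cbox a b"
        proof -
          have "norm x \<le> norm (x - s n *\<^sub>R w) + norm (s n *\<^sub>R w)"
            using norm_triangle_ineq[of "x - s n *\<^sub>R w" "s n *\<^sub>R w"] by simp
          also have "norm (s n *\<^sub>R w) \<le> norm w" using s1[of n] by (simp add: mult_left_le_one_le)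
          finally show ?thesis using R[OF that] by linarith
        qed
        then show "norm (I (x - s n *\<^sub>R w) * slope_seq f v n x) \<le> ?D x"
          using slope_seq_bound[OF lip, of v n x] C0 by (auto simp: I_def indicator_def)
      qed
      have l: "AE x in lborel. (\<lambda>n. I (x - s n *\<^sub>R w) * slope_seq f v n x) \<longlonglongrightarrow> I x * right_slope f v x"
        using lim[of v] frontier
      proof eventually_elim
        case (elim x)
        have "(\<lambda>n. x - s n *\<^sub>R w) \<longlonglongrightarrow> x - 0 *\<^sub>R w" by (intro tendsto_intros s0)
        then have t: "(\<lambda>n. x - s n *\<^sub>R w) \<longlonglongrightarrow> x" by simp
        have "\<forall>\<^sub>F n in sequentially. I (x - s n *\<^sub>R w) = I x"
        proof (cases "x \<in> box a b")
          case True
          have one: "I y = 1" if "y \<in> box a b" for y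
            using that box_subset_cbox[of a b] by (auto simp: I_def)
          have "\<forall>\<^sub>F n in sequentially. x - s n *\<^sub>R w \<in> box a b"
            using topological_tendstoD[OF t open_box True] .
          then show ?thesis
            by eventually_elim (simp add: one True)
        next
          case False
          then have x: "x \<in> - cbox a b" using elim(2) by auto
          have zero: "I y = 0" if "y \<in> - cbox a b" for y
            using that by (auto simp: I_def)
          have "\<forall>\<^sub>F n in sequentially. x - s n *\<^sub>R w \<in> - cbox a b"
            by (rule topological_tendstoD[OF t _ x]) (intro open_Compl closed_cbox)
          then show ?thesis by eventually_elim (simp only: zero zero[OF x])
        qed
        then have "(\<lambda>n. I (x - s n *\<^sub>R w)) \<longlonglongrightarrow> I x" by (rule tendsto_eventually)
        then show ?case using elim by (intro tendsto_intros)
      qed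
      show "(\<lambda>n. \<integral>x. I (x - s n *\<^sub>R w) * slope_seq f v n x \<partial>lborel) \<longlonglongrightarrow> (\<integral>x. I x * right_slope f v x \<partial>lborel)"
        by (rule integral_dominated_convergence[OF _ _ i l b]) auto
      show "integrable lborel (\<lambda>x. I (x - s n *\<^sub>R w) * slope_seq f v n x)"
        by (rule integrable_dominated_convergence2[OF _ _ i l b]) auto
    qed
    have shift: "(\<integral>x. I x * slope_seq f v n (x + s n *\<^sub>R w) \<partial>lborel) = (\<integral>x. I (x - s n *\<^sub>R w) * slope_seq f v n x \<partial>lborel)"
        "integrable lborel (\<lambda>x. I x * slope_seq f v n (x + s n *\<^sub>R w))" for n
    proof -
      let ?h = "\<lambda>x. I (x - s n *\<^sub>R w) * slope_seq f v n x"
      have "(\<integral>x. ?h x \<partial>lborel) = (\<integral>x. ?h x \<partial>distr lborel borel ((+) (s n *\<^sub>R w)))" by (simp add: lborel_distr_plus)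
      also have "\<dots> = (\<integral>x. I x * slope_seq f v n (x + s n *\<^sub>R w) \<partial>lborel)"
        by (subst integral_distr) (auto simp: add.commute)
      finally show "(\<integral>x. I x * slope_seq f v n (x + s n *\<^sub>R w) \<partial>lborel) = (\<integral>x. ?h x \<partial>lborel)" by simp
      have "integrable (distr lborel borel ((+) (s n *\<^sub>R w))) ?h" using lim2(2)[of n] by (simp add: lborel_distr_plus)
      then show "integrable lborel (\<lambda>x. I x * slope_seq f v n (x + s n *\<^sub>R w))"
        by (subst (asm) integrable_distr_eq) (auto simp: add.commute)
    qed
    have split: "slope_seq f (v + w) n x = slope_seq f v n (x + s n *\<^sub>R w) + slope_seq f w n x" for n x
      unfolding slope_seq_def s_def by (simp add: algebra_simps add_divide_distrib[symmetric] diff_divide_distrib[symmetric])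
    have "(\<integral>x. I x * slope_seq f (v + w) n x \<partial>lborel) =
        (\<integral>x. I (x - s n *\<^sub>R w) * slope_seq f v n x \<partial>lborel) + (\<integral>x. I x * slope_seq f w n x \<partial>lborel)" for n
      unfolding split distrib_left shift(1)[symmetric]
      by (rule Bochner_Integration.integral_add[OF shift(2) lim1(2)])
    moreover have "(\<lambda>n. (\<integral>x. I (x - s n *\<^sub>R w) * slope_seq f v n x \<partial>lborel) + (\<integral>x. I x * slope_seq f w n x \<partial>lborel))
       \<longlonglongrightarrow> (\<integral>x. I x * right_slope f v x \<partial>lborel) + (\<integral>x. I x * right_slope f w x \<partial>lborel)"
      by (intro tendsto_intros lim1 lim2)
    ultimately have eq: "(\<integral>x. I x * right_slope f (v + w) x \<partial>lborel) = (\<integral>x. I x * right_slope f v x \<partial>lborel) + (\<integral>x. I x * right_slope f w x \<partial>lborel)"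
      using LIMSEQ_unique[OF lim1(1)[of "v + w"]] by simp
    let ?g = "\<lambda>x. I x * right_slope f (v + w) x - I x * right_slope f v x - I x * right_slope f w x"
    have "integrable lborel ?g" by (intro Bochner_Integration.integrable_diff int0)
    then have "(?g has_integral (\<integral>x. ?g x \<partial>lborel)) UNIV" by (rule has_integral_integral_lborel)
    moreover have "(\<integral>x. ?g x \<partial>lborel) = 0" using eq by (simp add: int0)
    moreover have "?g = (\<lambda>x. if x \<in> cbox a b then right_slope f (v + w) x - right_slope f v x - right_slope f w x else 0)"
      by (auto simp: I_def)
    ultimately show ?thesis by (simp only: has_integral_restrict_UNIV)
  qed
  show ?thesis
    using AE_zero_of_box_integrals[OF box0] by eventually_elim simp
qed

lemma right_slope_scaleR:
  assumes c: "0 < c" and d: "slopes_cauchy f v x"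
  shows "slopes_cauchy f (c *\<^sub>R v) x" "right_slope f (c *\<^sub>R v) x = c * right_slope f v x"
proof -
  have "filterlim (\<lambda>s. s * c) (at_right 0) (at_right (0::real))"
    unfolding filterlim_at
  proof
    show "\<forall>\<^sub>F s in at_right 0. s * c \<in> {0<..} \<and> s * c \<noteq> 0"
      using eventually_at_right_less[of "0::real"] by eventually_elim (use c in auto)
  qed (auto intro!: tendsto_eq_intros)
  with slopes_cauchyD(1)[OF d] have "((\<lambda>s. (f (x + (s * c) *\<^sub>R v) - f x) / (s * c)) \<longlongrightarrow> right_slope f v x) (at_right 0)"
    by (rule filterlim_compose)
  then have "((\<lambda>s. c * ((f (x + (s * c) *\<^sub>R v) - f x) / (s * c))) \<longlongrightarrow> c * right_slope f v x) (at_right 0)"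
    by (intro tendsto_intros)
  moreover have "(\<lambda>s. c * ((f (x + (s * c) *\<^sub>R v) - f x) / (s * c))) = (\<lambda>s. (f (x + s *\<^sub>R c *\<^sub>R v) - f x) / s)"
    using c by auto
  ultimately have l: "((\<lambda>s. (f (x + s *\<^sub>R c *\<^sub>R v) - f x) / s) \<longlongrightarrow> c * right_slope f v x) (at_right 0)"
    by simp
  then show sc: "slopes_cauchy f (c *\<^sub>R v) x" by (rule slopes_cauchyI)
  show "right_slope f (c *\<^sub>R v) x = c * right_slope f v x"
    using tendsto_unique[OF _ slopes_cauchyD(1)[OF sc] l] by simp
qed

text \<open>Along countably many directions the existence and additivity of slopes hold off a single
  null set. The closure properties give rational linearity there, and density gives access to all
  other directions.\<close>

lemma countable_rational_vectors:
  obtains D :: "'a::euclidean_space set" where "countable D" "Basis \<subseteq> D"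
    "\<And>v w. v \<in> D \<Longrightarrow> w \<in> D \<Longrightarrow> v + w \<in> D" "\<And>v q. v \<in> D \<Longrightarrow> q \<in> \<rat> \<Longrightarrow> q *\<^sub>R v \<in> D"
    "\<And>v e. 0 < e \<Longrightarrow> \<exists>w\<in>D. dist w v < e"
    "\<And>v b. v \<in> D \<Longrightarrow> b \<in> Basis \<Longrightarrow> v \<bullet> b \<in> \<rat>"
proof
  define D :: "'a set" where "D = {v. \<forall>b\<in>Basis. v \<bullet> b \<in> \<rat>}"
  show "countable D"
  proof (rule countable_subset)
    show "D \<subseteq> (\<lambda>f. \<Sum>b\<in>Basis. f b *\<^sub>R b) ` (PiE Basis (\<lambda>_. \<rat>))"
    proof
      fix v assume "v \<in> D"
      then have "(\<lambda>b\<in>Basis. v \<bullet> b) \<in> PiE Basis (\<lambda>_. \<rat>)" by (auto simp: D_def)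
      moreover have "v = (\<Sum>b\<in>Basis. (\<lambda>b\<in>Basis. v \<bullet> b) b *\<^sub>R b)" by (simp add: euclidean_representation)
      ultimately show "v \<in> (\<lambda>f. \<Sum>b\<in>Basis. f b *\<^sub>R b) ` (PiE Basis (\<lambda>_. \<rat>))" by blast
    qed
    show "countable ((\<lambda>f. \<Sum>b\<in>Basis. f b *\<^sub>R b :: 'a) ` (PiE Basis (\<lambda>_. \<rat>)))"
      by (intro countable_image countable_PiE) (auto simp: countable_rat)
  qed
  show "\<exists>w\<in>D. dist w v < e" if "0 < e" for v e
  proof -
    define r where "r = e / (real DIM('a) + 1)"
    have r: "r > 0" using that by (simp add: r_def)
    have "\<forall>b. \<exists>q\<in>\<rat>. v \<bullet> b < q \<and> q < v \<bullet> b + r" using Rats_dense_in_real r by simp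
    then obtain q where q: "\<And>b. q b \<in> \<rat>" "\<And>b. v \<bullet> b < q b" "\<And>b. q b < v \<bullet> b + r" by metis
    define w where "w = (\<Sum>b\<in>Basis. q b *\<^sub>R b)"
    have wb: "w \<bullet> b = q b" if "b \<in> Basis" for b unfolding w_def using that by simp
    have "dist w v \<le> (\<Sum>b\<in>Basis. \<bar>(w - v) \<bullet> b\<bar>)" unfolding dist_norm by (rule norm_le_l1)
    also have "\<dots> \<le> (\<Sum>b\<in>(Basis::'a set). r)"
    proof (rule sum_mono)
      fix b :: 'a assume "b \<in> Basis"
      then show "\<bar>(w - v) \<bullet> b\<bar> \<le> r" using q(2,3)[of b] by (simp add: inner_diff_left wb)
    qed
    also have "\<dots> < e" using that by (simp add: r_def field_simps)
    finally have "dist w v < e" .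
    moreover have "w \<in> D" by (simp add: D_def wb q)
    ultimately show ?thesis by blast
  qed
  show "Basis \<subseteq> D" by (auto simp: D_def inner_Basis)
  show "v + w \<in> D" if "v \<in> D" "w \<in> D" for v w using that by (simp add: D_def inner_add_left)
  show "q *\<^sub>R v \<in> D" if "v \<in> D" "q \<in> \<rat>" for v q using that by (simp add: D_def)
  show "v \<bullet> b \<in> \<rat>" if "v \<in> D" "b \<in> Basis" for v b using that by (simp add: D_def)
qed

text \<open>Off one null set the right slopes along rational directions are additive and hence given
  by a vector \<open>g\<close>. Compactness of the unit sphere and the Lipschitz bound upgrade this
  to differentiability: finitely many rational directions approximate all others uniformly.\<close>

lemma AE_differentiable_lipschitz_real:
  fixes f :: "'a::euclidean_space \<Rightarrow> real"
  assumes lip: "C-lipschitz_on UNIV f"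
  shows "AE x in lborel. \<exists>g. (f has_derivative (\<lambda>h. g \<bullet> h)) (at x)"
proof -
  obtain D :: "'a set" where cD: "countable D" and D: "Basis \<subseteq> D"
    "\<And>v w. v \<in> D \<Longrightarrow> w \<in> D \<Longrightarrow> v + w \<in> D" "\<And>v q. v \<in> D \<Longrightarrow> q \<in> \<rat> \<Longrightarrow> q *\<^sub>R v \<in> D"
    "\<And>v e. 0 < e \<Longrightarrow> \<exists>w\<in>D. dist w v < e"
    "\<And>v b. v \<in> D \<Longrightarrow> b \<in> Basis \<Longrightarrow> v \<bullet> b \<in> \<rat>"
    by (rule countable_rational_vectors) (rule that)
  have C0: "0 \<le> C" by (rule lipschitz_on_nonneg[OF lip])
  have "AE x in lborel. \<forall>v\<in>D. slopes_cauchy f v x"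
    using AE_slopes_cauchy[OF lip] by (simp add: AE_ball_countable[OF cD])
  moreover have "AE x in lborel. \<forall>v\<in>D. \<forall>w\<in>D. right_slope f (v + w) x = right_slope f v x + right_slope f w x"
    using AE_right_slope_add[OF lip] by (simp add: AE_ball_countable[OF cD])
  ultimately show ?thesis
  proof eventually_elim
    case (elim x)
    define r where "r v = right_slope f v x" for v
    have sc: "slopes_cauchy f v x" if "v \<in> D" for v using elim that by blast
    have add: "r (v + w) = r v + r w" if "v \<in> D" "w \<in> D" for v w
      using elim that by (simp add: r_def)
    have D0: "0 \<in> D" using D(3)[of "SOME b. b \<in> Basis" 0] D(1) SOME_Basis by auto
    have r0: "r 0 = 0" using add[OF D0 D0] by simp
    have scal: "r (q *\<^sub>R v) = q * r v" if v: "v \<in> D" and q: "q \<in> \<rat>" for q v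
    proof -
      consider "q > 0" | "q = 0" | "q < 0" by linarith
      then show ?thesis
      proof cases
        case 1 then show ?thesis unfolding r_def by (rule right_slope_scaleR[OF _ sc[OF v]])
      next
        \<comment> \<open>A right slope scales only by positive factors; additivity and
          \<open>r 0 = 0\<close> supply the negative ones.\<close>
        case 3
        have "r ((- q) *\<^sub>R v) = (- q) * r v" unfolding r_def using 3 by (intro right_slope_scaleR sc v) auto
        moreover have "r (q *\<^sub>R v + (- q) *\<^sub>R v) = r (q *\<^sub>R v) + r ((- q) *\<^sub>R v)"
          using q by (intro add D v) auto
        ultimately show ?thesis using r0 by simp
      qed (simp add: r0)
    qed
    define g where "g = (\<Sum>b\<in>Basis. r b *\<^sub>R b)"
    have rg: "r v = g \<bullet> v" if v: "v \<in> D" for v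
    proof -
      have "(\<Sum>b\<in>B. (v \<bullet> b) *\<^sub>R b) \<in> D \<and> r (\<Sum>b\<in>B. (v \<bullet> b) *\<^sub>R b) = (\<Sum>b\<in>B. (v \<bullet> b) * r b)"
        if "finite B" "B \<subseteq> Basis" for B
        using that
      proof (induction B rule: finite_induct)
        case (insert b B)
        have 1: "(v \<bullet> b) *\<^sub>R b \<in> D" using insert.prems D(1) by (intro D(3) D(5) v) auto
        moreover have "r ((v \<bullet> b) *\<^sub>R b) = (v \<bullet> b) * r b"
          using insert.prems D(1) by (intro scal D(5) v) auto
        ultimately show ?case using insert D(2) add by auto
      qed (simp add: D0 r0)
      from this[OF finite_Basis order_refl] have "r v = (\<Sum>b\<in>Basis. (v \<bullet> b) * r b)"
        by (simp add: euclidean_representation)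
      also have "\<dots> = g \<bullet> v" unfolding g_def inner_sum_left by (simp add: inner_commute mult.commute)
      finally show ?thesis .
    qed
    have "(f has_derivative (\<lambda>h. g \<bullet> h)) (at x)"
      unfolding has_derivative_at_alt
    proof (intro conjI allI impI)
      show "bounded_linear ((\<bullet>) g)" by (rule bounded_linear_inner_right)
      fix e :: real assume e: "0 < e"
      \<comment> \<open>Replacing a unit direction \<open>u\<close> by a nearby \<open>w\<close>
        costs at most \<open>(C + norm g) * \<delta>\<close> per unit length, which is kept below
        half of the allowed error.\<close>
      define k where "k = C + norm g + 1"
      have k: "k > 0" using C0 by (simp add: k_def add_nonneg_pos)
      define \<delta> where "\<delta> = e / (2 * k)"
      have \<delta>: "\<delta> > 0" using e k by (simp add: \<delta>_def)
      have "compact (sphere (0::'a) 1)" by simp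
      moreover have "sphere (0::'a) 1 \<subseteq> (\<Union>w\<in>D. ball w \<delta>)" using D(4)[OF \<delta>] by (fastforce simp: mem_ball)
      ultimately obtain W where W: "W \<subseteq> D" "finite W" "sphere (0::'a) 1 \<subseteq> (\<Union>w\<in>W. ball w \<delta>)"
        using compactE_image[of "sphere (0::'a) 1" D "\<lambda>w. ball w \<delta>"] by blast
      have "\<forall>w\<in>W. \<exists>d>0. \<forall>s. 0 < s \<and> s < d \<longrightarrow> \<bar>f (x + s *\<^sub>R w) - f x - s * (g \<bullet> w)\<bar> \<le> e/2 * s"
      proof
        fix w assume "w \<in> W"
        then have w: "w \<in> D" using W by blast
        have "((\<lambda>s. (f (x + s *\<^sub>R w) - f x) / s) \<longlongrightarrow> g \<bullet> w) (at_right 0)"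
          using slopes_cauchyD(1)[OF sc[OF w]] rg[OF w] by (simp add: r_def)
        then have "\<forall>\<^sub>F s in at_right 0. dist ((f (x + s *\<^sub>R w) - f x) / s) (g \<bullet> w) < e/2"
          using e by (intro tendstoD) auto
        then obtain d where d: "d > 0" "\<And>s. 0 < s \<Longrightarrow> s < d \<Longrightarrow> dist ((f (x + s *\<^sub>R w) - f x) / s) (g \<bullet> w) < e/2"
          unfolding eventually_at_right_field by auto
        have "\<bar>f (x + s *\<^sub>R w) - f x - s * (g \<bullet> w)\<bar> \<le> e/2 * s" if s: "0 < s" "s < d" for s
        proof -
          have "f (x + s *\<^sub>R w) - f x - s * (g \<bullet> w) = s * ((f (x + s *\<^sub>R w) - f x) / s - g \<bullet> w)"
            using s by (simp add: field_simps)
          then have "\<bar>f (x + s *\<^sub>R w) - f x - s * (g \<bullet> w)\<bar> = s * \<bar>(f (x + s *\<^sub>R w) - f x) / s - g \<bullet> w\<bar>"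
            using s by (simp add: abs_mult)
          also have "\<dots> \<le> s * (e/2)" using d(2)[OF s] s by (intro mult_left_mono) (auto simp: dist_real_def)
          finally show ?thesis by (simp add: mult.commute)
        qed
        then show "\<exists>d>0. \<forall>s. 0 < s \<and> s < d \<longrightarrow> \<bar>f (x + s *\<^sub>R w) - f x - s * (g \<bullet> w)\<bar> \<le> e/2 * s"
          using d(1) by blast
      qed
      then obtain dd where dd: "\<And>w. w \<in> W \<Longrightarrow> dd w > 0"
        "\<And>w s. w \<in> W \<Longrightarrow> 0 < s \<Longrightarrow> s < dd w \<Longrightarrow> \<bar>f (x + s *\<^sub>R w) - f x - s * (g \<bullet> w)\<bar> \<le> e/2 * s"
        by metis
      define d where "d = Min (insert 1 (dd ` W))"
      have d0: "d > 0" unfolding d_def using W(2) dd(1) by (subst Min_gr_iff) auto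
      have dle: "d \<le> dd w" if "w \<in> W" for w unfolding d_def using W(2) that by (intro Min_le) auto
      show "\<exists>d>0. \<forall>y. norm (y - x) < d \<longrightarrow> norm (f y - f x - g \<bullet> (y - x)) \<le> e * norm (y - x)"
      proof (intro exI conjI allI impI)
        show "0 < d" by (rule d0)
        fix y assume y: "norm (y - x) < d"
        show "norm (f y - f x - g \<bullet> (y - x)) \<le> e * norm (y - x)"
        proof (cases "y = x")
          case False
          define s where "s = norm (y - x)"
          have s: "0 < s" "s < d" using False y by (auto simp: s_def)
          define u where "u = (1/s) *\<^sub>R (y - x)"
          have yu: "y = x + s *\<^sub>R u" using s by (simp add: u_def)
          have "u \<in> sphere 0 1" using False by (simp add: u_def s_def)
          then obtain w where w: "w \<in> W" "norm (u - w) < \<delta>"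
            using W(3) by (auto simp: dist_norm norm_minus_commute)
          have 1: "\<bar>f (x + s *\<^sub>R w) - f x - s * (g \<bullet> w)\<bar> \<le> e/2 * s"
            using dd(2)[OF w(1)] s dle[OF w(1)] by auto
          have "\<bar>f y - f (x + s *\<^sub>R w)\<bar> \<le> C * norm (y - (x + s *\<^sub>R w))"
            using lipschitz_onD[OF lip, of y "x + s *\<^sub>R w"] by (simp add: dist_norm)
          also have "y - (x + s *\<^sub>R w) = s *\<^sub>R (u - w)" by (simp add: yu algebra_simps)
          also have "norm (s *\<^sub>R (u - w)) = s * norm (u - w)" using s by simp
          finally have 2: "\<bar>f y - f (x + s *\<^sub>R w)\<bar> \<le> C * (s * norm (u - w))" .
          have "g \<bullet> (y - x) - s * (g \<bullet> w) = s * (g \<bullet> (u - w))" by (simp add: yu inner_simps algebra_simps)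
          then have 3: "\<bar>g \<bullet> (y - x) - s * (g \<bullet> w)\<bar> \<le> norm g * (s * norm (u - w))"
            using Cauchy_Schwarz_ineq2[of g "u - w"] s by (simp add: abs_mult mult.left_commute)
          have "(C + norm g) * (s * norm (u - w)) \<le> k * (s * \<delta>)"
            using s w C0 by (intro mult_mono) (auto simp: k_def)
          also have "\<dots> = e/2 * s" using k by (simp add: \<delta>_def)
          finally have "C * (s * norm (u - w)) + norm g * (s * norm (u - w)) \<le> e/2 * s" by (simp add: algebra_simps)
          moreover have "e * s = e/2 * s + e/2 * s" by simp
          ultimately have "\<bar>f y - f x - g \<bullet> (y - x)\<bar> \<le> e * s" using 1 2 3 by linarith
          then show ?thesis by (simp add: s_def)
        qed simp
      qed
    qed
    then show ?case by blast
  qed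
qed

theorem rademacher:
  fixes f :: "'a::euclidean_space \<Rightarrow> 'b::euclidean_space"
  assumes lip: "C-lipschitz_on UNIV f"
  shows "AE x in lborel. \<exists>f'. (f has_derivative f') (at x)"
proof -
  have "AE x in lborel. \<exists>g. ((\<lambda>x. f x \<bullet> b) has_derivative (\<lambda>h. g \<bullet> h)) (at x)" if "b \<in> Basis" for b
  proof (rule AE_differentiable_lipschitz_real)
    show "C-lipschitz_on UNIV (\<lambda>x. f x \<bullet> b)"
    proof (rule lipschitz_onI)
      fix x y
      have "dist (f x \<bullet> b) (f y \<bullet> b) \<le> norm (f x - f y)"
        using Basis_le_norm[OF that, of "f x - f y"] by (simp add: dist_real_def inner_diff_left)
      also have "\<dots> \<le> C * dist x y" using lipschitz_onD[OF lip, of x y] by (simp add: dist_norm)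
      finally show "dist (f x \<bullet> b) (f y \<bullet> b) \<le> C * dist x y" .
    qed (rule lipschitz_on_nonneg[OF lip])
  qed
  then have "AE x in lborel. \<forall>b\<in>Basis. \<exists>g. ((\<lambda>x. f x \<bullet> b) has_derivative (\<lambda>h. g \<bullet> h)) (at x)"
    by (subst AE_ball_countable) (auto intro: countable_finite)
  then show ?thesis
  proof eventually_elim
    case (elim x)
    then obtain g where g: "\<And>b. b \<in> Basis \<Longrightarrow> ((\<lambda>x. f x \<bullet> b) has_derivative (\<lambda>h. g b \<bullet> h)) (at x)" by metis
    have "(f has_derivative (\<lambda>h. \<Sum>b\<in>Basis. (g b \<bullet> h) *\<^sub>R b)) (at x)"
      by (subst has_derivative_componentwise_within) (auto intro: g)
    then show ?case by blast
  qed
qed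

section \<open>Alexandrov's theorem\<close>

text \<open>Schwarz's theorem for a gradient known to be differentiable at one point: by the mean
  value theorem in direction \<open>u\<close>, the second difference of \<open>h\<close> along s u
  and s v equals s^2 (B v . u) up to o(s^2), and this difference is symmetric in \<open>u\<close>
  and \<open>v\<close>.\<close>

lemma derivative_of_gradient_symmetric:
  fixes h :: "'a::euclidean_space \<Rightarrow> real"
  assumes h: "\<And>z. (h has_derivative (\<lambda>v. J z \<bullet> v)) (at z)" and J: "(J has_derivative B) (at z)"
  shows "B v \<bullet> u = B u \<bullet> v"
proof -
  interpret B: bounded_linear B using J by (rule has_derivative_bounded_linear)
  have approx: "\<exists>d>0. \<forall>s. 0 < s \<and> s < d \<longrightarrow>
      \<bar>(h (z + s *\<^sub>R u + s *\<^sub>R v) - h (z + s *\<^sub>R u) - h (z + s *\<^sub>R v) + h z) - s\<^sup>2 * (B v \<bullet> u)\<bar> \<le> e * s\<^sup>2"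
    if e: "0 < e" for e u v
  proof -
    define K where "K = norm u * (2 * (norm u + norm v)) + 1"
    have K: "K > 0" unfolding K_def by (intro add_nonneg_pos mult_nonneg_nonneg) auto
    define k where "k = e / K"
    have k: "k > 0" using e K by (simp add: k_def)
    obtain r where r: "r > 0" "\<And>y. norm (y - z) < r \<Longrightarrow> norm (J y - J z - B (y - z)) \<le> k * norm (y - z)"
      using J k unfolding has_derivative_at_alt by blast
    define d where "d = r / (norm u + norm v + 1)"
    have d: "d > 0" unfolding d_def using r(1) by (intro divide_pos_pos add_nonneg_pos) auto
    have "\<bar>(h (z + s *\<^sub>R u + s *\<^sub>R v) - h (z + s *\<^sub>R u) - h (z + s *\<^sub>R v) + h z) - s\<^sup>2 * (B v \<bullet> u)\<bar> \<le> e * s\<^sup>2"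
      if s: "0 < s" "s < d" for s
    proof -
      have sr: "s * (norm u + norm v) < r"
      proof -
        have "s * (norm u + norm v) \<le> s * (norm u + norm v + 1)" using s by simp
        also have "\<dots> < d * (norm u + norm v + 1)" using s by (intro mult_strict_right_mono add_nonneg_pos) auto
        also have "\<dots> = r" unfolding d_def by (simp add: add_nonneg_pos less_imp_neq[symmetric])
        finally show ?thesis .
      qed
      define g where "g \<tau> = h (z + s *\<^sub>R v + (\<tau> * s) *\<^sub>R u) - h (z + (\<tau> * s) *\<^sub>R u)" for \<tau>
      have dg: "(g has_derivative (\<lambda>x. x * (s * ((J (z + s *\<^sub>R v + (\<tau> * s) *\<^sub>R u) - J (z + (\<tau> * s) *\<^sub>R u)) \<bullet> u)))) (at \<tau>)" for \<tau>
        unfolding g_def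
        by (rule has_derivative_eq_rhs,
            (rule derivative_intros has_derivative_compose[OF _ h, where f="\<lambda>\<tau>. z + s *\<^sub>R v + (\<tau> * s) *\<^sub>R u"]
              has_derivative_compose[OF _ h, where f="\<lambda>\<tau>. z + (\<tau> * s) *\<^sub>R u"])+)
           (auto simp: inner_simps algebra_simps)
      have "\<exists>\<xi>\<in>{0<..<1}. g 1 - g 0 = (1 - 0) * (s * ((J (z + s *\<^sub>R v + (\<xi> * s) *\<^sub>R u) - J (z + (\<xi> * s) *\<^sub>R u)) \<bullet> u))"
        by (rule mvt_simple) (auto intro: has_derivative_at_withinI[OF dg])
      then obtain \<xi> where \<xi>: "\<xi> \<in> {0<..<1}" "g 1 - g 0 = (1 - 0) * (s * ((J (z + s *\<^sub>R v + (\<xi> * s) *\<^sub>R u) - J (z + (\<xi> * s) *\<^sub>R u)) \<bullet> u))"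
        by blast
      define y1 where "y1 = z + s *\<^sub>R v + (\<xi> * s) *\<^sub>R u"
      define y2 where "y2 = z + (\<xi> * s) *\<^sub>R u"
      have n2: "norm (y2 - z) \<le> s * (norm u + norm v)"
      proof -
        have "norm (y2 - z) = \<xi> * (s * norm u)" unfolding y2_def using \<xi>(1) s by simp
        also have "\<dots> \<le> s * norm u" using \<xi>(1) s by (intro mult_left_le_one_le) auto
        also have "\<dots> \<le> s * (norm u + norm v)" using s by simp
        finally show ?thesis .
      qed
      have n1: "norm (y1 - z) \<le> s * (norm u + norm v)"
      proof -
        have "norm (y1 - z) \<le> norm (s *\<^sub>R v) + norm ((\<xi> * s) *\<^sub>R u)"
          unfolding y1_def using norm_triangle_ineq[of "s *\<^sub>R v" "(\<xi> * s) *\<^sub>R u"] by simp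
        also have "\<dots> \<le> s * norm v + s * norm u"
          using \<xi>(1) s mult_left_le_one_le[of "s * norm u" \<xi>] by (simp add: mult.assoc)
        finally show ?thesis by (simp add: algebra_simps)
      qed
      have e1: "norm (J y1 - J z - B (y1 - z)) \<le> k * (s * (norm u + norm v))"
        using r(2)[of y1] n1 sr mult_left_mono[OF n1, of k] k by linarith
      have e2: "norm (J y2 - J z - B (y2 - z)) \<le> k * (s * (norm u + norm v))"
        using r(2)[of y2] n2 sr mult_left_mono[OF n2, of k] k by linarith
      have Bd: "B (y1 - z) - B (y2 - z) = s *\<^sub>R B v"
        by (simp add: y1_def y2_def B.diff[symmetric] B.scaleR[symmetric])
      have "J y1 - J y2 - s *\<^sub>R B v = (J y1 - J z - B (y1 - z)) - (J y2 - J z - B (y2 - z))"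
        unfolding Bd[symmetric] by simp
      then have "norm (J y1 - J y2 - s *\<^sub>R B v) \<le> 2 * (k * (s * (norm u + norm v)))"
        using norm_triangle_ineq4[of "J y1 - J z - B (y1 - z)" "J y2 - J z - B (y2 - z)"] e1 e2 by (simp only:)
      then have "\<bar>(J y1 - J y2 - s *\<^sub>R B v) \<bullet> u\<bar> \<le> 2 * (k * (s * (norm u + norm v))) * norm u"
        using order_trans[OF Cauchy_Schwarz_ineq2 mult_right_mono[OF _ norm_ge_zero]] by blast
      then have "s * \<bar>(J y1 - J y2 - s *\<^sub>R B v) \<bullet> u\<bar> \<le> s * (2 * (k * (s * (norm u + norm v))) * norm u)"
        using s by (intro mult_left_mono) auto
      also have "\<dots> = s\<^sup>2 * (k * (norm u * (2 * (norm u + norm v))))" by (simp add: power2_eq_square algebra_simps)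
      also have "\<dots> \<le> s\<^sup>2 * (k * K)" using k by (intro mult_left_mono) (auto simp: K_def)
      also have "k * K = e" using K by (simp add: k_def)
      finally have "s * \<bar>(J y1 - J y2 - s *\<^sub>R B v) \<bullet> u\<bar> \<le> e * s\<^sup>2" by (simp add: mult.commute)
      moreover have "g 1 - g 0 - s\<^sup>2 * (B v \<bullet> u) = s * ((J y1 - J y2 - s *\<^sub>R B v) \<bullet> u)"
        using \<xi>(2) unfolding y1_def[symmetric] y2_def[symmetric] by (simp add: inner_simps power2_eq_square algebra_simps)
      then have "\<bar>g 1 - g 0 - s\<^sup>2 * (B v \<bullet> u)\<bar> = s * \<bar>(J y1 - J y2 - s *\<^sub>R B v) \<bullet> u\<bar>"
        using s by (simp add: abs_mult)
      moreover have "g 1 - g 0 = h (z + s *\<^sub>R u + s *\<^sub>R v) - h (z + s *\<^sub>R u) - h (z + s *\<^sub>R v) + h z"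
        by (simp add: g_def algebra_simps)
      ultimately show ?thesis by simp
    qed
    then show ?thesis using d by blast
  qed
  show ?thesis
  proof (rule ccontr)
    assume ne: "B v \<bullet> u \<noteq> B u \<bullet> v"
    define e where "e = \<bar>B v \<bullet> u - B u \<bullet> v\<bar> / 4"
    have e: "e > 0" using ne by (simp add: e_def)
    obtain d1 where d1: "d1 > 0" "\<And>s. 0 < s \<and> s < d1 \<Longrightarrow>
      \<bar>(h (z + s *\<^sub>R u + s *\<^sub>R v) - h (z + s *\<^sub>R u) - h (z + s *\<^sub>R v) + h z) - s\<^sup>2 * (B v \<bullet> u)\<bar> \<le> e * s\<^sup>2"
      using approx[OF e, of u v] by blast
    obtain d2 where d2: "d2 > 0" "\<And>s. 0 < s \<and> s < d2 \<Longrightarrow>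
      \<bar>(h (z + s *\<^sub>R v + s *\<^sub>R u) - h (z + s *\<^sub>R v) - h (z + s *\<^sub>R u) + h z) - s\<^sup>2 * (B u \<bullet> v)\<bar> \<le> e * s\<^sup>2"
      using approx[OF e, of v u] by blast
    define s where "s = min d1 d2 / 2"
    have s: "0 < s" "s < d1" "s < d2" using d1(1) d2(1) by (auto simp: s_def)
    have comm: "z + s *\<^sub>R v + s *\<^sub>R u = z + s *\<^sub>R u + s *\<^sub>R v" by simp
    have "\<bar>s\<^sup>2 * (B v \<bullet> u) - s\<^sup>2 * (B u \<bullet> v)\<bar> \<le> 2 * (e * s\<^sup>2)"
      using d1(2)[OF conjI[OF s(1,2)]] d2(2)[OF conjI[OF s(1,3)]] unfolding comm by linarith
    moreover have "s\<^sup>2 * \<bar>B v \<bullet> u - B u \<bullet> v\<bar> = \<bar>s\<^sup>2 * (B v \<bullet> u) - s\<^sup>2 * (B u \<bullet> v)\<bar>"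
      by (simp add: right_diff_distrib[symmetric] abs_mult)
    ultimately have "s\<^sup>2 * \<bar>B v \<bullet> u - B u \<bullet> v\<bar> \<le> s\<^sup>2 * (2 * e)" by (simp add: mult.commute mult.left_commute)
    then have "\<bar>B v \<bullet> u - B u \<bullet> v\<bar> \<le> 2 * e" using s by simp
    then show False using e by (simp add: e_def)
  qed
qed

text \<open>The expansion is required of every subgradient at every nearby \<open>w\<close>, since
  \<phi> need not be differentiable near \<open>x\<close>. The case \<open>w = x\<close> forces
  \<open>p\<close> to be the only subgradient at \<open>x\<close>.\<close>

definition second_derivative_at :: "('a::euclidean_space \<Rightarrow> real) \<Rightarrow> 'a \<Rightarrow> 'a \<Rightarrow> ('a \<Rightarrow> 'a) \<Rightarrow> bool" where
  "second_derivative_at \<phi> x p A \<longleftrightarrow> linear A \<and> (\<forall>u v. A u \<bullet> v = u \<bullet> A v) \<and>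
     (\<forall>e>0. \<exists>d>0. \<forall>w q. norm (w - x) < d \<longrightarrow> subgrad \<phi> w q \<longrightarrow> norm (q - p - A (w - x)) \<le> e * norm (w - x))"

locale resolvent =
  fixes \<phi> :: "'a::euclidean_space \<Rightarrow> real" and J :: "'a \<Rightarrow> 'a"
  assumes subgrad_resolvent: "\<And>z. subgrad \<phi> (J z) (z - J z)"
begin

lemma firmly_nonexpansive: "(norm (J z - J w))\<^sup>2 \<le> (J z - J w) \<bullet> (z - w)"
  using subgrad_monotone[OF subgrad_resolvent subgrad_resolvent, of z w]
  unfolding power2_norm_eq_inner by (simp add: inner_simps inner_commute)

lemma monotone: "0 \<le> (J z - J w) \<bullet> (z - w)"
  using firmly_nonexpansive[of z w] order_trans[OF zero_le_power2] by blast

lemma nonexpansive: "norm (J z - J w) \<le> norm (z - w)"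
proof (cases "J z = J w")
  case False
  have "(norm (J z - J w))\<^sup>2 \<le> norm (J z - J w) * norm (z - w)"
    using firmly_nonexpansive norm_cauchy_schwarz order_trans by blast
  then show ?thesis using False by (simp add: power2_eq_square)
qed simp

lemma lipschitz: "1-lipschitz_on UNIV J"
  by (rule lipschitz_onI) (auto simp: dist_norm nonexpansive)

lemma resolvent_unique: "subgrad \<phi> x p \<Longrightarrow> J (x + p) = x"
proof -
  assume "subgrad \<phi> x p"
  from subgrad_monotone[OF this subgrad_resolvent, of "x + p"]
  have "0 \<le> - (norm (x - J (x + p)))\<^sup>2" unfolding power2_norm_eq_inner by (simp add: inner_simps inner_commute)
  then show ?thesis by simp
qed

text \<open>The potential is the Legendre transform of \<phi> + |.|^2/2, evaluated at its maximiser
  \<open>J z\<close>. It makes the derivative of \<open>J\<close> symmetric, and with it the second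
  derivative of \<phi>.\<close>

lemma has_potential:
  "((\<lambda>z. J z \<bullet> z - (norm (J z))\<^sup>2 / 2 - \<phi> (J z)) has_derivative (\<lambda>v. J z \<bullet> v)) (at z)"
proof -
  define h where "h z = J z \<bullet> z - (norm (J z))\<^sup>2 / 2 - \<phi> (J z)" for z
  have low: "h z + J z \<bullet> (w - z) \<le> h w" for z w
  proof -
    have "\<phi> (J w) + (w - J w) \<bullet> (J z - J w) \<le> \<phi> (J z)" by (rule subgradD[OF subgrad_resolvent])
    moreover have "0 \<le> (norm (J z - J w))\<^sup>2" by simp
    ultimately show ?thesis unfolding h_def power2_norm_eq_inner
      by (simp add: inner_simps inner_commute field_simps)
  qed
  have quad: "\<bar>h w - h z - J z \<bullet> (w - z)\<bar> \<le> norm (w - z) * norm (w - z)" for w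
  proof -
    have "h w - h z \<le> J w \<bullet> (w - z)" using low[of w z] by (simp add: inner_simps)
    then have "h w - h z - J z \<bullet> (w - z) \<le> (J w - J z) \<bullet> (w - z)" by (simp add: inner_simps)
    also have "\<dots> \<le> norm (J w - J z) * norm (w - z)" by (rule norm_cauchy_schwarz)
    also have "\<dots> \<le> norm (w - z) * norm (w - z)" by (intro mult_right_mono nonexpansive) auto
    finally show ?thesis using low[of z w] by simp
  qed
  have "(h has_derivative (\<lambda>v. J z \<bullet> v)) (at z)"
    unfolding has_derivative_at_alt
  proof (intro conjI allI impI)
    fix e :: real assume "0 < e"
    moreover have "norm (h y - h z - J z \<bullet> (y - z)) \<le> e * norm (y - z)" if "norm (y - z) < e" for y
      using quad[of y] mult_right_mono[of "norm (y - z)" e "norm (y - z)"] that by simp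
    ultimately show "\<exists>d>0. \<forall>y. norm (y - z) < d \<longrightarrow> norm (h y - h z - J z \<bullet> (y - z)) \<le> e * norm (y - z)"
      by blast
  qed (rule bounded_linear_inner_right)
  then show ?thesis by (simp add: h_def[abs_def])
qed

text \<open>If \<open>C\<close> inverts \<open>B\<close>, then id + \<partial>\<phi> has derivative
  \<open>C\<close> at \<open>x\<close>, so \<open>A\<close> is \<open>C\<close> minus the identity.
  Since \<open>J\<close> is differentiable at \<open>x + p\<close> only, points \<open>w + q\<close>
  with \<open>w\<close> near \<open>x\<close> must be shown to lie near \<open>x + p\<close> before
  the expansion of \<open>J\<close> applies to them.\<close>

lemma second_derivative:
  assumes p: "subgrad \<phi> x p" and B: "(J has_derivative B) (at (x + p))" and inj: "inj B"
  shows "\<exists>A. second_derivative_at \<phi> x p A"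
proof -
  let ?z = "x + p"
  have Jz: "J ?z = x" by (rule resolvent_unique[OF p])
  interpret B: bounded_linear B using B by (rule has_derivative_bounded_linear)
  have lB: "linear B" by (rule B.linear_axioms)
  obtain C where C: "linear C" "C \<circ> B = id" using linear_injective_left_inverse[OF lB inj] by blast
  have CB: "C (B v) = v" for v using C(2) by (metis comp_apply id_apply)
  have BC: "B (C v) = v" for v
  proof -
    have "surj B" using linear_injective_imp_surjective[OF lB inj] by simp
    then obtain u where "v = B u" unfolding surj_def by blast
    then show ?thesis by (simp add: CB)
  qed
  have symB: "B u \<bullet> v = u \<bullet> B v" for u v
    using derivative_of_gradient_symmetric[OF has_potential B, of u v] by (simp add: inner_commute)
  have symC: "C u \<bullet> v = u \<bullet> C v" for u v
    by (metis BC symB)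
  obtain K where K: "K > 0" "\<And>v. norm (C v) \<le> K * norm v"
    using linear_bounded_pos[OF C(1)] by blast
  have Bl: "norm v \<le> K * norm (B v)" for v using K(2)[of "B v"] by (simp add: CB)
  define A where "A v = C v - v" for v
  have "second_derivative_at \<phi> x p A"
    unfolding second_derivative_at_def
  proof (intro conjI allI impI)
    show "linear A" unfolding A_def[abs_def] by (intro linear_compose_sub C(1) linear_id[unfolded id_def])
    show "A u \<bullet> v = u \<bullet> A v" for u v by (simp add: A_def inner_simps symC)
    fix e :: real assume e: "0 < e"
    \<comment> \<open>The first bound allows the error term \<open>K * \<eta>\<close> to be
      absorbed, the second yields the final error \<open>e\<close>.\<close>
    define \<eta> where "\<eta> = min (1 / (2 * K)) (e / (2 * K * K))"
    have \<eta>: "\<eta> > 0" "K * \<eta> \<le> 1/2" "2 * K * K * \<eta> \<le> e"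
    proof -
      show "\<eta> > 0" using K e by (simp add: \<eta>_def)
      have "K * \<eta> \<le> K * (1 / (2 * K))" using K by (intro mult_left_mono) (auto simp: \<eta>_def)
      then show "K * \<eta> \<le> 1/2" using K by simp
      have "2 * K * K * \<eta> \<le> 2 * K * K * (e / (2 * K * K))" using K by (intro mult_left_mono) (auto simp: \<eta>_def)
      then show "2 * K * K * \<eta> \<le> e" using K by simp
    qed
    obtain r where r: "r > 0" "\<And>y. norm (y - ?z) < r \<Longrightarrow> norm (J y - J ?z - B (y - ?z)) \<le> \<eta> * norm (y - ?z)"
      using B \<eta>(1) unfolding has_derivative_at_alt by blast
    define \<rho> where "\<rho> = r / 2"
    have \<rho>: "0 < \<rho>" "\<rho> < r" using r by (auto simp: \<rho>_def)
    define d where "d = \<rho> / (4 * K * K)"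
    have d: "d > 0" using \<rho> K by (simp add: d_def)
    have "norm (q - p - A (w - x)) \<le> e * norm (w - x)" if w: "norm (w - x) < d" and q: "subgrad \<phi> w q" for w q
    proof -
      define z' where "z' = w + q"
      have Jz': "J z' = w" unfolding z'_def by (rule resolvent_unique[OF q])
      \<comment> \<open>Otherwise take \<open>y\<close> at distance \<open>\<rho>\<close> on the
        segment to \<open>z'\<close>. Injectivity of \<open>B\<close> and firm nonexpansiveness move
        \<open>J y\<close> away from \<open>x\<close> by at least
        \<open>\<rho> / (4 * K * K)\<close> in direction \<open>u\<close>, and monotonicity passes
        this on to \<open>w\<close>; the radius \<open>d\<close> is exactly this length.\<close>
      have "norm (z' - ?z) < \<rho>"
      proof (rule ccontr)
        assume "\<not> norm (z' - ?z) < \<rho>"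
        then have big: "\<rho> \<le> norm (z' - ?z)" by simp
        define l where "l = norm (z' - ?z)"
        define u where "u = (1 / l) *\<^sub>R (z' - ?z)"
        have l: "l > 0" "\<rho> \<le> l" using big \<rho> by (auto simp: l_def)
        have nu: "norm u = 1" using l(1) by (auto simp: u_def l_def)
        have z'u: "z' = ?z + l *\<^sub>R u" using l(1) by (simp add: u_def)
        define y where "y = ?z + \<rho> *\<^sub>R u"
        have ny: "norm (y - ?z) = \<rho>" using \<rho> nu by (simp add: y_def)
        have "norm (J y - J ?z - B (y - ?z)) \<le> \<eta> * \<rho>" using r(2)[of y] ny \<rho> by simp
        then have "norm (B (y - ?z)) \<le> norm (J y - J ?z) + \<eta> * \<rho>"
          using norm_triangle_ineq2[of "B (y - ?z)" "J y - J ?z"] by (simp add: norm_minus_commute)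
        moreover have "\<rho> \<le> K * norm (B (y - ?z))" using Bl[of "y - ?z"] ny by simp
        ultimately have "\<rho> \<le> K * (norm (J y - J ?z) + \<eta> * \<rho>)" using K(1)
          by (meson mult_left_mono less_imp_le order_trans)
        moreover have "K * \<eta> * \<rho> \<le> 1/2 * \<rho>" using \<eta>(2) \<rho> by (intro mult_right_mono) auto
        ultimately have h: "\<rho> / 2 \<le> K * norm (J y - J ?z)" by (simp add: algebra_simps)
        have "(\<rho> / 2)\<^sup>2 \<le> (K * norm (J y - J ?z))\<^sup>2" using h \<rho> by (intro power_mono) auto
        also have "\<dots> = K\<^sup>2 * (norm (J y - J ?z))\<^sup>2" by (rule power_mult_distrib)
        also have "\<dots> \<le> K\<^sup>2 * ((J y - J ?z) \<bullet> (y - ?z))" by (intro mult_left_mono firmly_nonexpansive) auto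
        also have "(J y - J ?z) \<bullet> (y - ?z) = \<rho> * ((J y - x) \<bullet> u)" by (simp add: y_def Jz)
        finally have "\<rho> * (\<rho> / 4) \<le> \<rho> * (K\<^sup>2 * ((J y - x) \<bullet> u))" by (simp add: power2_eq_square algebra_simps)
        then have 1: "\<rho> / 4 \<le> K\<^sup>2 * ((J y - x) \<bullet> u)" using \<rho>(1) by simp
        have "(J y - x) \<bullet> u \<le> (w - x) \<bullet> u"
        proof (cases "l = \<rho>")
          case True then show ?thesis using z'u y_def Jz' by simp
        next
          case False
          then have lr: "l - \<rho> > 0" using l by simp
          have "0 \<le> (J z' - J y) \<bullet> (z' - y)" by (rule monotone)
          also have "z' - y = (l - \<rho>) *\<^sub>R u" by (simp add: z'u y_def algebra_simps)
          finally have "0 \<le> (w - J y) \<bullet> u" using lr by (simp add: Jz' zero_le_mult_iff)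
          then show ?thesis by (simp add: inner_simps)
        qed
        also have "\<dots> \<le> norm (w - x)" using norm_cauchy_schwarz[of "w - x" u] nu by simp
        finally have "K\<^sup>2 * ((J y - x) \<bullet> u) \<le> K\<^sup>2 * norm (w - x)" by (intro mult_left_mono) auto
        also have "\<dots> < K\<^sup>2 * d" using w K by simp
        also have "K\<^sup>2 * d = \<rho> / 4" using K by (simp add: d_def power2_eq_square)
        finally show False using 1 by simp
      qed
      then have r2: "norm (w - x - B (z' - ?z)) \<le> \<eta> * norm (z' - ?z)"
        using r(2)[of z'] \<rho> Jz' Jz by simp
      have "C (w - x - B (z' - ?z)) = C (w - x) - (z' - ?z)" by (simp add: linear_diff[OF C(1)] CB)
      then have c1: "norm (C (w - x) - (z' - ?z)) \<le> K * (\<eta> * norm (z' - ?z))"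
        using K(2)[of "w - x - B (z' - ?z)"] mult_left_mono[OF r2, of K] K(1) by (simp only:) linarith
      have "norm (z' - ?z) \<le> norm (C (w - x)) + norm (C (w - x) - (z' - ?z))"
        using norm_triangle_ineq4[of "C (w - x)" "C (w - x) - (z' - ?z)"] by simp
      also have "\<dots> \<le> K * norm (w - x) + 1/2 * norm (z' - ?z)"
        using K(2)[of "w - x"] c1 mult_right_mono[OF \<eta>(2), of "norm (z' - ?z)"] by simp
      finally have c2: "norm (z' - ?z) \<le> 2 * K * norm (w - x)" by simp
      have "q - p - A (w - x) = - (C (w - x) - (z' - ?z))" by (simp add: A_def z'_def)
      then have "norm (q - p - A (w - x)) = norm (C (w - x) - (z' - ?z))" by (simp only: norm_minus_cancel)
      also have "\<dots> \<le> K * (\<eta> * (2 * K * norm (w - x)))"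
        using c1 c2 K \<eta>(1) by (meson mult_left_mono less_imp_le order_trans)
      also have "\<dots> = 2 * K * K * \<eta> * norm (w - x)" by simp
      also have "\<dots> \<le> e * norm (w - x)" by (intro mult_right_mono \<eta>) auto
      finally show ?thesis .
    qed
    then show "\<exists>d>0. \<forall>w q. norm (w - x) < d \<longrightarrow> subgrad \<phi> w q \<longrightarrow> norm (q - p - A (w - x)) \<le> e * norm (w - x)"
      using d by blast
  qed
  then show ?thesis by blast
qed

end

text \<open>The graph of the subdifferential is parametrised by the nonexpansive resolvent
  \<open>J = (id + \<partial>\<phi>)\<inverse>\<close>; Rademacher's theorem and Sard's lemma for \<open>J\<close> give the claim.\<close>
theorem alexandrov:
  fixes \<phi> :: "real^'k::{finite,wellorder} \<Rightarrow> real"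
  assumes cv: "convex_on UNIV \<phi>"
  shows "AE x in lborel. \<exists>p A. subgrad \<phi> x p \<and> second_derivative_at \<phi> x p A"
proof -
  have "\<forall>z. \<exists>x. subgrad \<phi> x (z - x)" using subgrad_minimizer[OF cv] by metis
  then obtain J where J: "\<And>z. subgrad \<phi> (J z) (z - J z)" by metis
  interpret resolvent \<phi> J by standard (rule J)
  define N1 where "N1 = {z. \<not> (\<exists>B. (J has_derivative B) (at z))}"
  define N2 where "N2 = {z. \<exists>B. (J has_derivative B) (at z) \<and> \<not> inj B}"
  obtain N where N: "N1 \<subseteq> N" "N \<in> null_sets lborel"
    using rademacher[OF lipschitz] unfolding N1_def eventually_ae_filter by auto
  have "negligible N" using N(2) by (simp add: negligible_iff_null_sets null_sets_completionI)
  then have "negligible N1" using N(1) negligible_subset by blast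
  then have n1: "negligible (J ` N1)"
    by (rule negligible_locally_Lipschitz_image[OF order_refl])
       (rule exI[of _ UNIV], rule exI[of _ 1], simp add: nonexpansive)
  define B where "B z = (SOME B. (J has_derivative B) (at z) \<and> \<not> inj B)" for z
  have B: "(J has_derivative B z) (at z)" "\<not> inj (B z)" if "z \<in> N2" for z
    using someI_ex[of "\<lambda>B. (J has_derivative B) (at z) \<and> \<not> inj B"] that unfolding N2_def B_def by blast+
  have n2: "negligible (J ` N2)"
  proof (rule baby_Sard)
    show "(J has_derivative B z) (at z within N2)" if "z \<in> N2" for z
      using B(1)[OF that] by (rule has_derivative_at_withinI)
    show "rank (matrix (B z)) < CARD('k)" if "z \<in> N2" for z
    proof -
      have "linear (B z)" using B(1)[OF that] by (rule has_derivative_linear)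
      then have "(*v) (matrix (B z)) = B z" by (simp add: matrix_vector_mul(2)[symmetric] matrix_works)
      then have "rank (matrix (B z)) \<noteq> CARD('k)" using B(2)[OF that] full_rank_injective by metis
      moreover have "rank (matrix (B z)) \<le> CARD('k)" using rank_bound[of "matrix (B z)"] by simp
      ultimately show ?thesis by simp
    qed
  qed simp
  show ?thesis
    using AE_lborel_not_in_negligible[OF n1] AE_lborel_not_in_negligible[OF n2]
  proof eventually_elim
    case (elim x)
    obtain p where p: "subgrad \<phi> x p" using subgrad_exists[OF cv] .
    \<comment> \<open>Every \<open>x\<close> is a value of \<open>J\<close>, namely at
      \<open>x + p\<close>; avoiding the two exceptional images thus keeps \<open>x + p\<close> out
      of the exceptional sets themselves.\<close>
    have "J (x + p) = x" by (rule resolvent_unique[OF p])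
    then have "x + p \<notin> N1" "x + p \<notin> N2" using elim by (metis imageI)+
    then obtain B where "(J has_derivative B) (at (x + p))" "inj B" unfolding N1_def N2_def by blast
    from second_derivative[OF p this] p show ?case by blast
  qed
qed

lemma second_derivative_atD:
  assumes "second_derivative_at \<phi> x p A" "0 < e"
  shows "\<exists>d>0. \<forall>w q. norm (w - x) < d \<longrightarrow> subgrad \<phi> w q \<longrightarrow> norm (q - p - A (w - x)) \<le> e * norm (w - x)"
  using assms unfolding second_derivative_at_def by blast

lemma second_derivative_at_unique:
  assumes "second_derivative_at \<phi> x p A" "subgrad \<phi> x q"
  shows "q = p"
proof -
  have lin: "linear A" using assms(1) by (simp add: second_derivative_at_def)
  obtain d where d: "0 < d" "\<And>w q. norm (w - x) < d \<Longrightarrow> subgrad \<phi> w q \<Longrightarrow> norm (q - p - A (w - x)) \<le> 1 * norm (w - x)"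
    using second_derivative_atD[OF assms(1) zero_less_one] by blast
  have "norm (q - p - A (x - x)) \<le> 1 * norm (x - x)" using d(2)[OF _ assms(2)] d(1) by simp
  then show ?thesis by (simp add: linear_0[OF lin])
qed

text \<open>Outside \<open>S\<close> the map \<open>T\<close> is arbitrary, so the derivative is
  relative to \<open>S\<close>; this is the form that the change of variables accepts.\<close>

lemma second_derivative_at_has_derivative_within:
  assumes A: "second_derivative_at \<phi> x p A" and T: "\<And>w. w \<in> S \<Longrightarrow> subgrad \<phi> w (T w)" and x: "x \<in> S"
  shows "(T has_derivative A) (at x within S)"
  unfolding has_derivative_within_alt
proof (intro conjI allI impI)
  have Tx: "T x = p" by (rule second_derivative_at_unique[OF A T[OF x]])
  show "bounded_linear A" using A by (simp add: second_derivative_at_def linear_conv_bounded_linear)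
  fix e :: real assume "0 < e"
  then obtain d where "d > 0" "\<forall>w q. norm (w - x) < d \<longrightarrow> subgrad \<phi> w q \<longrightarrow> norm (q - p - A (w - x)) \<le> e * norm (w - x)"
    using A unfolding second_derivative_at_def by blast
  then show "\<exists>d>0. \<forall>y\<in>S. norm (y - x) < d \<longrightarrow> norm (T y - T x - A (y - x)) \<le> e * norm (y - x)"
    using T Tx by blast
qed

lemma second_derivative_at_has_derivative:
  fixes \<phi> :: "'a::euclidean_space \<Rightarrow> real"
  assumes cv: "convex_on UNIV \<phi>" and A: "second_derivative_at \<phi> x p A"
  shows "(\<phi> has_derivative (\<lambda>h. p \<bullet> h)) (at x)"
proof -
  obtain p' where "subgrad \<phi> x p'" using subgrad_exists[OF cv] .
  with second_derivative_at_unique[OF A] have p: "subgrad \<phi> x p" by metis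
  have lin: "linear A" using A by (simp add: second_derivative_at_def)
  obtain K where K: "K > 0" "\<And>v. norm (A v) \<le> K * norm v" using linear_bounded_pos[OF lin] by blast
  obtain d where d: "d > 0" "\<And>w q. norm (w - x) < d \<Longrightarrow> subgrad \<phi> w q \<Longrightarrow> norm (q - p - A (w - x)) \<le> 1 * norm (w - x)"
    using second_derivative_atD[OF A zero_less_one] by blast
  show ?thesis
    unfolding has_derivative_at_alt
  proof (intro conjI allI impI)
    fix e :: real assume e: "0 < e"
    define r where "r = min d (e / (K + 1))"
    have r: "r > 0" using d e K by (simp add: r_def)
    have "norm (\<phi> y - \<phi> x - p \<bullet> (y - x)) \<le> e * norm (y - x)" if y: "norm (y - x) < r" for y
    proof -
      obtain q where q: "subgrad \<phi> y q" using subgrad_exists[OF cv] .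
      have "norm (q - p) \<le> norm (q - p - A (y - x)) + norm (A (y - x))"
        using norm_triangle_ineq[of "q - p - A (y - x)" "A (y - x)"] by simp
      also have "\<dots> \<le> (K + 1) * norm (y - x)"
        using d(2)[OF _ q] K(2)[of "y - x"] y by (simp add: r_def algebra_simps)
      also have "\<dots> \<le> (K + 1) * (e / (K + 1))" using y K by (intro mult_left_mono) (auto simp: r_def)
      also have "\<dots> = e" using K by simp
      finally have qp: "norm (q - p) \<le> e" .
      have lo: "0 \<le> \<phi> y - \<phi> x - p \<bullet> (y - x)" using subgradD[OF p, of y] by simp
      have "\<phi> y - \<phi> x - p \<bullet> (y - x) \<le> (q - p) \<bullet> (y - x)" using subgradD[OF q, of x] by (simp add: inner_simps)
      also have "\<dots> \<le> norm (q - p) * norm (y - x)" by (rule norm_cauchy_schwarz)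
      also have "\<dots> \<le> e * norm (y - x)" by (intro mult_right_mono qp) auto
      finally show ?thesis using lo by simp
    qed
    then show "\<exists>d>0. \<forall>y. norm (y - x) < d \<longrightarrow> norm (\<phi> y - \<phi> x - p \<bullet> (y - x)) \<le> e * norm (y - x)"
      using r by blast
  qed (rule bounded_linear_inner_right)
qed

lemma second_derivative_at_nonneg:
  fixes \<phi> :: "'a::euclidean_space \<Rightarrow> real"
  assumes cv: "convex_on UNIV \<phi>" and A: "second_derivative_at \<phi> x p A"
  shows "0 \<le> u \<bullet> A u"
proof (cases "u = 0")
  case False
  obtain p' where "subgrad \<phi> x p'" using subgrad_exists[OF cv] .
  with second_derivative_at_unique[OF A] have p: "subgrad \<phi> x p" by metis
  have lin: "linear A" using A by (simp add: second_derivative_at_def)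
  show ?thesis
  proof (rule field_le_epsilon)
    fix e :: real assume e: "0 < e"
    define k where "k = e / (norm u * norm u)"
    have k: "k > 0" using e False by (simp add: k_def)
    obtain d where d: "d > 0" "\<And>w q. norm (w - x) < d \<Longrightarrow> subgrad \<phi> w q \<Longrightarrow> norm (q - p - A (w - x)) \<le> k * norm (w - x)"
      using second_derivative_atD[OF A k] by blast
    define s where "s = d / (2 * norm u)"
    have s: "s > 0" using d False by (simp add: s_def)
    obtain q where q: "subgrad \<phi> (x + s *\<^sub>R u) q" using subgrad_exists[OF cv] .
    have "norm (s *\<^sub>R u) = d / 2" using s False d by (simp add: s_def)
    then have "norm (q - p - A (s *\<^sub>R u)) \<le> k * (s * norm u)"
      using d(2)[OF _ q] d(1) s by simp
    then have b: "norm (q - p - s *\<^sub>R A u) \<le> k * (s * norm u)" by (simp add: linear_cmul[OF lin])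
    have "0 \<le> s * ((q - p) \<bullet> u)" using subgrad_monotone[OF q p] by simp
    then have "0 \<le> (q - p) \<bullet> u" using s by (simp add: zero_le_mult_iff)
    also have "(q - p) \<bullet> u = (q - p - s *\<^sub>R A u) \<bullet> u + s * (u \<bullet> A u)" by (simp add: inner_simps inner_commute)
    also have "(q - p - s *\<^sub>R A u) \<bullet> u \<le> norm (q - p - s *\<^sub>R A u) * norm u" by (rule norm_cauchy_schwarz)
    also have "\<dots> \<le> k * (s * norm u) * norm u" by (intro mult_right_mono b) auto
    also have "\<dots> = s * e" using False by (simp add: k_def)
    finally have "s * 0 \<le> s * (u \<bullet> A u + e)" by (simp add: algebra_simps)
    then show "0 \<le> u \<bullet> A u + e" using s by (simp add: zero_le_mult_iff)
  qed
qed simp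

section \<open>Logarithmic concavity of the determinant\<close>

text \<open>A quadratic form that vanishes at \<open>v\<close> and is nonnegative along the line
  through \<open>v\<close> in direction \<open>w\<close> has no linear term there. The set
  \<open>S\<close> covers forms that are nonnegative on a subspace only, as in the construction of
  eigenvectors.\<close>

lemma psd_form_zero:
  fixes Q :: "'a::euclidean_space \<Rightarrow> 'a"
  assumes lin: "linear Q" and sym: "\<And>u v. Q u \<bullet> v = u \<bullet> Q v"
    and S: "\<And>s. v + s *\<^sub>R w \<in> S" and nonneg: "\<And>u. u \<in> S \<Longrightarrow> 0 \<le> u \<bullet> Q u"
    and v: "v \<bullet> Q v = 0"
  shows "w \<bullet> Q v = 0"
proof (rule ccontr)
  assume ne: "w \<bullet> Q v \<noteq> 0"
  define b where "b = w \<bullet> Q v"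
  define c where "c = \<bar>w \<bullet> Q w\<bar> + 1"
  have c: "c > 0" by (simp add: c_def)
  have "0 \<le> (v + s *\<^sub>R w) \<bullet> Q (v + s *\<^sub>R w)" for s using nonneg[OF S] .
  moreover have "(v + s *\<^sub>R w) \<bullet> Q (v + s *\<^sub>R w) = 2 * s * b + s\<^sup>2 * (w \<bullet> Q w)" for s
  proof -
    have "v \<bullet> Q w = b" unfolding b_def using sym[of v w] by (simp add: inner_commute)
    then show ?thesis
      by (simp add: linear_add[OF lin] linear_cmul[OF lin] inner_simps v b_def power2_eq_square algebra_simps)
  qed
  ultimately have "0 \<le> 2 * s * b + s\<^sup>2 * (w \<bullet> Q w)" for s by metis
  \<comment> \<open>Since \<open>c\<close> exceeds the quadratic coefficient, the linear term wins
    at \<open>- b / c\<close> and leaves \<open>- (b * b) / c\<close>.\<close>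
  from this[of "- b / c"] have "0 \<le> - 2 * (b * b) / c + (b / c)\<^sup>2 * (w \<bullet> Q w)" by simp
  also have "(b / c)\<^sup>2 * (w \<bullet> Q w) \<le> (b / c)\<^sup>2 * c" by (intro mult_left_mono) (auto simp: c_def)
  also have "\<dots> = b * b / c" using c by (simp add: power2_eq_square field_simps)
  finally have "0 \<le> - (b * b) / c" by (simp add: field_simps)
  then have "b * b \<le> 0" using c by (simp add: divide_le_0_iff)
  then show False using ne by (auto simp: b_def mult_le_0_iff)
qed

text \<open>The next generalised eigenvector maximises \<open>u \<bullet> B u / (u \<bullet> A u)\<close> on the
  \<open>A\<close>-orthogonal complement of the previous ones.\<close>
lemma generalized_eigenvectors:
  fixes A B :: "real^'k \<Rightarrow> real^'k" and K :: "'k::finite set"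
  assumes linA: "linear A" and symA: "\<And>u v. A u \<bullet> v = u \<bullet> A v" and posA: "\<And>u. u \<noteq> 0 \<Longrightarrow> 0 < u \<bullet> A u"
    and linB: "linear B" and symB: "\<And>u v. B u \<bullet> v = u \<bullet> B v"
  shows "\<exists>v c. (\<forall>i\<in>K. \<forall>j\<in>K. v i \<bullet> A (v j) = (if i = j then 1 else 0)) \<and> (\<forall>i\<in>K. B (v i) = c i *\<^sub>R A (v i))"
proof -
  have "finite K" by simp
  then show ?thesis
  proof (induction K rule: finite_induct)
    case (insert k K)
    then obtain v c where v: "\<And>i j. i \<in> K \<Longrightarrow> j \<in> K \<Longrightarrow> v i \<bullet> A (v j) = (if i = j then 1 else 0)"
      "\<And>i. i \<in> K \<Longrightarrow> B (v i) = c i *\<^sub>R A (v i)" by blast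
    define S where "S = {x. \<forall>j\<in>K. x \<bullet> A (v j) = 0}"
    have S_lin: "x + s *\<^sub>R y \<in> S" if "x \<in> S" "y \<in> S" for x y s
      using that by (simp add: S_def inner_add_left)
    have "S = (\<Inter>j\<in>K. {x. A (v j) \<bullet> x = 0})" by (auto simp: S_def inner_commute)
    then have clS: "closed S" by (auto intro: closed_hyperplane)
    have "dim ((\<lambda>j. A (v j)) ` K) \<le> card ((\<lambda>j. A (v j)) ` K)" by (rule dim_le_card') simp
    also have "\<dots> \<le> card K" by (rule card_image_le) simp
    also have "\<dots> < CARD('k)" using insert.hyps by (intro psubset_card_mono) auto
    finally have "dim ((\<lambda>j. A (v j)) ` K) < DIM(real^'k)" by simp
    then obtain x0 where x0: "x0 \<noteq> 0" "\<And>y. y \<in> span ((\<lambda>j. A (v j)) ` K) \<Longrightarrow> orthogonal x0 y"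
      using orthogonal_to_subspace_exists by blast
    have x0S: "x0 \<in> S" using x0(2) by (auto simp: S_def orthogonal_def intro: span_base)
    define q where "q x = (x \<bullet> B x) / (x \<bullet> A x)" for x
    define C where "C = S \<inter> sphere 0 1"
    have contA: "continuous_on C A" and contB: "continuous_on C B"
      using linA linB by (auto intro: linear_continuous_on simp: linear_conv_bounded_linear)
    have "compact C" unfolding C_def by (intro closed_Int_compact clS) simp
    moreover have "(1 / norm x0) *\<^sub>R x0 \<in> C" using x0 x0S by (auto simp: C_def S_def)
    moreover have "continuous_on C q" unfolding q_def
    proof (intro continuous_intros contA contB ballI)
      fix x assume "x \<in> C"
      then have "x \<noteq> 0" by (auto simp: C_def)
      from posA[OF this] show "x \<bullet> A x \<noteq> 0" by simp
    qed
    ultimately obtain u where u: "u \<in> C" "\<And>x. x \<in> C \<Longrightarrow> q x \<le> q u"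
      using continuous_attains_sup[of C q] by blast
    have u0: "u \<noteq> 0" "u \<in> S" using u(1) by (auto simp: C_def)
    define m where "m = q u"
    have qle: "x \<bullet> B x \<le> m * (x \<bullet> A x)" if x: "x \<in> S" for x
    proof (cases "x = 0")
      case False
      have "(1 / norm x) *\<^sub>R x \<in> C" using x False by (auto simp: C_def S_def)
      then have "q ((1 / norm x) *\<^sub>R x) \<le> m" unfolding m_def by (rule u)
      moreover have "q ((1 / norm x) *\<^sub>R x) = q x"
        using False by (simp add: q_def linear_cmul[OF linA] linear_cmul[OF linB])
      ultimately show ?thesis using posA[OF False] by (simp add: q_def pos_divide_le_eq)
    qed (simp add: linear_0[OF linA] linear_0[OF linB])
    \<comment> \<open>\<open>Q\<close> is nonnegative on \<open>S\<close> and vanishes at the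
      maximiser \<open>u\<close>, so \<open>Q u\<close> is orthogonal to \<open>S\<close>. It is
      orthogonal to the previous vectors too, because they are eigenvectors; hence
      \<open>Q u = 0\<close>.\<close>
    define Q where "Q x = m *\<^sub>R A x - B x" for x
    have linQ: "linear Q" unfolding Q_def[abs_def] by (intro linear_compose_sub linear_compose_scale_right linA linB)
    have symQ: "Q x \<bullet> y = x \<bullet> Q y" for x y by (simp add: Q_def inner_simps symA symB)
    have Qu: "u \<bullet> Q u = 0" using posA[OF u0(1)] by (simp add: Q_def inner_simps m_def q_def)
    have QS: "w \<bullet> Q u = 0" if "w \<in> S" for w
    proof (rule psd_form_zero[OF linQ symQ _ _ Qu])
      show "u + s *\<^sub>R w \<in> S" for s by (rule S_lin[OF u0(2) that])
      show "0 \<le> x \<bullet> Q x" if "x \<in> S" for x using qle[OF that] by (simp add: Q_def inner_simps)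
    qed
    have Qv: "v j \<bullet> Q u = 0" if j: "j \<in> K" for j
    proof -
      have uj: "u \<bullet> A (v j) = 0" using u0(2) j by (simp add: S_def)
      have "v j \<bullet> Q u = Q (v j) \<bullet> u" by (simp add: symQ)
      also have "\<dots> = 0" by (simp add: Q_def v(2)[OF j] inner_simps inner_commute[of _ u] uj)
      finally show ?thesis .
    qed
    have "w \<bullet> Q u = 0" for w
    proof -
      define p where "p = (\<Sum>j\<in>K. (w \<bullet> A (v j)) *\<^sub>R v j)"
      have "w - p \<in> S"
        unfolding S_def
      proof (intro CollectI ballI)
        fix i assume i: "i \<in> K"
        have "p \<bullet> A (v i) = (\<Sum>j\<in>K. if j = i then w \<bullet> A (v j) else 0)"
          unfolding p_def inner_sum_left using i by (intro sum.cong) (auto simp: v(1))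
        also have "\<dots> = w \<bullet> A (v i)" using i by (subst sum.delta) auto
        finally show "(w - p) \<bullet> A (v i) = 0" by (simp add: inner_diff_left)
      qed
      then have "(w - p) \<bullet> Q u = 0" by (rule QS)
      moreover have "p \<bullet> Q u = 0" unfolding p_def by (simp add: inner_sum_left Qv)
      ultimately show ?thesis by (simp add: inner_diff_left)
    qed
    then have "Q u = 0" using inner_eq_zero_iff by blast
    then have Bu: "B u = m *\<^sub>R A u" by (simp add: Q_def)
    define t where "t = 1 / sqrt (u \<bullet> A u)"
    have t2: "t * (t * (u \<bullet> A u)) = 1" using posA[OF u0(1)] by (simp add: t_def real_div_sqrt)
    define v' where "v' = v(k := t *\<^sub>R u)"
    have 1: "v' i \<bullet> A (v' j) = (if i = j then 1 else 0)" if ij: "i \<in> insert k K" "j \<in> insert k K" for i j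
    proof -
      have uj: "u \<bullet> A (v j) = 0" "v j \<bullet> A u = 0" if "j \<in> K" for j
        using u0(2) that symA[of "v j" u] by (auto simp: S_def inner_commute)
      show ?thesis using ij insert.hyps(2) uj t2
        by (auto simp: v'_def v(1) linear_cmul[OF linA])
    qed
    have "B (v' i) = (c(k := m)) i *\<^sub>R A (v' i)" if "i \<in> insert k K" for i
      using that insert.hyps(2) by (auto simp: v'_def v(2) Bu linear_cmul[OF linA] linear_cmul[OF linB])
    with 1 show ?case by blast
  qed simp
qed

text \<open>In a basis that diagonalises the form, the determinant is a product up to the squared
  determinant of the basis. That factor is common to all forms diagonalised by the same
  basis.\<close>

lemma det_matrix_congruence:
  fixes v :: "'k \<Rightarrow> real^'k::finite" and A :: "real^'k \<Rightarrow> real^'k"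
  assumes lin: "linear A" and orth: "\<And>i j. v i \<bullet> A (v j) = (if i = j then d i else 0)"
  defines "M \<equiv> (\<chi> i j. v j $ i)"
  shows "(det M)\<^sup>2 * det (matrix A) = (\<Prod>i\<in>UNIV. d i)"
proof -
  have "transpose M ** (matrix A ** M) = (\<chi> i j. if i = j then d i else 0)"
  proof -
    have "(matrix A ** M) $ k $ j = A (v j) $ k" for j k
    proof -
      have "A (v j) = matrix A *v v j" using fun_cong[OF matrix_vector_mul(2)[OF lin], of "v j"] by simp
      then show ?thesis by (simp add: matrix_matrix_mult_def matrix_vector_mult_def M_def)
    qed
    moreover have "(transpose M ** N) $ i $ j = (\<Sum>k\<in>UNIV. v i $ k * N $ k $ j)" for N :: "real^'k^'k" and i j
      by (simp add: matrix_matrix_mult_def transpose_def M_def)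
    ultimately have "(transpose M ** (matrix A ** M)) $ i $ j = v i \<bullet> A (v j)" for i j
      by (simp add: inner_vec_def)
    then show ?thesis by (simp add: vec_eq_iff orth)
  qed
  then have "det (transpose M) * (det (matrix A) * det M) = det (\<chi> i j. if i = j then d i else 0)"
    by (simp only: det_mul[symmetric])
  also have "\<dots> = (\<Prod>i\<in>UNIV. d i)" by (subst det_diagonal) auto
  finally show ?thesis by (simp add: det_transpose power2_eq_square algebra_simps)
qed

lemma weighted_am_gm_one:
  fixes c t :: real
  assumes "0 < c" "0 \<le> t" "t \<le> 1"
  shows "c powr t \<le> 1 - t + t * c"
proof -
  have "(1 - t) * exp 0 + t * exp (ln c) \<ge> exp ((1 - t) *\<^sub>R 0 + t *\<^sub>R ln c)"
    using convex_onD[OF exp_convex, of t 0 "ln c"] assms by simp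
  then show ?thesis using assms by (simp add: powr_def)
qed

text \<open>In a common eigenbasis the three determinants are \<open>m\<close>, \<open>m\<close>
  times the product of the \<open>c i\<close>, and \<open>m\<close> times the product of the
  \<open>1 - t + t * c i\<close>; the weighted arithmetic-geometric inequality applies factor by
  factor.\<close>

lemma det_log_concave:
  fixes A B :: "real^'k::finite \<Rightarrow> real^'k"
  assumes linA: "linear A" and symA: "\<And>u v. A u \<bullet> v = u \<bullet> A v" and posA: "\<And>u. 0 \<le> u \<bullet> A u"
    and detA: "det (matrix A) \<noteq> 0"
    and linB: "linear B" and symB: "\<And>u v. B u \<bullet> v = u \<bullet> B v" and posB: "\<And>u. 0 \<le> u \<bullet> B u"
    and detB: "det (matrix B) \<noteq> 0"
    and t: "0 \<le> t" "t \<le> 1"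
  shows "0 < det (matrix A)" "0 < det (matrix B)"
    "det (matrix A) powr (1 - t) * det (matrix B) powr t \<le> det (matrix (\<lambda>x. (1 - t) *\<^sub>R A x + t *\<^sub>R B x))"
proof -
  \<comment> \<open>A semidefinite form that is zero at some \<open>u \<noteq> 0\<close> has
    \<open>u\<close> in its kernel, contrary to the nonzero determinant.\<close>
  have pd: "0 < u \<bullet> C u" if "linear C" "\<And>u v. C u \<bullet> v = u \<bullet> C v" "\<And>u. 0 \<le> u \<bullet> C u" "det (matrix C) \<noteq> 0" "u \<noteq> 0"
    for C :: "real^'k \<Rightarrow> real^'k" and u
  proof (rule ccontr)
    assume "\<not> 0 < u \<bullet> C u"
    then have z: "u \<bullet> C u = 0" using that(3)[of u] by simp
    have "w \<bullet> C u = 0" for w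
      by (rule psd_form_zero[of C u w UNIV, OF that(1) that(2) _ _ z]) (use that(3) in auto)
    then have "C u = 0" using inner_eq_zero_iff by blast
    then have "matrix C *v u = 0" using fun_cong[OF matrix_vector_mul(2)[OF that(1)], of u] by simp
    moreover have "invertible (matrix C)" using that(4) by (simp add: invertible_det_nz)
    ultimately show False using \<open>u \<noteq> 0\<close> by (metis invertible_left_inverse matrix_left_invertible_ker)
  qed
  have pdA: "0 < u \<bullet> A u" if "u \<noteq> 0" for u by (rule pd[OF linA symA posA detA that])
  have pdB: "0 < u \<bullet> B u" if "u \<noteq> 0" for u by (rule pd[OF linB symB posB detB that])
  obtain v :: "'k \<Rightarrow> real^'k" and c where v: "\<And>i j. v i \<bullet> A (v j) = (if i = j then 1 else 0)" "\<And>i. B (v i) = c i *\<^sub>R A (v i)"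
  proof -
    have "\<exists>(v :: 'k \<Rightarrow> real^'k) c. (\<forall>i\<in>UNIV. \<forall>j\<in>UNIV. v i \<bullet> A (v j) = (if i = j then 1 else 0)) \<and> (\<forall>i\<in>UNIV. B (v i) = c i *\<^sub>R A (v i))"
      by (rule generalized_eigenvectors[OF linA symA pdA linB symB])
    then show thesis using that by auto
  qed
  have c0: "0 < c i" for i
  proof -
    have "v i \<noteq> 0" using v(1)[of i i] by auto
    then have "0 < v i \<bullet> B (v i)" by (rule pdB)
    then show ?thesis by (simp add: v)
  qed
  define M where "M = (\<chi> i j. v j $ i)"
  have dA: "(det M)\<^sup>2 * det (matrix A) = (\<Prod>i\<in>(UNIV :: 'k set). 1)"
    unfolding M_def by (rule det_matrix_congruence[OF linA]) (simp add: v)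
  have dB: "(det M)\<^sup>2 * det (matrix B) = (\<Prod>i\<in>UNIV. c i)"
    unfolding M_def by (rule det_matrix_congruence[OF linB]) (simp add: v)
  have linC: "linear (\<lambda>x. (1 - t) *\<^sub>R A x + t *\<^sub>R B x)"
    by (intro linear_compose_add linear_compose_scale_right linA linB)
  have dC: "(det M)\<^sup>2 * det (matrix (\<lambda>x. (1 - t) *\<^sub>R A x + t *\<^sub>R B x)) = (\<Prod>i\<in>UNIV. 1 - t + t * c i)"
    unfolding M_def by (rule det_matrix_congruence[OF linC]) (simp add: v inner_simps)
  have M0: "0 < (det M)\<^sup>2" using dA by (metis mult_zero_left prod.neutral_const zero_less_power2 zero_neq_one power_zero_numeral)
  define m where "m = 1 / (det M)\<^sup>2"
  have m: "m > 0" using M0 by (simp add: m_def)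
  have A: "det (matrix A) = m" using dA M0 by (simp add: m_def field_simps)
  have B: "det (matrix B) = m * (\<Prod>i\<in>UNIV. c i)" using dB M0 by (simp add: m_def field_simps)
  have C: "det (matrix (\<lambda>x. (1 - t) *\<^sub>R A x + t *\<^sub>R B x)) = m * (\<Prod>i\<in>UNIV. 1 - t + t * c i)"
    using dC M0 by (simp add: m_def field_simps)
  have P0: "0 < (\<Prod>i\<in>UNIV. c i)" using c0 by (intro prod_pos) auto
  show "0 < det (matrix A)" "0 < det (matrix B)" using m P0 by (simp_all add: A B)
  have "det (matrix A) powr (1 - t) * det (matrix B) powr t = m powr (1 - t) * m powr t * (\<Prod>i\<in>UNIV. c i) powr t"
    using m P0 by (simp add: A B powr_mult)
  also have "m powr (1 - t) * m powr t = m" using m by (simp add: powr_add[symmetric])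
  also have "(\<Prod>i\<in>UNIV. c i) powr t = (\<Prod>i\<in>UNIV. c i powr t)"
    by (rule prod_powr_distrib)
  also have "m * \<dots> \<le> m * (\<Prod>i\<in>UNIV. 1 - t + t * c i)"
    using m t c0 by (intro mult_left_mono prod_mono conjI weighted_am_gm_one) auto
  finally show "det (matrix A) powr (1 - t) * det (matrix B) powr t \<le> det (matrix (\<lambda>x. (1 - t) *\<^sub>R A x + t *\<^sub>R B x))"
    by (simp only: C)
qed

section \<open>Transport by gradients of convex functions\<close>

lemma has_integral_indicator_lborel:
  fixes g :: "'a::euclidean_space \<Rightarrow> real"
  assumes "integrable lborel g" "A \<in> sets borel"
  shows "(g has_integral (\<integral>x. indicator A x * g x \<partial>lborel)) A"
proof -
  have "integrable lborel (\<lambda>x. indicator A x * g x)"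
    using integrable_mult_indicator[of A lborel g] assms by simp
  then have "((\<lambda>x. indicator A x * g x) has_integral (\<integral>x. indicator A x * g x \<partial>lborel)) UNIV"
    by (rule has_integral_integral_lborel)
  moreover have "(\<lambda>x. indicator A x * g x) = (\<lambda>x. if x \<in> A then g x else 0)" by auto
  ultimately show ?thesis by (simp only: has_integral_restrict_UNIV)
qed

lemma absolutely_integrable_on_of_integrable:
  fixes g :: "'a::euclidean_space \<Rightarrow> real"
  assumes "integrable lborel g" "A \<in> sets lebesgue"
  shows "g absolutely_integrable_on A"
proof -
  have "integrable lebesgue g" using assms(1) integrable_completion[of g lborel] by auto
  then show ?thesis unfolding set_integrable_def by (rule integrable_mult_indicator[OF assms(2)])
qed

lemma det_scaleR_linear:
  fixes L :: "real^'k::finite \<Rightarrow> real^'k"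
  assumes "linear L"
  shows "det (matrix (\<lambda>v. c *\<^sub>R L v)) = c ^ CARD('k) * det (matrix L)"
proof -
  have "matrix ((*\<^sub>R) c \<circ> L) = matrix ((*\<^sub>R) c :: real^'k \<Rightarrow> _) ** matrix L"
    by (rule matrix_compose[OF assms]) (simp add: linear_scaleR)
  then have "matrix (\<lambda>v. c *\<^sub>R L v) = matrix ((*\<^sub>R) c :: real^'k \<Rightarrow> _) ** matrix L" by (simp add: comp_def)
  then show ?thesis by (simp only: det_mul det_matrix_scaleR)
qed

lemma AE_borel_subset:
  assumes "AE x in lborel. P x"
  obtains X where "X \<in> sets borel" "AE x in lborel. x \<in> X" "\<And>x. x \<in> X \<Longrightarrow> P x"
proof -
  from assms obtain N where N: "{x. \<not> P x} \<subseteq> N" "N \<in> null_sets lborel"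
    unfolding eventually_ae_filter by auto
  show thesis
  proof (rule that[of "- N"])
    show "- N \<in> sets borel" using N(2) by (auto simp: null_sets_def)
    show "AE x in lborel. x \<in> - N" using AE_not_in[OF N(2)] by simp
  qed (use N in auto)
qed

text \<open>The data are symmetric in source and target, so every statement also holds for the
  inverse transport through \<open>dual\<close>. The densities need not have mass one, and
  \<open>T\<close> and \<open>S\<close> select subgradients only almost everywhere.\<close>

locale transport =
  fixes \<phi> \<psi> :: "'a::euclidean_space \<Rightarrow> real" and f g :: "'a \<Rightarrow> real" and T S :: "'a \<Rightarrow> 'a"
  assumes convex_phi: "convex_on UNIV \<phi>" and convex_psi: "convex_on UNIV \<psi>"
    and conj: "\<And>x y. subgrad \<phi> x y \<longleftrightarrow> subgrad \<psi> y x"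
    and mT [measurable]: "T \<in> borel_measurable borel" and mS [measurable]: "S \<in> borel_measurable borel"
    and cf: "continuous_on UNIV f" and cg: "continuous_on UNIV g"
    and f_pos: "\<And>x. 0 < f x" and g_pos: "\<And>y. 0 < g y"
    and f_int: "integrable lborel f" and g_int: "integrable lborel g"
    and push_T: "distr (density lborel (\<lambda>x. ennreal (f x))) borel T = density lborel (\<lambda>x. ennreal (g x))"
    and push_S: "distr (density lborel (\<lambda>x. ennreal (g x))) borel S = density lborel (\<lambda>x. ennreal (f x))"
    and AE_T: "AE x in lborel. subgrad \<phi> x (T x)" and AE_S: "AE y in lborel. subgrad \<psi> y (S y)"
begin

lemma dual: "transport \<psi> \<phi> g f S T"
  by unfold_locales (rule convex_phi convex_psi conj[symmetric] mT mS cf cg f_pos g_pos f_int g_int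
      push_T push_S AE_T AE_S)+

lemma mf [measurable]: "f \<in> borel_measurable borel" and mg [measurable]: "g \<in> borel_measurable borel"
  by (auto intro: borel_measurable_continuous_onI cf cg)

lemma AE_compose_T:
  assumes "AE y in lborel. P y" shows "AE x in lborel. P (T x)"
proof -
  have "AE y in density lborel (\<lambda>x. ennreal (g x)). P y"
    using assms by (subst AE_density) (auto elim: eventually_mono)
  then have "AE y in distr (density lborel (\<lambda>x. ennreal (f x))) borel T. P y" unfolding push_T .
  then have "AE x in density lborel (\<lambda>x. ennreal (f x)). P (T x)" by (rule AE_distrD[rotated]) simp
  then show ?thesis using f_pos by (simp add: AE_density)
qed

lemma integral_push_S:
  fixes h :: "'a \<Rightarrow> real"
  assumes [measurable]: "h \<in> borel_measurable borel"
  shows "(\<integral>y. h (S y) * g y \<partial>lborel) = (\<integral>x. h x * f x \<partial>lborel)"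
proof -
  have "(\<integral>y. h (S y) * g y \<partial>lborel) = integral\<^sup>L (density lborel (\<lambda>x. ennreal (g x))) (\<lambda>y. h (S y))"
    by (subst integral_real_density) (simp_all add: g_pos less_imp_le mult.commute[of "g _"])
  also have "\<dots> = integral\<^sup>L (distr (density lborel (\<lambda>x. ennreal (g x))) borel S) h"
    by (subst integral_distr) auto
  also have "\<dots> = (\<integral>x. h x * f x \<partial>lborel)"
    unfolding push_S
    by (subst integral_real_density) (simp_all add: f_pos less_imp_le mult.commute[of "f _"])
  finally show ?thesis .
qed

text \<open>Equality in monotonicity means that \<phi> is affine between \<open>w\<close> and
  \<open>x\<close>, so a slope at one end supports at the other. This is what makes interpolated
  gradients injective.\<close>

lemma affine_imp_subgrad:
  assumes p: "subgrad \<phi> x p" and q: "subgrad \<phi> w q" and eq: "(p - q) \<bullet> (x - w) \<le> 0"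
  shows "subgrad \<phi> w p"
proof -
  have "\<phi> x \<ge> \<phi> w + q \<bullet> (x - w)" by (rule subgradD[OF q])
  then have "\<phi> w \<le> \<phi> x + p \<bullet> (w - x)" using eq by (simp add: inner_simps)
  then have *: "\<phi> w + p \<bullet> (y - w) \<le> \<phi> x + p \<bullet> (y - x)" for y by (simp add: inner_simps)
  show ?thesis unfolding subgrad_def
    using order_trans[OF * subgradD[OF p]] by blast
qed

end

section \<open>The Monge-Ampere equation and the comparison of masses\<close>

locale transport_cart = transport \<phi> \<psi> f g T S
  for \<phi> \<psi> :: "real^'k::{finite,wellorder} \<Rightarrow> real" and f g T S
begin

text \<open>At such points \<open>T x\<close> is the only subgradient, and \<open>T\<close> is
  injective on them because \<open>S\<close> recovers the point.\<close>

definition good :: "(real, 'k) vec \<Rightarrow> bool" where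
  "good x \<longleftrightarrow> subgrad \<phi> x (T x) \<and> S (T x) = x \<and> (\<exists>A. second_derivative_at \<phi> x (T x) A)"

definition hess :: "(real, 'k) vec \<Rightarrow> (real, 'k) vec \<Rightarrow> (real, 'k) vec" where
  "hess x = (SOME A. second_derivative_at \<phi> x (T x) A)"

lemma good_hess: "good x \<Longrightarrow> second_derivative_at \<phi> x (T x) (hess x)"
  unfolding good_def hess_def using someI_ex[of "second_derivative_at \<phi> x (T x)"] by blast

lemma good_unique: "good x \<Longrightarrow> subgrad \<phi> x p \<Longrightarrow> p = T x"
  using second_derivative_at_unique good_hess by blast

lemma AE_S_unique: "AE y in lborel. \<forall>x. subgrad \<psi> y x \<longrightarrow> x = S y"
  using alexandrov[OF convex_psi] AE_S
  by eventually_elim (metis second_derivative_at_unique)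

lemma AE_good: "AE x in lborel. good x"
  using AE_T AE_compose_T[OF AE_S_unique] alexandrov[OF convex_phi]
proof eventually_elim
  case (elim x)
  then have "subgrad \<psi> (T x) x" by (simp add: conj)
  then have "S (T x) = x" using elim by simp
  moreover obtain p A where "second_derivative_at \<phi> x p A" "subgrad \<phi> x p" using elim by blast
  moreover from this have "T x = p" using elim second_derivative_at_unique by blast
  ultimately show ?case using elim by (auto simp: good_def)
qed

lemma inj_on_T: "x \<in> {x. good x} \<Longrightarrow> w \<in> {x. good x} \<Longrightarrow> T x = T w \<Longrightarrow> x = w"
  unfolding good_def mem_Collect_eq by metis

lemma change_of_variables:
  assumes E: "E \<in> sets borel" and D: "\<And>x. x \<in> E \<Longrightarrow> (H has_derivative D x) (at x within E)" and inj: "inj_on H E"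
  shows "((\<lambda>x. \<bar>det (matrix (D x))\<bar> * g (H x)) has_integral integral (H ` E) g) E"
    and "H ` E \<in> sets lebesgue"
proof -
  have EL: "E \<in> sets lebesgue" using E by simp
  show HE: "H ` E \<in> sets lebesgue"
    by (rule differentiable_image_in_sets_lebesgue[OF EL]) (use D in \<open>auto simp: differentiable_on_def differentiable_def\<close>)
  have "g absolutely_integrable_on H ` E" by (rule absolutely_integrable_on_of_integrable[OF g_int HE])
  \<comment> \<open>The scalar \<open>g\<close> is viewed as a map into \<open>real^1\<close>, to
    which the vector-valued formula applies; \<open>E\<close> is merely Borel, with derivatives
    relative to it.\<close>
  then have "(\<lambda>y. vec (g y) :: real^1) absolutely_integrable_on H ` E \<and> integral (H ` E) (\<lambda>y. vec (g y) :: real^1) = vec (integral (H ` E) g)"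
    by (simp add: absolutely_integrable_on_1_iff integral_on_1_eq)
  then have "(\<lambda>x. \<bar>det (matrix (D x))\<bar> *\<^sub>R (vec (g (H x)) :: real^1)) absolutely_integrable_on E \<and>
      integral E (\<lambda>x. \<bar>det (matrix (D x))\<bar> *\<^sub>R (vec (g (H x)) :: real^1)) = vec (integral (H ` E) g)"
    using has_absolute_integral_change_of_variables[OF EL D inj, of "\<lambda>y. vec (g y) :: real^1" "vec (integral (H ` E) g)"]
    by simp
  then have "(\<lambda>x. \<bar>det (matrix (D x))\<bar> * g (H x)) absolutely_integrable_on E"
     "integral E (\<lambda>x. \<bar>det (matrix (D x))\<bar> * g (H x)) = integral (H ` E) g"
    by (auto simp: absolutely_integrable_on_1_iff integral_on_1_eq vec_eq_iff)
  then show "((\<lambda>x. \<bar>det (matrix (D x))\<bar> * g (H x)) has_integral integral (H ` E) g) E"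
    by (simp add: has_integral_iff absolutely_integrable_on_def)
qed

text \<open>The mass of the image of a Borel set \<open>E\<close> of good points is computed twice:
  by the change of variables, with the Jacobian, and by the push-forward, as the integral of
  \<open>f\<close> over \<open>E\<close>. Equality in all boxes gives equality almost
  everywhere.\<close>

lemma AE_monge_ampere: "AE x in lborel. \<bar>det (matrix (hess x))\<bar> * g (T x) = f x"
proof -
  obtain X where X: "X \<in> sets borel" "AE x in lborel. x \<in> X" "\<And>x. x \<in> X \<Longrightarrow> good x"
    using AE_borel_subset[OF AE_good] by blast
  define u where "u x = (if x \<in> X then \<bar>det (matrix (hess x))\<bar> * g (T x) - f x else 0)" for x
  have "(u has_integral 0) (cbox a b)" for a b
  proof -
    define E where "E = cbox a b \<inter> X"
    have E: "E \<in> sets borel" using X(1) by (simp add: E_def)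
    have gE: "good x" if "x \<in> E" for x using that X by (simp add: E_def)
    have D: "(T has_derivative hess x) (at x within E)" if "x \<in> E" for x
      by (rule second_derivative_at_has_derivative_within[OF good_hess[OF gE[OF that]] _ that])
         (use gE in \<open>auto simp: good_def\<close>)
    have inj: "inj_on T E" using gE inj_on_T by (auto intro!: inj_onI)
    note cov = change_of_variables[OF E D inj]
    \<comment> \<open>Described through the Borel maps \<open>S\<close> and \<open>T\<close>, the
      image is seen to be Borel.\<close>
    have TE: "T ` E = {y. S y \<in> E \<and> T (S y) = y}"
      using gE by (auto simp: good_def) (metis image_eqI)
    have "T ` E \<in> sets borel" unfolding TE using E by measurable
    then have "(g has_integral (\<integral>y. indicator (T ` E) y * g y \<partial>lborel)) (T ` E)"
      by (rule has_integral_indicator_lborel[OF g_int])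
    moreover have "(\<integral>y. indicator (T ` E) y * g y \<partial>lborel) = (\<integral>y. (indicator E (S y) :: real) * g y \<partial>lborel)"
    proof (rule integral_cong_AE)
      interpret d: transport \<psi> \<phi> g f S T by (rule dual)
      have "AE y in lborel. good (S y)" using AE_good by (rule d.AE_compose_T)
      then show "AE y in lborel. indicator (T ` E) y * g y = (indicator E (S y) :: real) * g y"
        using AE_S_unique AE_S
      proof eventually_elim
        case (elim y)
        then have "subgrad \<phi> (S y) y" using conj by blast
        then have "T (S y) = y" using good_unique[OF elim(1)] by simp
        then show ?case by (simp add: TE indicator_def)
      qed
      note [measurable] = E \<open>T ` E \<in> sets borel\<close>
      show "(\<lambda>y. indicator (T ` E) y * g y) \<in> borel_measurable lborel" by measurable
      show "(\<lambda>y. (indicator E (S y) :: real) * g y) \<in> borel_measurable lborel" by measurable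
    qed
    moreover have "(\<integral>y. (indicator E (S y) :: real) * g y \<partial>lborel) = (\<integral>x. indicator E x * f x \<partial>lborel)"
      by (rule integral_push_S) (use E in measurable)
    ultimately have "integral (T ` E) g = (\<integral>x. indicator E x * f x \<partial>lborel)"
      by (simp add: has_integral_iff)
    with cov(1) have "((\<lambda>x. \<bar>det (matrix (hess x))\<bar> * g (T x)) has_integral (\<integral>x. indicator E x * f x \<partial>lborel)) E" by simp
    from has_integral_diff[OF this has_integral_indicator_lborel[OF f_int E]]
    have "((\<lambda>x. \<bar>det (matrix (hess x))\<bar> * g (T x) - f x) has_integral 0) E" by simp
    then have "((\<lambda>x. if x \<in> E then \<bar>det (matrix (hess x))\<bar> * g (T x) - f x else 0) has_integral 0) UNIV"
      by (simp only: has_integral_restrict_UNIV)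
    moreover have "(\<lambda>x. if x \<in> E then \<bar>det (matrix (hess x))\<bar> * g (T x) - f x else 0) = (\<lambda>x. if x \<in> cbox a b then u x else 0)"
      by (auto simp: E_def u_def)
    ultimately show ?thesis by (simp only: has_integral_restrict_UNIV)
  qed
  from AE_zero_of_box_integrals[OF this] X(2) show ?thesis
    by eventually_elim (simp add: u_def)
qed

text \<open>If \<open>P < G\<close> exactly on the bounded open set \<open>U\<close> and \<open>p\<close> is a slope of \<open>G\<close> at a point
  of \<open>U\<close>, then \<open>P - p\<close> attains its minimum inside \<open>U\<close>; hence the gradient image of \<open>U\<close> under
  \<open>G\<close> is contained in that under \<open>P\<close>, and the change of variables compares the masses.\<close>
lemma comparison:
  fixes t \<epsilon> \<kappa> K :: real and z :: "(real, 'k) vec"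
  assumes t: "0 \<le> t" "t \<le> 1" and \<epsilon>: "0 < \<epsilon>" "\<epsilon> < 1" and K: "1 < K"
  defines "G x \<equiv> (1 - \<epsilon>) * ((1 - t) * \<phi> x + t * \<phi> (x + z))"
    and "P x \<equiv> \<phi> (x + t *\<^sub>R z) + \<kappa>"
  defines "U \<equiv> {x. P x < G x}"
  assumes bU: "bounded U"
    and dens: "\<And>x. x \<in> U \<Longrightarrow> good x \<Longrightarrow> good (x + z) \<Longrightarrow>
      K * f (x + t *\<^sub>R z) \<le> (1 - \<epsilon>) ^ CARD('k) * ((f x / g (T x)) powr (1 - t) * (f (x + z) / g (T (x + z))) powr t) *
        g ((1 - \<epsilon>) *\<^sub>R ((1 - t) *\<^sub>R T x + t *\<^sub>R T (x + z)))"
  shows "U = {}"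
proof (rule ccontr)
  assume ne: "U \<noteq> {}"
  have cphi: "continuous_on UNIV \<phi>" by (rule convex_on_UNIV_isCont[OF convex_phi])
  have cG: "continuous_on UNIV G" and cP: "continuous_on UNIV P"
    unfolding G_def P_def by (intro continuous_intros continuous_on_compose2[OF cphi]; simp)+
  have oU: "open U" unfolding U_def by (rule open_Collect_less[OF cP cG])
  then have [measurable]: "U \<in> sets borel" by simp
  \<comment> \<open>Almost everywhere \<open>H\<close> is the gradient of \<open>G\<close>, and
    \<open>D\<close> is its derivative: the interpolated Hessian scaled by
    \<open>1 - \<epsilon>\<close>.\<close>
  define H where "H x = (1 - \<epsilon>) *\<^sub>R ((1 - t) *\<^sub>R T x + t *\<^sub>R T (x + z))" for x
  define D where "D x = (\<lambda>v. (1 - \<epsilon>) *\<^sub>R ((1 - t) *\<^sub>R hess x v + t *\<^sub>R hess (x + z) v))" for x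
  have "AE x in lborel. good (x + z)"
    by (rule AE_lborel_translate[of _ "- z"]) (simp add: AE_good)
  moreover have "AE x in lborel. \<bar>det (matrix (hess (x + z)))\<bar> * g (T (x + z)) = f (x + z)"
    by (rule AE_lborel_translate[of _ "- z"]) (simp add: AE_monge_ampere)
  ultimately have "AE x in lborel. good x \<and> good (x + z) \<and> \<bar>det (matrix (hess x))\<bar> * g (T x) = f x \<and>
      \<bar>det (matrix (hess (x + z)))\<bar> * g (T (x + z)) = f (x + z)"
    using AE_good AE_monge_ampere by eventually_elim auto
  then obtain X where X: "X \<in> sets borel" "AE x in lborel. x \<in> X"
    and X': "\<And>x. x \<in> X \<Longrightarrow> good x \<and> good (x + z) \<and> \<bar>det (matrix (hess x))\<bar> * g (T x) = f x \<and>
      \<bar>det (matrix (hess (x + z)))\<bar> * g (T (x + z)) = f (x + z)"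
    using AE_borel_subset by blast
  have Xg: "good x" "good (x + z)" "\<bar>det (matrix (hess x))\<bar> * g (T x) = f x"
      "\<bar>det (matrix (hess (x + z)))\<bar> * g (T (x + z)) = f (x + z)" if "x \<in> X" for x
    using X'[OF that] by auto
  define E where "E = U \<inter> X"
  have E: "E \<in> sets borel" using oU X(1) by (simp add: E_def)
  have Hsub: "G x + H x \<bullet> (w - x) \<le> G w" if "x \<in> E" for x w
  proof -
    have 1: "\<phi> x + T x \<bullet> (w - x) \<le> \<phi> w"
      using Xg(1)[of x] that subgradD by (auto simp: E_def good_def)
    have 2: "\<phi> (x + z) + T (x + z) \<bullet> (w - x) \<le> \<phi> (w + z)"
      using Xg(2)[of x] that subgradD[of \<phi> "x + z" "T (x + z)" "w + z"] by (auto simp: E_def good_def)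
    have "(1 - \<epsilon>) * ((1 - t) * (\<phi> x + T x \<bullet> (w - x)) + t * (\<phi> (x + z) + T (x + z) \<bullet> (w - x)))
      \<le> (1 - \<epsilon>) * ((1 - t) * \<phi> w + t * \<phi> (w + z))"
      using t \<epsilon> by (intro mult_left_mono add_mono 1 2) auto
    then show ?thesis by (simp add: G_def H_def inner_simps algebra_simps)
  qed
  have DH: "(H has_derivative D x) (at x within E)" if x: "x \<in> E" for x
  proof -
    have d1: "(T has_derivative hess x) (at x within E)"
      by (rule second_derivative_at_has_derivative_within[OF good_hess _ x])
         (use x Xg in \<open>auto simp: good_def E_def\<close>)
    have d2: "(T has_derivative hess (x + z)) (at (x + z) within ((\<lambda>x. x + z) ` E))"
      by (rule second_derivative_at_has_derivative_within[OF good_hess])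
         (use x Xg in \<open>auto simp: good_def E_def\<close>)
    have "((\<lambda>x. T (x + z)) has_derivative (\<lambda>v. hess (x + z) v)) (at x within E)"
      by (rule has_derivative_in_compose[of "\<lambda>x. x + z" "\<lambda>v. v", OF _ d2]) (auto intro!: derivative_eq_intros)
    with d1 show ?thesis unfolding H_def D_def by (intro derivative_intros)
  qed
  have inj: "inj_on H E"
  proof (rule inj_onI)
    fix x w assume x: "x \<in> E" and w: "w \<in> E" and eq: "H x = H w"
    have gx: "good x" "good w" "good (x + z)" "good (w + z)" using x w Xg by (auto simp: E_def)
    have m1: "0 \<le> (T x - T w) \<bullet> (x - w)" using gx subgrad_monotone by (auto simp: good_def)
    have m2: "0 \<le> (T (x + z) - T (w + z)) \<bullet> (x - w)"
      using gx subgrad_monotone[of \<phi> "x + z" "T (x + z)" "w + z" "T (w + z)"] by (auto simp: good_def)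
    have "(1 - t) *\<^sub>R T x + t *\<^sub>R T (x + z) = (1 - t) *\<^sub>R T w + t *\<^sub>R T (w + z)"
      using eq \<epsilon> by (simp add: H_def)
    then have "((1 - t) *\<^sub>R (T x - T w) + t *\<^sub>R (T (x + z) - T (w + z))) \<bullet> (x - w) = 0"
      by (simp add: algebra_simps)
    then have sum0: "(1 - t) * ((T x - T w) \<bullet> (x - w)) + t * ((T (x + z) - T (w + z)) \<bullet> (x - w)) = 0"
      by (simp only: inner_add_left inner_scaleR_left)
    \<comment> \<open>In \<open>sum0\<close> both products are nonnegative, with weights
      \<open>1 - t\<close> and \<open>t\<close>, so a product of positive weight vanishes; for
      \<open>t = 1\<close> this can only be the second one.\<close>
    show "x = w"
    proof (cases "t = 1")
      case True
      have "subgrad \<phi> (w + z) (T (x + z))"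
      proof (rule affine_imp_subgrad)
        show "subgrad \<phi> (x + z) (T (x + z))" "subgrad \<phi> (w + z) (T (w + z))" using gx unfolding good_def by blast+
        have "(T (x + z) - T (w + z)) \<bullet> (x - w) = 0" using sum0 unfolding True by simp
        then show "(T (x + z) - T (w + z)) \<bullet> (x + z - (w + z)) \<le> 0" by simp
      qed
      then have "T (x + z) = T (w + z)" by (rule good_unique[OF gx(4)])
      then show ?thesis using inj_on_T[of "x + z" "w + z"] gx(3,4) by simp
    next
      case False
      have "(1 - t) * ((T x - T w) \<bullet> (x - w)) \<le> 0"
        using sum0 mult_nonneg_nonneg[OF t(1) m2] by linarith
      then have "(T x - T w) \<bullet> (x - w) \<le> 0" using False t by (simp add: mult_le_0_iff)
      moreover have "subgrad \<phi> x (T x)" "subgrad \<phi> w (T w)" using gx unfolding good_def by blast+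
      ultimately have "subgrad \<phi> w (T x)" using affine_imp_subgrad by blast
      then have "T x = T w" by (rule good_unique[OF gx(2)])
      then show ?thesis using inj_on_T[of x w] gx(1,2) by simp
    qed
  qed
  note cov = change_of_variables[OF E DH inj]
  have image: "\<exists>w\<in>U. subgrad \<phi> (w + t *\<^sub>R z) (H x)" if x: "x \<in> E" for x
  proof -
    have xU: "x \<in> U" using x by (simp add: E_def)
    \<comment> \<open>The affine function with slope \<open>H x\<close> that touches
      \<open>G\<close> at \<open>x\<close> lies below \<open>G\<close>, hence below \<open>P\<close>
      outside \<open>U\<close>, but above \<open>P\<close> at \<open>x\<close>; this forces the
      minimum into \<open>U\<close>.\<close>
    have out: "P x - H x \<bullet> x < P w - H x \<bullet> w" if "w \<notin> U" for w
      using Hsub[OF x, of w] that xU by (simp add: U_def inner_simps)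
    have "compact (closure U)" using bU by simp
    moreover have "continuous_on (closure U) (\<lambda>w. P w - H x \<bullet> w)"
      by (intro continuous_intros continuous_on_subset[OF cP]) auto
    ultimately obtain w where w: "w \<in> closure U" "\<And>v. v \<in> closure U \<Longrightarrow> P w - H x \<bullet> w \<le> P v - H x \<bullet> v"
      using continuous_attains_inf[of "closure U" "\<lambda>w. P w - H x \<bullet> w"] ne by auto
    have le: "P w - H x \<bullet> w \<le> P x - H x \<bullet> x" using w(2) xU closure_subset by blast
    have wU: "w \<in> U" using out[of w] le by force
    have min: "P w - H x \<bullet> w \<le> P v - H x \<bullet> v" for v
      using w(2)[of v] out[of v] le closure_subset by fastforce
    have "subgrad \<phi> (w + t *\<^sub>R z) (H x)"
      unfolding subgrad_def
    proof
      fix v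
      show "\<phi> (w + t *\<^sub>R z) + H x \<bullet> (v - (w + t *\<^sub>R z)) \<le> \<phi> v"
        using min[of "v - t *\<^sub>R z"] by (simp add: P_def inner_simps)
    qed
    then show ?thesis using wU by blast
  qed
  \<comment> \<open>Up to a null set \<open>V\<close> contains the image of \<open>E\<close> under
    \<open>H\<close>, and its mass under \<open>g\<close> equals the mass under \<open>f\<close> of
    \<open>U\<close> shifted by \<open>t *\<^sub>R z\<close>.\<close>
  define V where "V = {y. S y - t *\<^sub>R z \<in> U}"
  have "(\<lambda>y. S y - t *\<^sub>R z) \<in> borel_measurable borel" by measurable
  from measurable_sets[OF this borel_open[OF oU]] have V: "V \<in> sets borel"
    by (simp add: V_def vimage_def)
  \<comment> \<open>For \<open>y\<close> in \<open>Y\<close> the point at which \<phi> has slope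
    \<open>y\<close> is unique, so the shifted minimiser must be \<open>S y\<close>.\<close>
  obtain Y where Y: "Y \<in> sets borel" "AE y in lborel. y \<in> Y"
    and Y': "\<And>y. y \<in> Y \<Longrightarrow> \<forall>x. subgrad \<psi> y x \<longrightarrow> x = S y"
    using AE_borel_subset[OF AE_S_unique] by blast
  have nY: "negligible (- Y)"
  proof -
    have "- Y \<in> null_sets lborel" using Y(1,2) by (subst AE_iff_null_sets) auto
    then show ?thesis by (simp add: negligible_iff_null_sets null_sets_completionI)
  qed
  have sub: "H ` E \<inter> Y \<subseteq> V"
  proof
    fix y assume y: "y \<in> H ` E \<inter> Y"
    then obtain x where x: "x \<in> E" "y = H x" by blast
    obtain w where w: "w \<in> U" "subgrad \<phi> (w + t *\<^sub>R z) y" using image[OF x(1)] x(2) by blast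
    then have "w + t *\<^sub>R z = S y" using Y' y conj by blast
    from this[symmetric] have "S y - t *\<^sub>R z = w" by simp
    then show "y \<in> V" using w(1) by (simp add: V_def)
  qed
  have I1: "(g has_integral integral (H ` E) g) (H ` E)"
    using absolutely_integrable_on_of_integrable[OF g_int cov(2)]
    by (simp add: absolutely_integrable_on_def has_integral_integral)
  have "negligible (H ` E \<inter> Y - H ` E)" "negligible (H ` E - H ` E \<inter> Y)"
    by (auto intro: negligible_subset[OF nY])
  then have I2: "(g has_integral integral (H ` E) g) (H ` E \<inter> Y)"
    using I1 by (subst has_integral_spike_set_eq[of _ "H ` E"]) (auto intro: negligible_subset)
  have "integral (H ` E) g \<le> (\<integral>y. indicator V y * g y \<partial>lborel)"
    by (rule has_integral_subset_le[OF sub I2 has_integral_indicator_lborel[OF g_int V]])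
       (auto intro: less_imp_le g_pos)
  also have "\<dots> = (\<integral>y. indicator U (S y - t *\<^sub>R z) * g y \<partial>lborel)"
    by (intro Bochner_Integration.integral_cong) (auto simp: V_def indicator_def)
  also have "\<dots> = (\<integral>x. indicator U (x - t *\<^sub>R z) * f x \<partial>lborel)"
    by (rule integral_push_S[of "\<lambda>x. indicator U (x - t *\<^sub>R z)"]) measurable
  also have "\<dots> = (\<integral>x. indicator U (x - t *\<^sub>R z) * f x \<partial>distr lborel borel ((+) (t *\<^sub>R z)))"
    by (simp add: lborel_distr_plus)
  also have "\<dots> = (\<integral>x. indicator U x * f (x + t *\<^sub>R z) \<partial>lborel)"
    by (subst integral_distr) (auto simp: add.commute)
  finally have upper: "integral (H ` E) g \<le> (\<integral>x. indicator U x * f (x + t *\<^sub>R z) \<partial>lborel)" .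
  have ft_int: "integrable lborel (\<lambda>x. f (x + t *\<^sub>R z))"
  proof -
    have "integrable (distr lborel borel ((+) (t *\<^sub>R z))) f" using f_int by (simp add: lborel_distr_plus)
    then show ?thesis by (subst (asm) integrable_distr_eq) (auto simp: add.commute)
  qed
  have "(\<integral>x. indicator U x * f (x + t *\<^sub>R z) \<partial>lborel) = (\<integral>x. indicator E x * f (x + t *\<^sub>R z) \<partial>lborel)"
  proof (rule integral_cong_AE)
    note [measurable] = E
    show "(\<lambda>x. indicator E x * f (x + t *\<^sub>R z)) \<in> borel_measurable lborel" by measurable
    show "AE x in lborel. indicator U x * f (x + t *\<^sub>R z) = indicator E x * f (x + t *\<^sub>R z)"
      using X(2) by eventually_elim (simp add: E_def indicator_def)
  qed measurable
  then have I3: "((\<lambda>x. f (x + t *\<^sub>R z)) has_integral (\<integral>x. indicator U x * f (x + t *\<^sub>R z) \<partial>lborel)) E"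
    using has_integral_indicator_lborel[OF ft_int E] by simp
  \<comment> \<open>The Monge-Ampere equation at \<open>x\<close> and at \<open>x + z\<close> turns
    log-concavity of the determinant into a bound by densities, to which \<open>dens\<close>
    applies.\<close>
  have lower: "K * f (x + t *\<^sub>R z) \<le> \<bar>det (matrix (D x))\<bar> * g (H x)" if x: "x \<in> E" for x
  proof -
    have gx: "good x" "good (x + z)" and xU: "x \<in> U" using x Xg by (auto simp: E_def)
    note h1 = good_hess[OF gx(1)] and h2 = good_hess[OF gx(2)]
    have d1: "\<bar>det (matrix (hess x))\<bar> = f x / g (T x)" and d2: "\<bar>det (matrix (hess (x + z)))\<bar> = f (x + z) / g (T (x + z))"
      using Xg(3,4)[of x] x g_pos[of "T x"] g_pos[of "T (x + z)"] by (auto simp: E_def field_simps)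
    have lin: "linear (hess x)" "linear (hess (x + z))"
      and sym: "\<And>u v. hess x u \<bullet> v = u \<bullet> hess x v" "\<And>u v. hess (x + z) u \<bullet> v = u \<bullet> hess (x + z) v"
      using h1 h2 by (auto simp: second_derivative_at_def)
    have nz: "det (matrix (hess x)) \<noteq> 0" "det (matrix (hess (x + z))) \<noteq> 0"
      using d1 d2 f_pos[of x] g_pos[of "T x"] f_pos[of "x + z"] g_pos[of "T (x + z)"] by auto
    note dlc = det_log_concave[OF lin(1) sym(1) second_derivative_at_nonneg[OF convex_phi h1] nz(1)
        lin(2) sym(2) second_derivative_at_nonneg[OF convex_phi h2] nz(2) t]
    have "(f x / g (T x)) powr (1 - t) * (f (x + z) / g (T (x + z))) powr t
      \<le> det (matrix (\<lambda>v. (1 - t) *\<^sub>R hess x v + t *\<^sub>R hess (x + z) v))"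
      using dlc d1 d2 by simp
    then have "(1 - \<epsilon>) ^ CARD('k) * ((f x / g (T x)) powr (1 - t) * (f (x + z) / g (T (x + z))) powr t)
      \<le> (1 - \<epsilon>) ^ CARD('k) * det (matrix (\<lambda>v. (1 - t) *\<^sub>R hess x v + t *\<^sub>R hess (x + z) v))"
      using \<epsilon> by (intro mult_left_mono) auto
    also have "\<dots> = det (matrix (D x))"
      unfolding D_def by (rule det_scaleR_linear[symmetric]) (intro linear_compose_add linear_compose_scale_right lin)
    also have "\<dots> \<le> \<bar>det (matrix (D x))\<bar>" by simp
    finally have "(1 - \<epsilon>) ^ CARD('k) * ((f x / g (T x)) powr (1 - t) * (f (x + z) / g (T (x + z))) powr t) * g (H x) \<le> \<bar>det (matrix (D x))\<bar> * g (H x)"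
      using g_pos[of "H x"] by (intro mult_right_mono) auto
    then show ?thesis using dens[OF xU gx] unfolding H_def by linarith
  qed
  have "K * (\<integral>x. indicator U x * f (x + t *\<^sub>R z) \<partial>lborel) \<le> integral (H ` E) g"
    by (rule has_integral_le[OF has_integral_mult_right[OF I3] cov(1)]) (use lower in auto)
  with upper have le: "K * (\<integral>x. indicator U x * f (x + t *\<^sub>R z) \<partial>lborel) \<le> (\<integral>x. indicator U x * f (x + t *\<^sub>R z) \<partial>lborel)"
    by simp
  \<comment> \<open>As \<open>K > 1\<close>, the two mass inequalities are contradictory once the
    mass is positive, which it is for a nonempty open set.\<close>
  have "0 < (\<integral>x. indicator U x * f (x + t *\<^sub>R z) \<partial>lborel)"
  proof -
    have int: "integrable lborel (\<lambda>x. indicator U x * f (x + t *\<^sub>R z))"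
      using integrable_mult_indicator[of U lborel "\<lambda>x. f (x + t *\<^sub>R z)"] ft_int oU by simp
    have nn: "0 \<le> indicator U x * f (x + t *\<^sub>R z)" for x using f_pos[of "x + t *\<^sub>R z"] by (simp add: indicator_def)
    have "(\<integral>x. indicator U x * f (x + t *\<^sub>R z) \<partial>lborel) \<noteq> 0"
    proof
      assume "(\<integral>x. indicator U x * f (x + t *\<^sub>R z) \<partial>lborel) = 0"
      then have "AE x in lborel. indicator U x * f (x + t *\<^sub>R z) = 0"
        using integral_nonneg_eq_0_iff_AE[OF int] nn by simp
      then have "AE x in lborel. x \<notin> U"
      proof eventually_elim
        case (elim x)
        then show ?case using f_pos[of "x + t *\<^sub>R z"] by (auto simp: indicator_def)
      qed
      then have "U \<in> null_sets lborel" using oU by (subst AE_iff_null_sets) auto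
      then have "negligible U" by (simp add: negligible_iff_null_sets null_sets_completionI)
      then show False using open_not_negligible[OF oU ne] by simp
    qed
    moreover have "0 \<le> (\<integral>x. indicator U x * f (x + t *\<^sub>R z) \<partial>lborel)" by (intro integral_nonneg_AE) (use nn in auto)
    ultimately show ?thesis by simp
  qed
  then show False using le K by simp
qed

end

section \<open>Lipschitz perturbations of the Gaussian weight\<close>

lemma nn_integral_exp_neg_square_finite:
  assumes c: "0 < c"
  shows "(\<integral>\<^sup>+s. ennreal (exp (- c * s\<^sup>2)) \<partial>(lborel :: real measure)) < \<infinity>"
proof -
  \<comment> \<open>The number \<open>1 / (4 * c)\<close> is the maximum of
    \<open>\<bar>s\<bar> - c * s\<^sup>2\<close>, so the Gaussian lies below
    \<open>K * exp (- \<bar>s\<bar>)\<close>.\<close>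
  define K where "K = exp (1 / (4 * c))"
  have half: "(\<integral>\<^sup>+s. ennreal (K * exp (- s)) * indicator {0..} s \<partial>lborel) < \<infinity>"
  proof -
    have "(\<integral>\<^sup>+s. ennreal (K * exp (- s)) * indicator {0..} s \<partial>lborel) = ennreal (0 - (- K * exp (- 0)))"
    proof (rule nn_integral_FTC_atLeast)
      show "((\<lambda>s. - K * exp (- s)) \<longlongrightarrow> 0) at_top"
        by (rule tendsto_eq_rhs, rule tendsto_mult[OF tendsto_const],
            rule filterlim_compose[OF exp_at_bot filterlim_uminus_at_bot_at_top]) simp
    qed (auto intro!: derivative_eq_intros simp: K_def)
    then show ?thesis by simp
  qed
  have bound: "exp (- c * s\<^sup>2) \<le> K * exp (- \<bar>s\<bar>)" for s :: real
  proof -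
    have "0 \<le> c * (\<bar>s\<bar> - 1 / (2 * c))\<^sup>2" using c by simp
    also have "\<dots> = c * s\<^sup>2 - \<bar>s\<bar> + 1 / (4 * c)" using c by (simp add: power2_diff field_simps power2_eq_square)
    finally show ?thesis unfolding K_def exp_add[symmetric] by simp
  qed
  have refl: "(\<integral>\<^sup>+s. ennreal (K * exp s) * indicator {..0} s \<partial>lborel) = (\<integral>\<^sup>+s. ennreal (K * exp (- s)) * indicator {0..} s \<partial>lborel)"
    by (subst nn_integral_real_affine[where c="-1" and t=0]) (auto intro!: nn_integral_cong simp: indicator_def)
  have "(\<integral>\<^sup>+s. ennreal (exp (- c * s\<^sup>2)) \<partial>lborel)
     \<le> (\<integral>\<^sup>+s. ennreal (K * exp (- s)) * indicator {0..} s + ennreal (K * exp s) * indicator {..0} s \<partial>lborel)"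
  proof (rule nn_integral_mono)
    fix s :: real
    show "ennreal (exp (- c * s\<^sup>2)) \<le> ennreal (K * exp (- s)) * indicator {0..} s + ennreal (K * exp s) * indicator {..0} s"
    proof (cases "0 \<le> s")
      case True
      then have "ennreal (exp (- c * s\<^sup>2)) \<le> ennreal (K * exp (- s)) * indicator {0..} s"
        using bound[of s] by (simp add: ennreal_leI)
      then show ?thesis by (rule add_increasing2[OF zero_le])
    next
      case False
      then have "ennreal (exp (- c * s\<^sup>2)) \<le> ennreal (K * exp s) * indicator {..0} s"
        using bound[of s] by (simp add: ennreal_leI)
      then show ?thesis by (rule add_increasing[OF zero_le])
    qed
  qed
  also have "\<dots> = (\<integral>\<^sup>+s. ennreal (K * exp (- s)) * indicator {0..} s \<partial>lborel) + (\<integral>\<^sup>+s. ennreal (K * exp s) * indicator {..0} s \<partial>lborel)"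
    by (rule nn_integral_add) auto
  also have "\<dots> < \<infinity>" using half refl by simp
  finally show ?thesis .
qed

lemma integrable_exp_neg_norm_square:
  assumes c: "0 < c"
  shows "integrable lborel (\<lambda>x::'a::euclidean_space. exp (- c * (norm x)\<^sup>2))"
proof (rule integrableI_bounded)
  have "(\<integral>\<^sup>+x. ennreal (norm (exp (- c * (norm x)\<^sup>2))) \<partial>(lborel :: 'a measure))
      = (\<integral>\<^sup>+x. (\<Prod>b\<in>Basis. ennreal (exp (- c * (x \<bullet> b)\<^sup>2))) \<partial>(lborel :: 'a measure))"
  proof (rule nn_integral_cong)
    fix x :: 'a
    have "(norm x)\<^sup>2 = (\<Sum>b\<in>Basis. (x \<bullet> b)\<^sup>2)"
      unfolding power2_norm_eq_inner by (subst euclidean_inner) (simp add: power2_eq_square)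
    then have "exp (- c * (norm x)\<^sup>2) = (\<Prod>b\<in>Basis. exp (- c * (x \<bullet> b)\<^sup>2))"
      by (simp add: exp_sum[symmetric] sum_distrib_left sum_negf[symmetric])
    moreover have "norm (exp (- c * (norm x)\<^sup>2)) = exp (- c * (norm x)\<^sup>2)" by simp
    ultimately show "ennreal (norm (exp (- c * (norm x)\<^sup>2))) = (\<Prod>b\<in>Basis. ennreal (exp (- c * (x \<bullet> b)\<^sup>2)))"
      by (simp only: prod_ennreal[OF exp_ge_zero])
  qed
  also have "\<dots> = (\<Prod>b\<in>(Basis :: 'a set). (\<integral>\<^sup>+s. ennreal (exp (- c * s\<^sup>2)) \<partial>lborel))"
    by (rule nn_integral_lborel_prod) auto
  also have "\<dots> < \<infinity>"
    using nn_integral_exp_neg_square_finite[OF c] by (simp add: power_less_top_ennreal)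
  finally show "(\<integral>\<^sup>+x. ennreal (norm (exp (- c * (norm x)\<^sup>2))) \<partial>(lborel :: 'a measure)) < \<infinity>" .
qed simp

text \<open>The inequality L |x| \<le> |x|^2/8 + 2 L^2 trades the Lipschitz part for an eighth in
  the exponent; the remaining 3/8 leaves room for factors up to exp (|x|^2/8).\<close>

lemma gauss_weight_bound:
  fixes a :: "'a::euclidean_space \<Rightarrow> real"
  assumes "L-lipschitz_on UNIV a"
  shows "exp (- a x - (norm x)\<^sup>2 / 2) \<le> exp (2 * L\<^sup>2 - a 0) * exp (- (3/8) * (norm x)\<^sup>2)"
proof -
  have "\<bar>a x - a 0\<bar> \<le> L * norm x" using lipschitz_onD[OF assms, of x 0] by (simp add: dist_norm)
  moreover have "0 \<le> (norm x / 2 - 2 * L)\<^sup>2" by simp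
  then have "L * norm x \<le> (norm x)\<^sup>2 / 8 + 2 * L\<^sup>2" by (simp add: power2_eq_square algebra_simps)
  ultimately show ?thesis unfolding exp_add[symmetric] by (simp add: abs_le_iff)
qed

lemma integrable_gauss_weight:
  fixes a :: "'a::euclidean_space \<Rightarrow> real"
  assumes lip: "L-lipschitz_on UNIV a" and h: "h \<in> borel_measurable borel" and hb: "\<And>x. \<bar>h x\<bar> \<le> exp ((norm x)\<^sup>2 / 8)"
  shows "integrable lborel (\<lambda>x. h x * exp (- a x - (norm x)\<^sup>2 / 2))"
proof (rule Bochner_Integration.integrable_bound)
  note [measurable] = h
  have [measurable]: "a \<in> borel_measurable borel"
    by (rule borel_measurable_continuous_onI[OF lipschitz_on_continuous_on[OF lip]])
  show "integrable lborel (\<lambda>x::'a. exp (2 * L\<^sup>2 - a 0) * exp (- (1/4) * (norm x)\<^sup>2))"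
    by (intro integrable_mult_right integrable_exp_neg_norm_square) simp
  show "AE x in lborel. norm (h x * exp (- a x - (norm x)\<^sup>2 / 2)) \<le> norm (exp (2 * L\<^sup>2 - a 0) * exp (- (1/4) * (norm x)\<^sup>2))"
  proof (rule AE_I2)
    fix x
    have "norm (h x * exp (- a x - (norm x)\<^sup>2 / 2)) \<le> exp ((norm x)\<^sup>2 / 8) * (exp (2 * L\<^sup>2 - a 0) * exp (- (3/8) * (norm x)\<^sup>2))"
      unfolding norm_mult using hb[of x] gauss_weight_bound[OF lip, of x] by (intro mult_mono) auto
    also have "\<dots> = exp (2 * L\<^sup>2 - a 0) * exp (- (1/4) * (norm x)\<^sup>2)"
      unfolding exp_add[symmetric] by (simp add: field_simps)
    finally show "norm (h x * exp (- a x - (norm x)\<^sup>2 / 2)) \<le> norm (exp (2 * L\<^sup>2 - a 0) * exp (- (1/4) * (norm x)\<^sup>2))"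
      by simp
  qed
  show "(\<lambda>x. h x * exp (- a x - (norm x)\<^sup>2 / 2)) \<in> borel_measurable lborel" by measurable
qed

text \<open>One constant \<open>L\<close> for both weights keeps the locale symmetric under duality.
  Normalising factors are absorbed into \<open>a\<close> and \<open>b\<close> as additive constants,
  which do not change \<open>L\<close>.\<close>

locale gauss_transport = transport \<phi> \<psi> "\<lambda>x. exp (- a x - (norm x)\<^sup>2 / 2)" "\<lambda>y. exp (- b y - (norm y)\<^sup>2 / 2)" T S
  for \<phi> \<psi> :: "'a::euclidean_space \<Rightarrow> real" and a b :: "'a \<Rightarrow> real" and T S :: "'a \<Rightarrow> 'a" +
  fixes L :: real
  assumes lip_a: "L-lipschitz_on UNIV a" and lip_b: "L-lipschitz_on UNIV b"
begin

lemma dual_gauss: "gauss_transport \<psi> \<phi> b a S T L"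
  using dual lip_a lip_b by (simp add: gauss_transport_def gauss_transport_axioms_def)

lemma L_nonneg: "0 \<le> L" by (rule lipschitz_on_nonneg[OF lip_a])

text \<open>By monotonicity a large slope \<open>p\<close> at \<open>x\<close> forces \<open>T\<close> to be large on a ball close to \<open>x\<close>;
  such a ball has too much mass for the Gaussian tail of the target.\<close>
lemma linear_growth: "\<exists>C>0. \<forall>x p. subgrad \<phi> x p \<longrightarrow> norm p \<le> C * (1 + norm x)"
proof -
  let ?f = "\<lambda>x. exp (- a x - (norm x)\<^sup>2 / 2)" and ?g = "\<lambda>y. exp (- b y - (norm y)\<^sup>2 / 2)"
  define M where "M = (\<integral>y. exp ((norm y)\<^sup>2 / 8) * ?g y \<partial>lborel)"
  have intM: "integrable lborel (\<lambda>y. exp ((norm y)\<^sup>2 / 8) * ?g y)"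
    by (rule integrable_gauss_weight[OF lip_b]) auto
  define m where "m = measure lborel (ball (0::'a) (1/2))"
  have m: "m > 0" unfolding m_def using content_ball_pos by simp
  have key: "m * exp (- a 0 - 3 * L * \<rho> - 9 * \<rho>\<^sup>2 / 2) \<le> exp (- (norm p)\<^sup>2 / 72) * M"
    if p: "subgrad \<phi> x p" and "p \<noteq> 0" and rho: "\<rho> = 1 + norm x" for x p \<rho>
  proof -
    define u where "u = (1 / norm p) *\<^sub>R p"
    have nu: "norm u = 1" "p = norm p *\<^sub>R u" using \<open>p \<noteq> 0\<close> by (auto simp: u_def)
    \<comment> \<open>The centre lies at distance \<open>\<rho>\<close> from \<open>x\<close> in the
      direction of \<open>p\<close>. As \<open>\<rho> \<ge> 1\<close>, each point of the ball is
      within \<open>3/2 * \<rho>\<close> of \<open>x\<close> and has component at least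
      \<open>\<rho> / 2\<close> along \<open>u\<close>; monotonicity then leaves a third of
      \<open>norm p\<close> for the norm of \<open>T\<close>.\<close>
    define B where "B = ball (x + \<rho> *\<^sub>R u) (1/2)"
    have \<rho>: "\<rho> \<ge> 1" using rho by simp
    have dist: "norm (w - x) \<le> 3/2 * \<rho>" "\<rho> / 2 \<le> u \<bullet> (w - x)" "norm w \<le> 3 * \<rho>" if w: "w \<in> B" for w
    proof -
      define e where "e = w - x - \<rho> *\<^sub>R u"
      have e: "norm e \<le> 1/2" using w by (simp add: B_def e_def dist_norm norm_minus_commute algebra_simps)
      have we: "w - x = \<rho> *\<^sub>R u + e" by (simp add: e_def)
      have "norm (w - x) \<le> \<rho> + 1/2" unfolding we using norm_triangle_ineq[of "\<rho> *\<^sub>R u" e] e nu \<rho> by simp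
      then show 1: "norm (w - x) \<le> 3/2 * \<rho>" using \<rho> by simp
      have "\<bar>u \<bullet> e\<bar> \<le> 1/2" using Cauchy_Schwarz_ineq2[of u e] e nu by simp
      moreover have "u \<bullet> (w - x) = \<rho> + u \<bullet> e" unfolding we using nu by (simp add: inner_simps norm_eq_1)
      ultimately show "\<rho> / 2 \<le> u \<bullet> (w - x)" using \<rho> by simp
      have "norm w \<le> norm x + norm (w - x)" using norm_triangle_ineq[of x "w - x"] by simp
      then show "norm w \<le> 3 * \<rho>" using 1 rho \<rho> by linarith
    qed
    have fB: "exp (- a 0 - 3 * L * \<rho> - 9 * \<rho>\<^sup>2 / 2) \<le> ?f w" if w: "w \<in> B" for w
    proof -
      have "a w \<le> a 0 + L * norm w" using lipschitz_onD[OF lip_a, of w 0] by (simp add: dist_norm abs_le_iff)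
      also have "L * norm w \<le> L * (3 * \<rho>)" by (intro mult_left_mono dist(3)[OF w] L_nonneg)
      finally have 1: "a w \<le> a 0 + 3 * L * \<rho>" by simp
      have "(norm w)\<^sup>2 \<le> (3 * \<rho>)\<^sup>2" by (intro power_mono dist(3)[OF w]) simp
      then have "(norm w)\<^sup>2 / 2 \<le> 9 * \<rho>\<^sup>2 / 2" by (simp add: power_mult_distrib)
      with 1 show ?thesis by simp
    qed
    have Tbig: "norm p / 3 \<le> norm (T w)" if w: "w \<in> B" and Tw: "subgrad \<phi> w (T w)" for w
    proof -
      have "0 \<le> (T w - p) \<bullet> (w - x)" by (rule subgrad_monotone[OF Tw p])
      then have "p \<bullet> (w - x) \<le> T w \<bullet> (w - x)" by (simp add: inner_simps)
      also have "\<dots> \<le> norm (T w) * norm (w - x)" by (rule norm_cauchy_schwarz)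
      also have "\<dots> \<le> norm (T w) * (3/2 * \<rho>)" by (intro mult_left_mono dist(1)[OF w]) auto
      finally have "p \<bullet> (w - x) \<le> norm (T w) * (3/2 * \<rho>)" .
      moreover have "p \<bullet> (w - x) = norm p * (u \<bullet> (w - x))" by (subst nu(2)) (simp only: inner_scaleR_left)
      moreover have "norm p * (\<rho> / 2) \<le> norm p * (u \<bullet> (w - x))" by (intro mult_left_mono dist(2)[OF w]) auto
      ultimately have "\<rho> * (norm p / 2) \<le> \<rho> * (norm (T w) * (3/2))" by (simp add: mult.commute mult.left_commute)
      then show ?thesis using \<rho> by simp
    qed
    have mB: "measure lborel B = m" unfolding B_def m_def by (simp add: content_ball)
    have eB: "emeasure lborel B < \<infinity>" unfolding B_def by (rule emeasure_bounded_finite) simp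
    have "m * exp (- a 0 - 3 * L * \<rho> - 9 * \<rho>\<^sup>2 / 2) = (\<integral>w. indicator B w * exp (- a 0 - 3 * L * \<rho> - 9 * \<rho>\<^sup>2 / 2) \<partial>lborel)"
      by (simp add: mB)
    also have "\<dots> \<le> (\<integral>w. indicator {y. norm p / 3 \<le> norm y} (T w) * ?f w \<partial>lborel)"
    proof (rule integral_mono_AE)
      show "integrable lborel (\<lambda>w. indicator B w * exp (- a 0 - 3 * L * \<rho> - 9 * \<rho>\<^sup>2 / 2))"
        using eB by (intro integrable_mult_left integrable_real_indicator) (auto simp: B_def)
      show "integrable lborel (\<lambda>w. indicator {y. norm p / 3 \<le> norm y} (T w) * ?f w)"
        by (rule integrable_gauss_weight[OF lip_a]) (auto simp: indicator_def)
      show "AE w in lborel. indicator B w * exp (- a 0 - 3 * L * \<rho> - 9 * \<rho>\<^sup>2 / 2) \<le> indicator {y. norm p / 3 \<le> norm y} (T w) * ?f w"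
        using AE_T by eventually_elim (use Tbig fB in \<open>auto simp: indicator_def\<close>)
    qed
    also have "\<dots> = (\<integral>y. indicator {y. norm p / 3 \<le> norm y} y * ?g y \<partial>lborel)"
    proof -
      interpret d: transport \<psi> \<phi> ?g ?f S T by (rule dual)
      show ?thesis by (rule d.integral_push_S) measurable
    qed
    \<comment> \<open>Chebyshev's inequality with weight \<open>exp ((norm y)\<^sup>2 / 8)\<close>
      at radius \<open>norm p / 3\<close>; this is the origin of 72.\<close>
    also have "\<dots> \<le> (\<integral>y. exp (- (norm p)\<^sup>2 / 72) * (exp ((norm y)\<^sup>2 / 8) * ?g y) \<partial>lborel)"
    proof (rule integral_mono)
      show "integrable lborel (\<lambda>y. indicator {y. norm p / 3 \<le> norm y} y * ?g y)"
        by (rule integrable_gauss_weight[OF lip_b]) (auto simp: indicator_def)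
      show "integrable lborel (\<lambda>y. exp (- (norm p)\<^sup>2 / 72) * (exp ((norm y)\<^sup>2 / 8) * ?g y))"
        by (intro integrable_mult_right intM)
      fix y
      show "indicator {y. norm p / 3 \<le> norm y} y * ?g y \<le> exp (- (norm p)\<^sup>2 / 72) * (exp ((norm y)\<^sup>2 / 8) * ?g y)"
      proof (cases "norm p / 3 \<le> norm y")
        case True
        then have "(norm p / 3)\<^sup>2 \<le> (norm y)\<^sup>2" by (intro power_mono) auto
        then have "1 \<le> exp (- (norm p)\<^sup>2 / 72) * exp ((norm y)\<^sup>2 / 8)"
          unfolding exp_add[symmetric] by (simp add: power_divide)
        from mult_right_mono[OF this, of "?g y"] show ?thesis using True by (simp add: mult.assoc)
      qed simp
    qed
    also have "\<dots> = exp (- (norm p)\<^sup>2 / 72) * M" unfolding M_def by (rule integral_mult_right_zero)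
    finally show ?thesis .
  qed
  \<comment> \<open>Taking logarithms in \<open>key\<close> bounds
    \<open>(norm p)\<^sup>2 / 72\<close> by a quadratic in \<open>\<rho>\<close>, whose coefficients
    are collected in \<open>K\<close> by means of \<open>\<rho> \<ge> 1\<close>.\<close>
  define K where "K = \<bar>ln M - ln m + a 0\<bar> + 3 * L + 9 / 2"
  have K: "K > 0" using L_nonneg by (simp add: K_def)
  have "norm p \<le> sqrt (72 * K) * (1 + norm x)" if p: "subgrad \<phi> x p" for x p
  proof (cases "p = 0")
    case True then show ?thesis using K by simp
  next
    case False
    define \<rho> where "\<rho> = 1 + norm x"
    have \<rho>: "\<rho> \<ge> 1" by (simp add: \<rho>_def)
    note k = key[OF p False \<rho>_def]
    have "0 < m * exp (- a 0 - 3 * L * \<rho> - 9 * \<rho>\<^sup>2 / 2)" using m by simp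
    with k have M: "M > 0" by (smt (verit) exp_gt_zero zero_less_mult_pos)
    have "ln (m * exp (- a 0 - 3 * L * \<rho> - 9 * \<rho>\<^sup>2 / 2)) \<le> ln (exp (- (norm p)\<^sup>2 / 72) * M)"
      using k m M by (subst ln_le_cancel_iff) auto
    then have "(norm p)\<^sup>2 / 72 \<le> (ln M - ln m + a 0) + 3 * L * \<rho> + 9 * \<rho>\<^sup>2 / 2"
      using m M by (simp add: ln_mult)
    also have "\<dots> \<le> \<bar>ln M - ln m + a 0\<bar> * \<rho>\<^sup>2 + 3 * L * \<rho>\<^sup>2 + 9 / 2 * \<rho>\<^sup>2"
    proof -
      have r2: "1 \<le> \<rho>\<^sup>2" "\<rho> \<le> \<rho>\<^sup>2" using \<rho> one_le_power[of \<rho> 2] by (auto simp: power2_eq_square)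
      have "ln M - ln m + a 0 \<le> \<bar>ln M - ln m + a 0\<bar> * 1" by simp
      also have "\<dots> \<le> \<bar>ln M - ln m + a 0\<bar> * \<rho>\<^sup>2" by (intro mult_left_mono r2) auto
      finally have "ln M - ln m + a 0 \<le> \<bar>ln M - ln m + a 0\<bar> * \<rho>\<^sup>2" .
      moreover have "3 * L * \<rho> \<le> 3 * L * \<rho>\<^sup>2" using L_nonneg by (intro mult_left_mono r2) auto
      ultimately show ?thesis by simp
    qed
    also have "\<dots> = K * \<rho>\<^sup>2" by (simp add: K_def algebra_simps)
    finally have "(norm p)\<^sup>2 \<le> (72 * K) * \<rho>\<^sup>2" by simp
    then have "sqrt ((norm p)\<^sup>2) \<le> sqrt ((72 * K) * \<rho>\<^sup>2)" by (rule real_sqrt_le_mono)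
    then show ?thesis using \<rho> by (simp add: real_sqrt_mult \<rho>_def)
  qed
  then show ?thesis using K by (intro exI[of _ "sqrt (72 * K)"]) auto
qed

text \<open>Linear growth of the subgradients of \<psi> means that slopes of \<phi> grow at least
  linearly. Concretely, take a point \<open>q\<close> where \<phi> has slope
  \<open>l *\<^sub>R x\<close> and evaluate the supporting inequality from \<open>q\<close> at
  \<open>x\<close>.\<close>

lemma quadratic_growth: "\<exists>c>0. \<exists>C. \<forall>x. c * (norm x)\<^sup>2 - C \<le> \<phi> x"
proof -
  interpret d: gauss_transport \<psi> \<phi> b a S T L by (rule dual_gauss)
  obtain C where C: "C > 0" "\<And>y q. subgrad \<psi> y q \<Longrightarrow> norm q \<le> C * (1 + norm y)" using d.linear_growth by blast
  obtain p where p: "subgrad \<phi> 0 p" using subgrad_exists[OF convex_phi] .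
  \<comment> \<open>With this \<open>l\<close> the norm of \<open>q\<close> is at most
    \<open>C + norm x / 2\<close>, so up to a linear term \<open>l * (x \<bullet> q)\<close>
    consumes only half of \<open>l * (norm x)\<^sup>2\<close>.\<close>
  define l where "l = 1 / (2 * C)"
  have l: "l > 0" "C * l = 1/2" using C by (auto simp: l_def)
  define k where "k = \<bar>\<phi> 0\<bar> + norm p * C"
  define j where "j = norm p / 2 + 1/2"
  have low: "l / 2 * (norm x)\<^sup>2 - j * norm x - k \<le> \<phi> x" for x
  proof -
    obtain q where q: "subgrad \<psi> (l *\<^sub>R x) q" using subgrad_exists[OF convex_psi] .
    have "norm q \<le> C * (1 + l * norm x)" using C(2)[OF q] l by simp
    also have "\<dots> = C + (C * l) * norm x" by (simp add: algebra_simps)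
    finally have nq: "norm q \<le> C + norm x / 2" using l by simp
    have "subgrad \<phi> q (l *\<^sub>R x)" using q by (simp add: conj)
    then have 1: "\<phi> q + (l *\<^sub>R x) \<bullet> (x - q) \<le> \<phi> x" by (rule subgradD)
    have "x \<bullet> q \<le> norm x * norm q" by (rule norm_cauchy_schwarz)
    also have "\<dots> \<le> norm x * (C + norm x / 2)" by (intro mult_left_mono nq) auto
    finally have "l * (x \<bullet> q) \<le> l * (norm x * (C + norm x / 2))" using l by (intro mult_left_mono) auto
    also have "\<dots> = (C * l) * norm x + l / 2 * (norm x)\<^sup>2" by (simp add: algebra_simps power2_eq_square)
    finally have 2: "l * (x \<bullet> q) \<le> norm x / 2 + l / 2 * (norm x)\<^sup>2" using l by simp
    have "\<phi> 0 + p \<bullet> q \<le> \<phi> q" using subgradD[OF p, of q] by simp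
    moreover have "\<bar>p \<bullet> q\<bar> \<le> norm p * (C + norm x / 2)"
      by (rule order_trans[OF Cauchy_Schwarz_ineq2]) (intro mult_left_mono nq norm_ge_zero)
    ultimately have 3: "- k - norm p / 2 * norm x \<le> \<phi> q" using abs_ge_minus_self[of "\<phi> 0"] abs_ge_minus_self[of "p \<bullet> q"]
      by (simp only: k_def distrib_left)
    have "(l *\<^sub>R x) \<bullet> (x - q) = l * (norm x)\<^sup>2 - l * (x \<bullet> q)" by (simp add: inner_simps power2_norm_eq_inner algebra_simps)
    then have "\<phi> q + (l * (norm x)\<^sup>2 - l * (x \<bullet> q)) \<le> \<phi> x" using 1 by (simp only:)
    moreover have "j * norm x = norm p / 2 * norm x + norm x / 2" by (simp add: j_def algebra_simps)
    moreover have "l / 2 * (norm x)\<^sup>2 + l / 2 * (norm x)\<^sup>2 = l * (norm x)\<^sup>2" by simp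
    ultimately show ?thesis using 2 3 by linarith
  qed
  have "l / 4 * (norm x)\<^sup>2 - (k + j\<^sup>2 / l) \<le> \<phi> x" for x
  proof -
    have "0 \<le> l * (norm x / 2 - j / l)\<^sup>2" using l by simp
    also have "\<dots> = l / 4 * (norm x)\<^sup>2 - j * norm x + j\<^sup>2 / l" using l by (simp add: power2_diff field_simps power2_eq_square)
    finally show ?thesis using low[of x] by simp
  qed
  then show ?thesis using l by (intro exI[of _ "l / 4"]) auto
qed

end

section \<open>The gap estimate\<close>

lemma norm_square_convex_combination:
  fixes p q :: "'a::real_inner"
  shows "(1 - t) * (norm p)\<^sup>2 + t * (norm q)\<^sup>2 - (norm ((1 - t) *\<^sub>R p + t *\<^sub>R q))\<^sup>2 = t * (1 - t) * (norm (q - p))\<^sup>2"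
  unfolding power2_norm_eq_inner by (simp add: inner_simps inner_commute algebra_simps power2_eq_square)

lemma lipschitz_convex_combination:
  fixes b :: "'a::real_normed_vector \<Rightarrow> real"
  assumes lip: "L-lipschitz_on UNIV b" and t: "0 \<le> t" "t \<le> 1"
  shows "\<bar>(1 - t) * b p + t * b q - b ((1 - t) *\<^sub>R p + t *\<^sub>R q)\<bar> \<le> t * (1 - t) * (2 * L * norm (q - p))"
proof -
  let ?m = "(1 - t) *\<^sub>R p + t *\<^sub>R q"
  have "p - ?m = t *\<^sub>R (p - q)" by (simp add: algebra_simps)
  then have n1: "norm (p - ?m) = t * norm (q - p)" using t by (simp add: norm_minus_commute)
  have "q - ?m = (1 - t) *\<^sub>R (q - p)" by (simp add: algebra_simps)
  then have n2: "norm (q - ?m) = (1 - t) * norm (q - p)" using t by simp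
  have l1: "\<bar>b p - b ?m\<bar> \<le> L * (t * norm (q - p))"
    using lipschitz_onD[OF lip, of p ?m] unfolding dist_norm n1 by simp
  have l2: "\<bar>b q - b ?m\<bar> \<le> L * ((1 - t) * norm (q - p))"
    using lipschitz_onD[OF lip, of q ?m] unfolding dist_norm n2 by simp
  have "(1 - t) * b p + t * b q - b ?m = (1 - t) * (b p - b ?m) + t * (b q - b ?m)" by (simp add: algebra_simps)
  also have "\<bar>\<dots>\<bar> \<le> (1 - t) * \<bar>b p - b ?m\<bar> + t * \<bar>b q - b ?m\<bar>"
    using abs_triangle_ineq[of "(1 - t) * (b p - b ?m)" "t * (b q - b ?m)"] t by (simp add: abs_mult)
  also have "\<dots> \<le> (1 - t) * (L * (t * norm (q - p))) + t * (L * ((1 - t) * norm (q - p)))"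
    using t by (intro add_mono mult_left_mono l1 l2) auto
  also have "\<dots> = t * (1 - t) * (2 * L * norm (q - p))" by (simp add: algebra_simps)
  finally show ?thesis .
qed

text \<open>The quadratic part has an exact convexity defect, and the Lipschitz part perturbs it by
  at most \<open>2 * L * norm (q - p)\<close> in units of \<open>t * (1 - t)\<close>. It serves as a
  lower bound for the target weight and an upper bound for the source weight, which adds up to 4
  L.\<close>

lemma gauss_potential_convex_combination:
  fixes a :: "'a::real_inner \<Rightarrow> real"
  assumes lip: "L-lipschitz_on UNIV a" and t: "0 \<le> t" "t \<le> 1"
  defines "V x \<equiv> a x + (norm x)\<^sup>2 / 2"
  shows "\<bar>(1 - t) * V p + t * V q - V ((1 - t) *\<^sub>R p + t *\<^sub>R q) - t * (1 - t) * ((norm (q - p))\<^sup>2 / 2)\<bar>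
    \<le> t * (1 - t) * (2 * L * norm (q - p))"
proof -
  let ?m = "(1 - t) *\<^sub>R p + t *\<^sub>R q"
  have "(1 - t) * V p + t * V q - V ?m = ((1 - t) * a p + t * a q - a ?m) +
      ((1 - t) * (norm p)\<^sup>2 + t * (norm q)\<^sup>2 - (norm ?m)\<^sup>2) / 2"
    unfolding V_def by (simp add: distrib_left diff_divide_distrib add_divide_distrib)
  then have "(1 - t) * V p + t * V q - V ?m - t * (1 - t) * ((norm (q - p))\<^sup>2 / 2) = (1 - t) * a p + t * a q - a ?m"
    unfolding norm_square_convex_combination by simp
  then show ?thesis using lipschitz_convex_combination[OF lip t, of p q] by (simp only:)
qed

context transport begin

text \<open>The inner segment, shorter by the factor \<open>l\<close>, is placed so that its
  division point at ratio \<open>t\<close> is still \<open>x + t *\<^sub>R z\<close>. The estimate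
  thus controls the growth of the gap from the inner segment to the whole one; \<open>l = 0\<close>
  bounds the gap itself.\<close>

lemma gap_le_subgrad:
  assumes t: "0 \<le> t" "t \<le> 1" and l: "l \<le> 1" and p: "subgrad \<phi> x p" and q: "subgrad \<phi> (x + z) q"
  shows "((1 - t) * \<phi> x + t * \<phi> (x + z))
    - ((1 - t) * \<phi> (x + (t * (1 - l)) *\<^sub>R z) + t * \<phi> (x + (t * (1 - l) + l) *\<^sub>R z)) \<le> t * (1 - t) * (1 - l) * ((q - p) \<bullet> z)"
proof -
  have 1: "\<phi> x + (t * (1 - l)) * (p \<bullet> z) \<le> \<phi> (x + (t * (1 - l)) *\<^sub>R z)"
    using subgradD[OF p, of "x + (t * (1 - l)) *\<^sub>R z"] by simp
  have "x + (t * (1 - l) + l) *\<^sub>R z - (x + z) = - ((1 - t) * (1 - l)) *\<^sub>R z" by (simp add: algebra_simps)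
  then have 2: "\<phi> (x + z) - ((1 - t) * (1 - l)) * (q \<bullet> z) \<le> \<phi> (x + (t * (1 - l) + l) *\<^sub>R z)"
    using subgradD[OF q, of "x + (t * (1 - l) + l) *\<^sub>R z"] by (simp only: inner_scaleR_right) simp
  have "(1 - t) * (\<phi> x + (t * (1 - l)) * (p \<bullet> z)) + t * (\<phi> (x + z) - ((1 - t) * (1 - l)) * (q \<bullet> z))
     \<le> (1 - t) * \<phi> (x + (t * (1 - l)) *\<^sub>R z) + t * \<phi> (x + (t * (1 - l) + l) *\<^sub>R z)"
    using t by (intro add_mono mult_left_mono 1 2) auto
  then show ?thesis by (simp add: inner_simps algebra_simps)
qed

end

locale gauss_transport_cart = gauss_transport \<phi> \<psi> a b T S L
  for \<phi> \<psi> a b :: "real^'k::{finite,wellorder} \<Rightarrow> real" and T S L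
begin

sublocale transport_cart \<phi> \<psi> "\<lambda>x. exp (- a x - (norm x)\<^sup>2 / 2)" "\<lambda>y. exp (- b y - (norm y)\<^sup>2 / 2)" T S ..

text \<open>The mass comparison is run on a set where the gap exceeds \<kappa>. There the expansion
  yields a gain in density that outweighs the loss caused by the factor
  \<open>1 - \<epsilon>\<close>.\<close>

lemma gap_le_of_expansion:
  fixes z :: "(real, 'k) vec"
  assumes t: "0 < t" "t < 1" and \<kappa>: "0 \<le> \<kappa>" and \<theta>: "0 < \<theta>"
    and big: "\<And>x. good x \<Longrightarrow> good (x + z) \<Longrightarrow> \<kappa> < (1 - t) * \<phi> x + t * \<phi> (x + z) - \<phi> (x + t *\<^sub>R z) \<Longrightarrow>
        norm z + 4 * L + \<theta> \<le> norm (T (x + z) - T x)"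
  shows "(1 - t) * \<phi> x + t * \<phi> (x + z) - \<phi> (x + t *\<^sub>R z) \<le> \<kappa>"
proof (rule ccontr)
  define F where "F x = (1 - t) * \<phi> x + t * \<phi> (x + z) - \<phi> (x + t *\<^sub>R z)" for x
  define A where "A x = (1 - t) * \<phi> x + t * \<phi> (x + z)" for x
  define n where "n = real CARD('k)"
  assume "\<not> (1 - t) * \<phi> x + t * \<phi> (x + z) - \<phi> (x + t *\<^sub>R z) \<le> \<kappa>"
  then have Fx: "\<kappa> < F x" by (simp add: F_def)
  obtain c C where c: "0 < c" "\<And>x. c * (norm x)\<^sup>2 - C \<le> \<phi> x" using quadratic_growth by blast
  obtain C1 where C1: "0 < C1" "\<And>x p. subgrad \<phi> x p \<Longrightarrow> norm p \<le> C1 * (1 + norm x)" using linear_growth by blast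
  define m where "m = - C"
  have m: "m \<le> \<phi> x" for x using c(2)[of x] c(1) by (simp add: m_def) (smt (verit) mult_nonneg_nonneg zero_le_power2)
  have mA: "m \<le> A x" for x
  proof -
    have "(1 - t) * m + t * m \<le> A x" unfolding A_def using t by (intro add_mono mult_left_mono m) auto
    then show ?thesis by (simp add: algebra_simps)
  qed
  \<comment> \<open>Half of this gain is reserved for the errors in \<epsilon>; the other half
    becomes the factor \<open>exp (\<tau> / 2)\<close> of the comparison.\<close>
  define \<tau> where "\<tau> = t * (1 - t) * (\<theta>\<^sup>2 / 2)"
  have \<tau>: "\<tau> > 0" using t \<theta> by (simp add: \<tau>_def)
  \<comment> \<open>The three bounds serve the estimate of \<open>ln (1 - \<epsilon>)\<close>, a
    loss of at most \<open>\<tau> / 2\<close> in the densities, and the membership of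
    \<open>x\<close> in \<open>U\<close>.\<close>
  define \<epsilon> where "\<epsilon> = min (1/2) (min (\<tau> / (2 * (2 * n + L\<^sup>2 / 2 + 1))) ((F x - \<kappa>) / (2 * (A x - m + 1))))"
  have n0: "0 \<le> n" by (simp add: n_def)
  have d1: "0 < 2 * n + L\<^sup>2 / 2 + 1" using n0 by (intro add_nonneg_pos add_nonneg_nonneg) auto
  have d2: "0 < A x - m + 1" using mA[of x] by simp
  have \<epsilon>: "0 < \<epsilon>" "\<epsilon> \<le> 1/2"
  proof -
    show "0 < \<epsilon>" using \<tau> d1 d2 Fx by (simp add: \<epsilon>_def)
    show "\<epsilon> \<le> 1/2" unfolding \<epsilon>_def by (rule min.cobounded1)
  qed
  have \<epsilon>\<tau>: "\<epsilon> * (2 * n + L\<^sup>2 / 2) \<le> \<tau> / 2"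
  proof -
    have "\<epsilon> * (2 * n + L\<^sup>2 / 2) \<le> \<epsilon> * (2 * n + L\<^sup>2 / 2 + 1)" using \<epsilon> by simp
    also have "\<dots> \<le> \<tau> / (2 * (2 * n + L\<^sup>2 / 2 + 1)) * (2 * n + L\<^sup>2 / 2 + 1)"
      using d1 by (intro mult_right_mono) (auto simp: \<epsilon>_def)
    also have "\<dots> = \<tau> / 2" using d1 by (simp add: field_simps)
    finally show ?thesis .
  qed
  have \<epsilon>F: "\<epsilon> * (A x - m) < F x - \<kappa>"
  proof -
    have "\<epsilon> * (A x - m) \<le> \<epsilon> * (A x - m + 1)" using \<epsilon> by simp
    also have "\<dots> \<le> (F x - \<kappa>) / (2 * (A x - m + 1)) * (A x - m + 1)"
      using d2 by (intro mult_right_mono) (auto simp: \<epsilon>_def)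
    also have "\<dots> = (F x - \<kappa>) / 2" using d2 by (simp add: field_simps)
    also have "\<dots> < F x - \<kappa>" using Fx by simp
    finally show ?thesis .
  qed
  \<comment> \<open>The shift by \<open>\<epsilon> * m\<close> makes membership equivalent to
    \<open>F w > \<kappa> + \<epsilon> * (A w - m)\<close>, where \<open>A w \<ge> m\<close>. So
    \<open>U\<close> lies in the superlevel set, and it is bounded because \<open>A\<close> grows
    quadratically and \<open>F\<close> at most linearly.\<close>
  define U where "U = {x. \<phi> (x + t *\<^sub>R z) + (\<kappa> - \<epsilon> * m) < (1 - \<epsilon>) * ((1 - t) * \<phi> x + t * \<phi> (x + z))}"
  have U_iff: "w \<in> U \<longleftrightarrow> \<kappa> + \<epsilon> * (A w - m) < F w" for w
    by (simp add: U_def F_def A_def algebra_simps)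
  have xU: "x \<in> U" using \<epsilon>F by (simp add: U_iff)
  have UF: "\<kappa> < F w" if "w \<in> U" for w
  proof -
    have "0 \<le> \<epsilon> * (A w - m)" using \<epsilon> mA[of w] by simp
    then show ?thesis using that by (simp add: U_iff)
  qed
  have bU: "bounded U"
  proof -
    define k where "k = C1 * norm z * (2 + norm z)"
    have upper: "F w \<le> k + 2 * C1 * norm z * norm w" for w
    proof -
      obtain p where p: "subgrad \<phi> w p" using subgrad_exists[OF convex_phi] .
      obtain q where q: "subgrad \<phi> (w + z) q" using subgrad_exists[OF convex_phi] .
      have "F w \<le> t * (1 - t) * ((q - p) \<bullet> z)"
        using gap_le_subgrad[OF _ _ _ p q, of t 0] t by (simp add: F_def algebra_simps)
      also have "\<dots> \<le> t * (1 - t) * (norm (q - p) * norm z)"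
        using t by (intro mult_left_mono norm_cauchy_schwarz) auto
      also have "\<dots> \<le> 1 * (norm (q - p) * norm z)"
        using t by (intro mult_right_mono mult_le_one) auto
      also have "\<dots> \<le> (C1 * (1 + norm w) + C1 * (1 + (norm w + norm z))) * norm z"
      proof -
        have "norm (q - p) \<le> norm q + norm p" by (rule norm_triangle_ineq4)
        moreover have "norm q \<le> C1 * (1 + norm (w + z))" by (rule C1(2)[OF q])
        moreover have "C1 * (1 + norm (w + z)) \<le> C1 * (1 + (norm w + norm z))"
          using C1(1) norm_triangle_ineq[of w z] by (intro mult_left_mono) auto
        ultimately have "norm (q - p) \<le> C1 * (1 + norm w) + C1 * (1 + (norm w + norm z))" using C1(2)[OF p] by linarith
        then show ?thesis by (simp add: mult_right_mono)
      qed
      also have "\<dots> = k + 2 * C1 * norm z * norm w" by (simp add: k_def algebra_simps)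
      finally show ?thesis .
    qed
    have lower: "(1 - t) * (c * (norm w)\<^sup>2) - C \<le> A w" for w
    proof -
      have "(1 - t) * (c * (norm w)\<^sup>2 - C) + t * m \<le> A w"
        unfolding A_def using t by (intro add_mono mult_left_mono c m) auto
      then show ?thesis by (simp add: m_def algebra_simps)
    qed
    define e where "e = \<epsilon> * (1 - t) * c"
    have e: "e > 0" using \<epsilon> t c by (simp add: e_def)
    define R where "R = (\<bar>k\<bar> + 2 * C1 * norm z) / e + 1"
    have "norm w \<le> R" if w: "w \<in> U" for w
    proof (rule ccontr)
      assume "\<not> norm w \<le> R"
      then have big: "R < norm w" by simp
      have R1: "1 \<le> R" using e C1(1) by (simp add: R_def)
      have "\<epsilon> * ((1 - t) * (c * (norm w)\<^sup>2)) \<le> \<epsilon> * (A w - m)"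
        using lower[of w] \<epsilon> by (intro mult_left_mono) (auto simp: m_def)
      also have "\<dots> < F w" using w \<kappa> by (simp add: U_iff)
      also have "\<dots> \<le> k + 2 * C1 * norm z * norm w" by (rule upper)
      also have "\<dots> \<le> \<bar>k\<bar> * norm w + 2 * C1 * norm z * norm w"
        using mult_left_mono[of 1 "norm w" "\<bar>k\<bar>"] big R1 by simp
      finally have "norm w * (e * norm w) < norm w * (\<bar>k\<bar> + 2 * C1 * norm z)"
        by (simp add: e_def power2_eq_square algebra_simps)
      then have "e * norm w < \<bar>k\<bar> + 2 * C1 * norm z" using big R1 by (simp add: mult_less_cancel_left)
      moreover have "e * R = \<bar>k\<bar> + 2 * C1 * norm z + e" using e by (simp add: R_def field_simps)
      moreover have "e * R < e * norm w" using big e by simp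
      ultimately show False using e by linarith
    qed
    then show ?thesis unfolding bounded_iff by blast
  qed
  define V where "V x = a x + (norm x)\<^sup>2 / 2" for x
  define W where "W y = b y + (norm y)\<^sup>2 / 2" for y
  have fV: "exp (- a x - (norm x)\<^sup>2 / 2) = exp (- V x)" and gW: "exp (- b x - (norm x)\<^sup>2 / 2) = exp (- W x)" for x
    by (simp_all add: V_def W_def)
  have "U = {}"
    unfolding U_def
  proof (rule comparison[of t \<epsilon> "exp (\<tau> / 2)" z "\<kappa> - \<epsilon> * m"])
    show "bounded {x. \<phi> (x + t *\<^sub>R z) + (\<kappa> - \<epsilon> * m) < (1 - \<epsilon>) * ((1 - t) * \<phi> x + t * \<phi> (x + z))}"
      using bU by (simp add: U_def)
    fix w assume wU: "w \<in> {x. \<phi> (x + t *\<^sub>R z) + (\<kappa> - \<epsilon> * m) < (1 - \<epsilon>) * ((1 - t) * \<phi> x + t * \<phi> (x + z))}"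
      and gw: "good w" "good (w + z)"
    define p where "p = (1 - t) *\<^sub>R T w + t *\<^sub>R T (w + z)"
    define s where "s = norm (T (w + z) - T w)"
    define r where "r = norm z"
    have r0: "0 \<le> r" by (simp add: r_def)
    have "\<kappa> < F w" using wU UF by (simp add: U_def)
    then have s: "r + 4 * L + \<theta> \<le> s" using big[OF gw] by (simp add: F_def s_def r_def)
    have eW: "t * (1 - t) * (s\<^sup>2 / 2 - 2 * L * s) \<le> (1 - t) * W (T w) + t * W (T (w + z)) - W p"
      using gauss_potential_convex_combination[OF lip_b, of t "T w" "T (w + z)"] t
      unfolding W_def[symmetric] p_def[symmetric] s_def[symmetric] right_diff_distrib[of "t * (1 - t)"] abs_le_iff by simp
    have wz: "(1 - t) *\<^sub>R w + t *\<^sub>R (w + z) = w + t *\<^sub>R z" by (simp add: algebra_simps)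
    have eV: "(1 - t) * V w + t * V (w + z) - V (w + t *\<^sub>R z) \<le> t * (1 - t) * (r\<^sup>2 / 2 + 2 * L * r)"
      using gauss_potential_convex_combination[OF lip_a, of t w "w + z"] t
      unfolding V_def[symmetric] wz add_diff_cancel_left' r_def[symmetric] distrib_left[of "t * (1 - t)"] abs_le_iff by simp
    \<comment> \<open>Shrinking \<open>p\<close> lowers the quadratic part by at least
      \<open>\<epsilon> * (norm p)\<^sup>2 / 2\<close>, which pays for the change of
      \<open>b\<close> up to \<open>\<epsilon> * (L\<^sup>2 / 2)\<close>, uniformly in
      \<open>p\<close>.\<close>
    have eS: "W ((1 - \<epsilon>) *\<^sub>R p) \<le> W p + \<epsilon> * (L\<^sup>2 / 2)"
    proof -
      have "b ((1 - \<epsilon>) *\<^sub>R p) \<le> b p + L * norm ((1 - \<epsilon>) *\<^sub>R p - p)"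
        using lipschitz_onD[OF lip_b, of "(1 - \<epsilon>) *\<^sub>R p" p] by (simp add: dist_norm abs_le_iff)
      also have "(1 - \<epsilon>) *\<^sub>R p - p = - (\<epsilon> *\<^sub>R p)" by (simp add: algebra_simps)
      also have "norm (- (\<epsilon> *\<^sub>R p)) = \<epsilon> * norm p" using \<epsilon> by simp
      finally have 1: "b ((1 - \<epsilon>) *\<^sub>R p) \<le> b p + L * (\<epsilon> * norm p)" .
      have "(1 - \<epsilon>)\<^sup>2 \<le> 1 - \<epsilon>" using \<epsilon> by (simp add: power2_eq_square mult_left_le)
      then have "(norm ((1 - \<epsilon>) *\<^sub>R p))\<^sup>2 \<le> (1 - \<epsilon>) * (norm p)\<^sup>2"
        using \<epsilon> by (simp add: power_mult_distrib mult_right_mono)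
      moreover have "0 \<le> \<epsilon> * (norm p - L)\<^sup>2" using \<epsilon> by simp
      then have "L * (\<epsilon> * norm p) \<le> \<epsilon> * (norm p)\<^sup>2 / 2 + \<epsilon> * (L\<^sup>2 / 2)" by (simp add: power2_diff algebra_simps)
      ultimately show ?thesis using 1 by (simp add: W_def algebra_simps)
    qed
    have ln: "- (2 * \<epsilon>) \<le> ln (1 - \<epsilon>)"
    proof -
      have "- \<epsilon> - 2 * \<epsilon>\<^sup>2 \<le> ln (1 - \<epsilon>)" using \<epsilon> by (intro ln_one_minus_pos_lower_bound) auto
      moreover have "2 * \<epsilon>\<^sup>2 \<le> \<epsilon>" using \<epsilon> by (simp add: power2_eq_square)
      ultimately show ?thesis by simp
    qed
    \<comment> \<open>The difference is half of \<open>(s + r) * (s - r - 4 * L)\<close> times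
      \<open>t * (1 - t)\<close>, and the expansion hypothesis makes both factors at least
      \<open>\<theta>\<close>.\<close>
    have gain: "\<tau> \<le> t * (1 - t) * (s\<^sup>2 / 2 - 2 * L * s) - t * (1 - t) * (r\<^sup>2 / 2 + 2 * L * r)"
    proof -
      have "\<theta> * \<theta> \<le> (s + r) * (s - r - 4 * L)" using s \<theta> r0 L_nonneg by (intro mult_mono) auto
      also have "\<dots> = 2 * ((s\<^sup>2 / 2 - 2 * L * s) - (r\<^sup>2 / 2 + 2 * L * r))" by (simp add: power2_eq_square algebra_simps)
      finally have "\<theta>\<^sup>2 / 2 \<le> (s\<^sup>2 / 2 - 2 * L * s) - (r\<^sup>2 / 2 + 2 * L * r)" by (simp add: power2_eq_square)
      from mult_left_mono[OF this, of "t * (1 - t)"] t show ?thesis by (simp add: \<tau>_def right_diff_distrib)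
    qed
    have "- (n * (2 * \<epsilon>)) \<le> n * ln (1 - \<epsilon>)" using mult_left_mono[OF ln n0] by simp
    then have main: "\<tau> / 2 - V (w + t *\<^sub>R z) \<le> n * ln (1 - \<epsilon>) + (1 - t) * (W (T w) - V w) + t * (W (T (w + z)) - V (w + z)) - W ((1 - \<epsilon>) *\<^sub>R p)"
      using gain eW eV eS \<epsilon>\<tau> by (simp add: algebra_simps)
    have "exp (\<tau> / 2) * exp (- V (w + t *\<^sub>R z)) = exp (\<tau> / 2 - V (w + t *\<^sub>R z))" by (simp add: exp_add[symmetric])
    also have "\<dots> \<le> exp (n * ln (1 - \<epsilon>) + (1 - t) * (W (T w) - V w) + t * (W (T (w + z)) - V (w + z)) - W ((1 - \<epsilon>) *\<^sub>R p))"
      using main by simp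
    also have "\<dots> = (1 - \<epsilon>) ^ CARD('k) * (exp (W (T w) - V w) powr (1 - t) * exp (W (T (w + z)) - V (w + z)) powr t) * exp (- W ((1 - \<epsilon>) *\<^sub>R p))"
    proof -
      have "exp (n * ln (1 - \<epsilon>)) = (1 - \<epsilon>) ^ CARD('k)" using \<epsilon> by (simp add: n_def exp_of_nat_mult)
      moreover have "exp v powr u = exp (u * v)" for u v :: real by (simp add: powr_def)
      moreover have "exp (x1 + x2 + x3 - x4) = exp x1 * (exp x2 * exp x3) * exp (- x4)" for x1 x2 x3 x4 :: real
        by (simp add: exp_add[symmetric])
      ultimately show ?thesis by simp
    qed
    also have "exp (W (T w) - V w) = exp (- V w) / exp (- W (T w))" by (simp add: exp_diff exp_minus field_simps)
    also have "exp (W (T (w + z)) - V (w + z)) = exp (- V (w + z)) / exp (- W (T (w + z)))" by (simp add: exp_diff exp_minus field_simps)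
    finally show "exp (\<tau> / 2) * exp (- a (w + t *\<^sub>R z) - (norm (w + t *\<^sub>R z))\<^sup>2 / 2)
         \<le> (1 - \<epsilon>) ^ CARD('k) *
            ((exp (- a w - (norm w)\<^sup>2 / 2) / exp (- b (T w) - (norm (T w))\<^sup>2 / 2)) powr (1 - t) *
             (exp (- a (w + z) - (norm (w + z))\<^sup>2 / 2) / exp (- b (T (w + z)) - (norm (T (w + z)))\<^sup>2 / 2)) powr t) *
            exp (- b ((1 - \<epsilon>) *\<^sub>R ((1 - t) *\<^sub>R T w + t *\<^sub>R T (w + z))) - (norm ((1 - \<epsilon>) *\<^sub>R ((1 - t) *\<^sub>R T w + t *\<^sub>R T (w + z))))\<^sup>2 / 2)"
      unfolding fV gW p_def .
  qed (use t \<epsilon> \<tau> in auto)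
  then show False using xU by simp
qed

text \<open>For the gap \<open>c \<lambda>\<close> along \<open>\<lambda> z\<close>, convexity in \<open>\<lambda>\<close> and the previous lemma bound the increments of \<open>c\<close>,
  and a Riemann sum turns the crude bound \<open>r\<^sup>2 + 4 L r\<close> into \<open>r\<^sup>2 / 2 + 4 L r\<close>.\<close>
lemma gap_le:
  fixes z :: "(real, 'k) vec"
  assumes t: "0 < t" "t < 1"
  shows "(1 - t) * \<phi> x + t * \<phi> (x + z) - \<phi> (x + t *\<^sub>R z) \<le> t * (1 - t) * ((norm z)\<^sup>2 / 2 + 4 * L * norm z)"
proof (cases "z = 0")
  case True then show ?thesis by (simp add: algebra_simps)
next
  case False
  define r where "r = norm z"
  have r: "r > 0" using False by (simp add: r_def)
  \<comment> \<open>The fraction in \<open>i\<close> and \<open>N\<close> is the Riemann sum of j /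
    N^2 over 1 \<le> j \<le> i, which tends to one half for \<open>i = N\<close>. The slack
    \<open>\<theta>\<close> is the strict expansion that the mass comparison asks for.\<close>
  have step: "(1 - t) * \<phi> x + t * \<phi> (x + (real i / real N) *\<^sub>R z) - \<phi> (x + (t * (real i / real N)) *\<^sub>R z)
      \<le> t * (1 - t) * (r\<^sup>2 * (real i * (real i + 1) / (2 * (real N)\<^sup>2)) + (4 * L + \<theta>) * r * (real i / real N))"
    if N: "0 < N" and \<theta>: "0 < \<theta>" for i N :: nat and \<theta> x
  proof (induction i arbitrary: x)
    case (Suc i)
    define l where "l = real (Suc i) / real N"
    have l: "l > 0" using N by (simp add: l_def)
    define \<kappa> where "\<kappa> = t * (1 - t) * (r\<^sup>2 * (real (Suc i) * (real (Suc i) + 1) / (2 * (real N)\<^sup>2)) + (4 * L + \<theta>) * r * l)"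
    have "(1 - t) * \<phi> x + t * \<phi> (x + l *\<^sub>R z) - \<phi> (x + t *\<^sub>R (l *\<^sub>R z)) \<le> \<kappa>"
    proof (rule gap_le_of_expansion[OF t _ \<theta>])
      show "0 \<le> \<kappa>" unfolding \<kappa>_def using t r \<theta> l L_nonneg
        by (intro mult_nonneg_nonneg add_nonneg_nonneg divide_nonneg_nonneg) auto
      fix x assume gx: "good x" "good (x + l *\<^sub>R z)"
        and gap: "\<kappa> < (1 - t) * \<phi> x + t * \<phi> (x + l *\<^sub>R z) - \<phi> (x + t *\<^sub>R (l *\<^sub>R z))"
      \<comment> \<open>The ratio of the previous length to the present one. The inner segment
        starting at \<open>y\<close> has the previous length and the same division point.\<close>
      define k where "k = real i / real (Suc i)"
      have k: "0 \<le> k" "k < 1" by (auto simp: k_def)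
      have kl: "k * l = real i / real N" by (simp add: k_def l_def)
      define y where "y = x + (t * (1 - k) * l) *\<^sub>R z"
      have y1: "y + (real i / real N) *\<^sub>R z = x + (t * (1 - k) + k) *\<^sub>R (l *\<^sub>R z)"
        unfolding y_def kl[symmetric] by (simp add: algebra_simps)
      have y2: "y + (t * (real i / real N)) *\<^sub>R z = x + t *\<^sub>R (l *\<^sub>R z)"
        unfolding y_def kl[symmetric] by (simp add: algebra_simps)
      have y0: "y = x + (t * (1 - k)) *\<^sub>R (l *\<^sub>R z)" by (simp add: y_def)
      have IH: "(1 - t) * \<phi> y + t * \<phi> (y + (real i / real N) *\<^sub>R z) - \<phi> (y + (t * (real i / real N)) *\<^sub>R z)
        \<le> t * (1 - t) * (r\<^sup>2 * (real i * (real i + 1) / (2 * (real N)\<^sup>2)) + (4 * L + \<theta>) * r * (k * l))"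
        using Suc.IH[of y] unfolding kl .
      have inc: "((1 - t) * \<phi> x + t * \<phi> (x + l *\<^sub>R z)) - ((1 - t) * \<phi> y + t * \<phi> (y + (real i / real N) *\<^sub>R z))
        \<le> t * (1 - t) * (1 - k) * ((T (x + l *\<^sub>R z) - T x) \<bullet> (l *\<^sub>R z))"
        unfolding y1 unfolding y0 by (rule gap_le_subgrad) (use gx t k in \<open>auto simp: good_def\<close>)
      have diff: "\<kappa> - t * (1 - t) * (r\<^sup>2 * (real i * (real i + 1) / (2 * (real N)\<^sup>2)) + (4 * L + \<theta>) * r * (k * l))
         = t * (1 - t) * (1 - k) * (l * r * (l * r + 4 * L + \<theta>))"
      proof -
        define Q0 where "Q0 = real i * (real i + 1) / (2 * (real N)\<^sup>2)"
        define Q1 where "Q1 = real (Suc i) * (real (Suc i) + 1) / (2 * (real N)\<^sup>2)"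
        have Q: "Q1 = Q0 + (1 - k) * l * l"
          using N by (simp add: Q0_def Q1_def k_def l_def field_simps power2_eq_square)
        show ?thesis unfolding \<kappa>_def Q0_def[symmetric] Q1_def[symmetric] Q by (simp add: algebra_simps power2_eq_square)
      qed
      \<comment> \<open>On the long segment the gap exceeds \<kappa>, on the short one it obeys the
        induction hypothesis; the growth in between must come from the increment of
        \<open>T\<close>, which yields the required expansion.\<close>
      have "t * (1 - t) * (1 - k) * (l * r * (l * r + 4 * L + \<theta>)) < t * (1 - t) * (1 - k) * ((T (x + l *\<^sub>R z) - T x) \<bullet> (l *\<^sub>R z))"
        using gap IH inc diff unfolding y2 by linarith
      then have "l * r * (l * r + 4 * L + \<theta>) < (T (x + l *\<^sub>R z) - T x) \<bullet> (l *\<^sub>R z)"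
        using t k by (simp add: mult_less_cancel_left)
      also have "\<dots> \<le> norm (T (x + l *\<^sub>R z) - T x) * norm (l *\<^sub>R z)" by (rule norm_cauchy_schwarz)
      also have "norm (l *\<^sub>R z) = l * r" using l by (simp add: r_def)
      finally have "l * r * (l * r + 4 * L + \<theta>) < l * r * norm (T (x + l *\<^sub>R z) - T x)" by (simp add: mult.commute)
      then show "norm (l *\<^sub>R z) + 4 * L + \<theta> \<le> norm (T (x + l *\<^sub>R z) - T x)"
        using l r by (simp add: mult_less_cancel_left r_def)
    qed
    then show ?case unfolding \<kappa>_def l_def by simp
  qed (simp add: algebra_simps)
  let ?F = "(1 - t) * \<phi> x + t * \<phi> (x + z) - \<phi> (x + t *\<^sub>R z)"
  \<comment> \<open>Take \<open>i = N = Suc n\<close> and \<open>\<theta> = 1 / Suc n\<close>; both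
    excess terms vanish in the limit.\<close>
  have bound: "?F \<le> t * (1 - t) * (r\<^sup>2 * (1 / 2 + 1 / (2 * real (Suc n))) + (4 * L + 1 / real (Suc n)) * r)" for n
  proof -
    define M where "M = real (Suc n)"
    have M: "M > 0" by (simp add: M_def)
    have "M * (M + 1) / (2 * M\<^sup>2) = 1 / 2 + 1 / (2 * M)" using M by (simp add: field_simps power2_eq_square)
    moreover have "M / M = 1" using M by simp
    ultimately show ?thesis using step[of "Suc n" "1 / M" x "Suc n"] M unfolding M_def[symmetric] by simp
  qed
  have "(\<lambda>n. 1 / real (Suc n)) \<longlonglongrightarrow> 0" using LIMSEQ_inverse_real_of_nat by (simp add: inverse_eq_divide)
  then have "(\<lambda>n. t * (1 - t) * (r\<^sup>2 * (1 / 2 + 1 / 2 * (1 / real (Suc n))) + (4 * L + 1 / real (Suc n)) * r))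
     \<longlonglongrightarrow> t * (1 - t) * (r\<^sup>2 * (1 / 2 + 1 / 2 * 0) + (4 * L + 0) * r)"
    by (intro tendsto_intros)
  then have "?F \<le> t * (1 - t) * (r\<^sup>2 * (1 / 2 + 1 / 2 * 0) + (4 * L + 0) * r)"
    by (rule LIMSEQ_le_const) (use bound in auto)
  then show ?thesis by (simp add: r_def)
qed

end

section \<open>Passage to coordinates\<close>

text \<open>The change-of-variables theorem is available for \<open>real^'k\<close> only, so a Euclidean space is
  identified with \<open>real^'k\<close> for an index type that is a copy of its basis.\<close>
typedef (overloaded) ('a::euclidean_space) basis_index = "Basis :: 'a set"
  using nonempty_Basis by blast

instance basis_index :: (euclidean_space) finite
proof
  have "(UNIV :: 'a basis_index set) = Abs_basis_index ` Basis"
    by (metis (no_types, opaque_lifting) Rep_basis_index Rep_basis_index_inverse UNIV_eq_I image_eqI)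
  moreover have "finite (Abs_basis_index ` (Basis :: 'a set))" by simp
  ultimately show "finite (UNIV :: 'a basis_index set)" by (simp only:)
qed

text \<open>An arbitrary enumeration of the basis, from which the index type gets its
  well-order.\<close>

definition basis_number :: "'a::euclidean_space basis_index \<Rightarrow> nat" where
  "basis_number = (SOME f. inj f)"

lemma inj_basis_number: "inj (basis_number :: 'a::euclidean_space basis_index \<Rightarrow> nat)"
proof -
  have "\<exists>f :: 'a basis_index \<Rightarrow> nat. inj f"
    using finite_imp_inj_to_nat_seg[of "UNIV :: 'a basis_index set"] by auto
  then show ?thesis unfolding basis_number_def by (rule someI_ex)
qed

instantiation basis_index :: (euclidean_space) wellorder
begin

definition less_eq_basis_index :: "'a basis_index \<Rightarrow> 'a basis_index \<Rightarrow> bool" where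
  "less_eq_basis_index i j \<longleftrightarrow> basis_number i \<le> basis_number j"

definition less_basis_index :: "'a basis_index \<Rightarrow> 'a basis_index \<Rightarrow> bool" where
  "less_basis_index i j \<longleftrightarrow> basis_number i < basis_number j"

instance
proof
  fix P :: "'a basis_index \<Rightarrow> bool" and i
  assume step: "\<And>i. (\<And>j. j < i \<Longrightarrow> P j) \<Longrightarrow> P i"
  show "P i"
    by (induction "basis_number i" arbitrary: i rule: less_induct) (auto intro: step simp: less_basis_index_def)
qed (auto simp: less_eq_basis_index_def less_basis_index_def dest: injD[OF inj_basis_number])

end

definition to_cart :: "'a::euclidean_space \<Rightarrow> real^('a basis_index)" where
  "to_cart x = (\<chi> i. x \<bullet> Rep_basis_index i)"

definition of_cart :: "real^('a basis_index) \<Rightarrow> 'a::euclidean_space" where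
  "of_cart v = (\<Sum>i\<in>UNIV. v $ i *\<^sub>R Rep_basis_index i)"

lemma sum_basis_index: "(\<Sum>i\<in>UNIV. h (Rep_basis_index i)) = (\<Sum>b\<in>Basis. h b)"
proof (rule sum.reindex_bij_betw)
  show "bij_betw Rep_basis_index UNIV Basis"
    by (metis Rep_basis_index_inject bij_betw_def inj_onI type_definition.Rep_range type_definition_basis_index)
qed

lemma prod_basis_index: "(\<Prod>i\<in>UNIV. h (Rep_basis_index i)) = (\<Prod>b\<in>Basis. h b)"
proof (rule prod.reindex_bij_betw)
  show "bij_betw Rep_basis_index UNIV Basis"
    by (metis Rep_basis_index_inject bij_betw_def inj_onI type_definition.Rep_range type_definition_basis_index)
qed

lemma of_cart_to_cart [simp]: "of_cart (to_cart x) = x"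
  unfolding of_cart_def to_cart_def
  using sum_basis_index[of "\<lambda>b. (x \<bullet> b) *\<^sub>R b"] by (simp add: euclidean_representation)

lemma of_cart_inner: "of_cart v \<bullet> Rep_basis_index i = v $ i"
proof -
  have "of_cart v \<bullet> Rep_basis_index i = (\<Sum>j\<in>UNIV. if j = i then v $ j else 0)"
    unfolding of_cart_def inner_sum_left
    by (intro sum.cong) (auto simp: inner_Basis Rep_basis_index Rep_basis_index_inject)
  then show ?thesis by simp
qed

lemma to_cart_of_cart [simp]: "to_cart (of_cart v) = v"
  by (simp add: to_cart_def of_cart_inner vec_eq_iff)

lemma linear_to_cart: "linear to_cart"
  by (rule linearI) (simp_all add: to_cart_def vec_eq_iff inner_simps)

lemma linear_of_cart: "linear of_cart"
  by (rule linearI) (simp_all add: of_cart_def algebra_simps sum.distrib scaleR_sum_right)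

lemma inner_to_cart [simp]: "to_cart x \<bullet> to_cart y = x \<bullet> y"
  unfolding inner_vec_def to_cart_def
  using sum_basis_index[of "\<lambda>b. (x \<bullet> b) * (y \<bullet> b)"] by (simp add: euclidean_inner[of x y])

lemma inner_of_cart [simp]: "of_cart v \<bullet> of_cart w = v \<bullet> w"
  using inner_to_cart[of "of_cart v" "of_cart w"] by simp

lemma norm_of_cart [simp]: "norm (of_cart v) = norm v" and norm_to_cart [simp]: "norm (to_cart x) = norm x"
  by (simp_all add: norm_eq_sqrt_inner)

lemma continuous_to_cart: "continuous_on A to_cart"
  using linear_to_cart by (auto intro: linear_continuous_on simp: linear_conv_bounded_linear)

lemma continuous_of_cart: "continuous_on A of_cart"
  using linear_of_cart by (auto intro: linear_continuous_on simp: linear_conv_bounded_linear)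

lemma measurable_to_cart [measurable]: "to_cart \<in> borel_measurable borel"
  and measurable_of_cart [measurable]: "of_cart \<in> borel_measurable borel"
  by (intro borel_measurable_continuous_onI continuous_to_cart continuous_of_cart)+

text \<open>Preimages of boxes are boxes with the same side lengths, and Lebesgue measure is
  determined by its values on boxes.\<close>

lemma distr_to_cart: "distr lborel borel to_cart = (lborel :: (real^('a::euclidean_space basis_index)) measure)"
proof (rule lborel_eqI[symmetric])
  fix l u :: "real^('a basis_index)"
  assume lu: "\<And>b. b \<in> Basis \<Longrightarrow> l \<bullet> b \<le> u \<bullet> b"
  have le: "l $ i \<le> u $ i" for i using lu[of "axis i 1"] by (simp add: axis_in_Basis_iff cart_eq_inner_axis)
  have "to_cart -` box l u = (box (of_cart l) (of_cart u) :: 'a set)"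
  proof (intro set_eqI)
    fix x :: 'a
    have "x \<in> to_cart -` box l u \<longleftrightarrow> (\<forall>i. l $ i < x \<bullet> Rep_basis_index i \<and> x \<bullet> Rep_basis_index i < u $ i)"
      by (auto simp: mem_box_cart to_cart_def)
    also have "\<dots> \<longleftrightarrow> (\<forall>b\<in>Basis. of_cart l \<bullet> b < x \<bullet> b \<and> x \<bullet> b < of_cart u \<bullet> b)"
    proof
      assume *: "\<forall>i. l $ i < x \<bullet> Rep_basis_index i \<and> x \<bullet> Rep_basis_index i < u $ i"
      show "\<forall>b\<in>Basis. of_cart l \<bullet> b < x \<bullet> b \<and> x \<bullet> b < of_cart u \<bullet> b"
      proof
        fix b :: 'a assume "b \<in> Basis"
        then obtain i where "b = Rep_basis_index i" by (metis Abs_basis_index_inverse)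
        then show "of_cart l \<bullet> b < x \<bullet> b \<and> x \<bullet> b < of_cart u \<bullet> b" using * by (simp add: of_cart_inner)
      qed
    next
      assume *: "\<forall>b\<in>Basis. of_cart l \<bullet> b < x \<bullet> b \<and> x \<bullet> b < of_cart u \<bullet> b"
      show "\<forall>i. l $ i < x \<bullet> Rep_basis_index i \<and> x \<bullet> Rep_basis_index i < u $ i"
      proof
        fix i
        show "l $ i < x \<bullet> Rep_basis_index i \<and> x \<bullet> Rep_basis_index i < u $ i"
          using bspec[OF * Rep_basis_index[of i]] by (simp add: of_cart_inner)
      qed
    qed
    also have "\<dots> \<longleftrightarrow> x \<in> box (of_cart l) (of_cart u)" by (simp add: mem_box)
    finally show "x \<in> to_cart -` box l u \<longleftrightarrow> x \<in> box (of_cart l) (of_cart u)" .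
  qed
  then have "emeasure (distr lborel borel to_cart) (box l u) = emeasure lborel (box (of_cart l) (of_cart u) :: 'a set)"
    by (subst emeasure_distr) auto
  also have "\<dots> = ennreal (\<Prod>b\<in>Basis. (of_cart u - of_cart l :: 'a) \<bullet> b)"
  proof (rule emeasure_lborel_box)
    fix b :: 'a assume "b \<in> Basis"
    then obtain i where "b = Rep_basis_index i" by (metis Abs_basis_index_inverse)
    then show "of_cart l \<bullet> b \<le> of_cart u \<bullet> b" using le by (simp add: of_cart_inner)
  qed
  also have "(\<Prod>b\<in>Basis. (of_cart u - of_cart l :: 'a) \<bullet> b) = (\<Prod>i\<in>UNIV. (u - l) $ i)"
    by (subst prod_basis_index[symmetric]) (simp add: inner_diff_left of_cart_inner)
  also have "\<dots> = (\<Prod>b\<in>Basis. (u - l) \<bullet> b)"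
  proof -
    have B: "(Basis :: (real^('a basis_index)) set) = range (\<lambda>i. axis i 1)" by (auto simp: Basis_vec_def)
    have I: "inj (\<lambda>i :: 'a basis_index. axis i (1::real))" by (auto intro!: injI simp: axis_eq_axis)
    have "(\<Prod>b\<in>Basis. (u - l) \<bullet> b) = (\<Prod>i\<in>UNIV. (u - l) \<bullet> axis i 1)"
      unfolding B by (subst prod.reindex[OF I]) (simp add: comp_def)
    then show ?thesis by (simp add: cart_eq_inner_axis)
  qed
  finally show "emeasure (distr lborel borel to_cart) (box l u) = ennreal (\<Prod>b\<in>Basis. (u - l) \<bullet> b)" .
qed simp

lemma AE_of_cart:
  assumes "AE x in (lborel :: 'a::euclidean_space measure). P x"
  shows "AE v in lborel. P (of_cart v :: 'a)"
proof -
  from assms obtain N where N: "{x. \<not> P x} \<subseteq> N" "N \<in> null_sets lborel"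
    unfolding eventually_ae_filter by auto
  have NB: "N \<in> sets borel" using N(2) by (auto simp: null_sets_def)
  have mN: "of_cart -` N \<in> sets borel" using measurable_sets[OF measurable_of_cart NB] by simp
  have "to_cart -` (of_cart -` N) = N" by auto
  then have "emeasure (distr lborel borel to_cart) (of_cart -` N) = emeasure lborel N"
    using mN by (subst emeasure_distr) auto
  then have "of_cart -` N \<in> null_sets lborel" using N(2) mN by (simp add: distr_to_cart null_sets_def)
  then show ?thesis by (rule AE_I') (use N in auto)
qed

lemma AE_to_cart:
  assumes "AE v in lborel. P v"
  shows "AE x in (lborel :: 'a::euclidean_space measure). P (to_cart x)"
proof -
  have "AE v in distr (lborel :: 'a measure) borel to_cart. P v" using assms unfolding distr_to_cart .
  then show ?thesis by (rule AE_distrD[rotated]) simp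
qed

lemma subgrad_of_cart: "subgrad (\<lambda>v. \<phi> (of_cart v)) v w \<longleftrightarrow> subgrad \<phi> (of_cart v) (of_cart w)"
proof
  assume *: "subgrad (\<lambda>v. \<phi> (of_cart v)) v w"
  show "subgrad \<phi> (of_cart v) (of_cart w)"
    unfolding subgrad_def
  proof
    fix x
    have "of_cart w \<bullet> (x - of_cart v) = w \<bullet> (to_cart x - v)"
      by (metis inner_of_cart linear_diff[OF linear_of_cart] of_cart_to_cart)
    then show "\<phi> (of_cart v) + of_cart w \<bullet> (x - of_cart v) \<le> \<phi> x"
      using subgradD[OF *, of "to_cart x"] by simp
  qed
next
  assume *: "subgrad \<phi> (of_cart v) (of_cart w)"
  show "subgrad (\<lambda>v. \<phi> (of_cart v)) v w"
    unfolding subgrad_def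
    using subgradD[OF *] by (metis inner_of_cart linear_diff[OF linear_of_cart])
qed

lemma convex_on_of_cart:
  assumes "convex_on UNIV \<phi>" shows "convex_on UNIV (\<lambda>v. \<phi> (of_cart v))"
  using assms by (auto simp: convex_on_def linear_add[OF linear_of_cart] linear_cmul[OF linear_of_cart])

lemma lipschitz_on_of_cart:
  fixes a :: "'a::euclidean_space \<Rightarrow> real"
  assumes "L-lipschitz_on UNIV a" shows "L-lipschitz_on UNIV (\<lambda>v. a (of_cart v))"
proof (rule lipschitz_onI)
  fix v w :: "real^('a basis_index)"
  have "dist (a (of_cart v)) (a (of_cart w)) \<le> L * dist (of_cart v) (of_cart w)" by (rule lipschitz_onD[OF assms]) auto
  also have "dist (of_cart v) (of_cart w :: 'a) = dist v w"
    by (simp add: dist_norm linear_diff[OF linear_of_cart, symmetric])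
  finally show "dist (a (of_cart v)) (a (of_cart w)) \<le> L * dist v w" .
qed (rule lipschitz_on_nonneg[OF assms])

lemma density_of_cart:
  fixes f :: "'a::euclidean_space \<Rightarrow> real"
  assumes [measurable]: "f \<in> borel_measurable borel"
  shows "density lborel (\<lambda>v. ennreal (f (of_cart v))) = distr (density lborel (\<lambda>x. ennreal (f x))) borel to_cart"
  unfolding distr_to_cart[symmetric] by (subst density_distr) auto

lemma distr_density_of_cart:
  fixes f g :: "'a::euclidean_space \<Rightarrow> real"
  assumes [measurable]: "f \<in> borel_measurable borel" "g \<in> borel_measurable borel" "T \<in> borel_measurable borel"
    and push: "distr (density lborel (\<lambda>x. ennreal (f x))) borel T = density lborel (\<lambda>x. ennreal (g x))"
  shows "distr (density lborel (\<lambda>v. ennreal (f (of_cart v)))) borel (\<lambda>v. to_cart (T (of_cart v))) = density lborel (\<lambda>v. ennreal (g (of_cart v)))"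
proof -
  have "distr (density lborel (\<lambda>v. ennreal (f (of_cart v)))) borel (\<lambda>v. to_cart (T (of_cart v)))
     = distr (density lborel (\<lambda>x. ennreal (f x))) borel (\<lambda>x. to_cart (T x))"
    unfolding density_of_cart[OF assms(1)] by (subst distr_distr) (auto simp: comp_def)
  also have "\<dots> = distr (distr (density lborel (\<lambda>x. ennreal (f x))) borel T) borel to_cart"
    by (subst distr_distr) (auto simp: comp_def)
  also have "\<dots> = density lborel (\<lambda>v. ennreal (g (of_cart v)))"
    unfolding push density_of_cart[OF assms(2)] ..
  finally show ?thesis .
qed

lemma integrable_of_cart:
  fixes f :: "'a::euclidean_space \<Rightarrow> real"
  assumes "integrable lborel f"
  shows "integrable lborel (\<lambda>v. f (of_cart v))"
proof -
  have [measurable]: "f \<in> borel_measurable borel" using assms by auto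
  show ?thesis unfolding distr_to_cart[symmetric] using assms by (subst integrable_distr_eq) auto
qed

context gauss_transport begin

text \<open>The coordinate map is a linear isometry preserving Lebesgue measure, so all assumptions
  carry over to coordinates and the estimate comes back unchanged.\<close>

lemma gap_le:
  assumes t: "0 < t" "t < 1"
  shows "(1 - t) * \<phi> x + t * \<phi> (x + z) - \<phi> (x + t *\<^sub>R z) \<le> t * (1 - t) * ((norm z)\<^sup>2 / 2 + 4 * L * norm z)"
proof -
  interpret c: gauss_transport_cart "\<lambda>v. \<phi> (of_cart v)" "\<lambda>v. \<psi> (of_cart v)" "\<lambda>v. a (of_cart v)" "\<lambda>v. b (of_cart v)"
    "\<lambda>v. to_cart (T (of_cart v))" "\<lambda>v. to_cart (S (of_cart v))" L
  proof unfold_locales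
    show "convex_on UNIV (\<lambda>v. \<phi> (of_cart v :: 'a))" "convex_on UNIV (\<lambda>v. \<psi> (of_cart v :: 'a))"
      by (intro convex_on_of_cart convex_phi convex_psi)+
    show "subgrad (\<lambda>v. \<phi> (of_cart v)) v w \<longleftrightarrow> subgrad (\<lambda>v. \<psi> (of_cart v)) w v" for v w
      unfolding subgrad_of_cart by (rule conj)
    show "(\<lambda>v. to_cart (T (of_cart v))) \<in> borel_measurable borel" "(\<lambda>v. to_cart (S (of_cart v))) \<in> borel_measurable borel"
      by measurable
    have ca: "continuous_on UNIV (\<lambda>v. a (of_cart v))" and cb: "continuous_on UNIV (\<lambda>v. b (of_cart v))"
      by (rule lipschitz_on_continuous_on[OF lipschitz_on_of_cart[OF lip_a]], rule lipschitz_on_continuous_on[OF lipschitz_on_of_cart[OF lip_b]])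
    show "continuous_on UNIV (\<lambda>v::real^('a basis_index). exp (- a (of_cart v) - (norm v)\<^sup>2 / 2))"
      "continuous_on UNIV (\<lambda>v::real^('a basis_index). exp (- b (of_cart v) - (norm v)\<^sup>2 / 2))"
      by (intro continuous_intros ca cb; simp)+
    show "integrable lborel (\<lambda>v::real^('a basis_index). exp (- a (of_cart v) - (norm v)\<^sup>2 / 2))"
      using integrable_of_cart[OF f_int] by simp
    show "integrable lborel (\<lambda>v::real^('a basis_index). exp (- b (of_cart v) - (norm v)\<^sup>2 / 2))"
      using integrable_of_cart[OF g_int] by simp
    show "distr (density lborel (\<lambda>v. ennreal (exp (- a (of_cart v) - (norm v)\<^sup>2 / 2)))) borel (\<lambda>v. to_cart (T (of_cart v)))
        = density lborel (\<lambda>v. ennreal (exp (- b (of_cart v) - (norm v)\<^sup>2 / 2)))"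
      using distr_density_of_cart[OF mf mg mT push_T] by simp
    show "distr (density lborel (\<lambda>v. ennreal (exp (- b (of_cart v) - (norm v)\<^sup>2 / 2)))) borel (\<lambda>v. to_cart (S (of_cart v)))
        = density lborel (\<lambda>v. ennreal (exp (- a (of_cart v) - (norm v)\<^sup>2 / 2)))"
      using distr_density_of_cart[OF mg mf mS push_S] by simp
    show "AE v in lborel. subgrad (\<lambda>v. \<phi> (of_cart v)) v (to_cart (T (of_cart v)))"
      unfolding subgrad_of_cart using AE_of_cart[OF AE_T] by simp
    show "AE v in lborel. subgrad (\<lambda>v. \<psi> (of_cart v)) v (to_cart (S (of_cart v)))"
      unfolding subgrad_of_cart using AE_of_cart[OF AE_S] by simp
    show "L-lipschitz_on UNIV (\<lambda>v. a (of_cart v :: 'a))" "L-lipschitz_on UNIV (\<lambda>v. b (of_cart v :: 'a))"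
      by (intro lipschitz_on_of_cart lip_a lip_b)+
  qed simp_all
  show ?thesis
    using c.gap_le[OF t, of "to_cart x" "to_cart z"]
    by (simp add: linear_add[OF linear_of_cart] linear_cmul[OF linear_of_cart])
qed

end

lemma AE_differentiable_convex:
  fixes \<psi> :: "'a::euclidean_space \<Rightarrow> real"
  assumes cv: "convex_on UNIV \<psi>"
  shows "AE y in lborel. \<exists>p. (\<psi> has_derivative (\<lambda>h. p \<bullet> h)) (at y)"
proof -
  have cv': "convex_on UNIV (\<lambda>v. \<psi> (of_cart v))" by (rule convex_on_of_cart[OF cv])
  have "AE v in lborel. \<exists>p. ((\<lambda>v. \<psi> (of_cart v)) has_derivative (\<lambda>h. p \<bullet> h)) (at v)"
    using alexandrov[OF cv'] by eventually_elim (use second_derivative_at_has_derivative[OF cv'] in blast)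
  from AE_to_cart[OF this] show ?thesis
  proof eventually_elim
    case (elim y)
    then obtain p where p: "((\<lambda>v. \<psi> (of_cart v)) has_derivative (\<lambda>h. p \<bullet> h)) (at (to_cart y))" by blast
    have "(to_cart has_derivative to_cart) (at y)"
      using linear_to_cart by (intro bounded_linear_imp_has_derivative) (simp add: linear_conv_bounded_linear)
    from has_derivative_compose[OF this p] have "(\<psi> has_derivative (\<lambda>h. p \<bullet> to_cart h)) (at y)" by simp
    moreover have "p \<bullet> to_cart h = of_cart p \<bullet> h" for h
      using inner_of_cart[of p "to_cart h"] by simp
    ultimately show ?case by auto
  qed
qed

section \<open>Brenier maps\<close>

lemma AE_density_pos:
  fixes f :: "'a::euclidean_space \<Rightarrow> real"
  assumes "f \<in> borel_measurable borel" "\<And>x. 0 < f x"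
  shows "(AE x in density lborel (\<lambda>x. ennreal (f x)). P x) \<longleftrightarrow> (AE x in lborel. P x)"
  using assms by (subst AE_density) auto

context gauss_transport begin

lemma upper_expansion:
  assumes d: "(\<phi> has_derivative (\<lambda>h. p \<bullet> h)) (at x)"
  shows "\<phi> (x + z) - \<phi> x - p \<bullet> z \<le> (norm z)\<^sup>2 / 2 + 4 * L * norm z"
proof (rule field_le_epsilon)
  fix e :: real assume e: "0 < e"
  define k where "k = e / (norm z + 1)"
  have k: "k > 0" using e by (simp add: k_def add_nonneg_pos)
  have nz: "norm z + 1 \<noteq> 0" using norm_ge_zero[of z] by linarith
  obtain r where r: "r > 0" "\<And>w. norm (w - x) < r \<Longrightarrow> norm (\<phi> w - \<phi> x - p \<bullet> (w - x)) \<le> k * norm (w - x)"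
    using d k unfolding has_derivative_at_alt by blast
  define t where "t = min (1/2) (r / (2 * (norm z + 1)))"
  have t: "0 < t" "t < 1" using r by (auto simp: t_def add_nonneg_pos)
  have "t * norm z \<le> r / (2 * (norm z + 1)) * (norm z + 1)"
    using t by (intro mult_mono) (auto simp: t_def)
  also have "\<dots> = r / 2" using nz by (simp add: field_simps)
  finally have "norm (x + t *\<^sub>R z - x) < r" using r t by simp
  from r(2)[OF this] have 1: "\<phi> (x + t *\<^sub>R z) - \<phi> x - t * (p \<bullet> z) \<le> k * (t * norm z)" using t by simp
  have "k * norm z \<le> k * (norm z + 1)" using k by simp
  also have "\<dots> = e" using nz by (simp add: k_def)
  finally have "t * (k * norm z) \<le> t * e" using t by (intro mult_left_mono) auto
  with 1 have 2: "\<phi> (x + t *\<^sub>R z) - \<phi> x - t * (p \<bullet> z) \<le> t * e" by (simp add: mult.left_commute)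
  let ?s = "(norm z)\<^sup>2 / 2 + 4 * L * norm z"
  have "0 \<le> ?s" using L_nonneg by simp
  then have "t * (1 - t) * ?s \<le> t * ?s" using t by (intro mult_right_mono) (auto simp: mult_left_le)
  with gap_le[OF t, of x z] have 3: "(1 - t) * \<phi> x + t * \<phi> (x + z) - \<phi> (x + t *\<^sub>R z) \<le> t * ?s" by linarith
  have "t * (\<phi> (x + z) - \<phi> x - p \<bullet> z) \<le> t * (?s + e)"
    using 2 3 by (simp add: algebra_simps)
  then show "\<phi> (x + z) - \<phi> x - p \<bullet> z \<le> ?s + e" using t by simp
qed

text \<open>Let s be the distance of the slopes. Playing the upper expansion at one point against
  the supporting function at the other gives a defect (s - 4 L)^2/2. The two defects add up to (s -
  4 L)^2 \<le> s |x - y|, and expanding the square gives 8 L.\<close>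

lemma norm_gradient_diff_le:
  assumes dx: "(\<phi> has_derivative (\<lambda>h. p \<bullet> h)) (at x)" and dy: "(\<phi> has_derivative (\<lambda>h. q \<bullet> h)) (at y)"
  shows "norm (p - q) \<le> 8 * L + norm (x - y)"
proof (cases "norm (p - q) \<le> 4 * L")
  case True then show ?thesis using L_nonneg norm_ge_zero[of "x - y"] by linarith
next
  case False
  have coercive: "\<phi> x - \<phi> y + p \<bullet> (y - x) \<le> - (norm (p - q) - 4 * L)\<^sup>2 / 2"
    if dx: "(\<phi> has_derivative (\<lambda>h. p \<bullet> h)) (at x)" and dy: "(\<phi> has_derivative (\<lambda>h. q \<bullet> h)) (at y)"
      and big: "4 * L < norm (p - q)" for p q x y
  proof -
    define s where "s = norm (p - q)"
    define \<tau> where "\<tau> = s - 4 * L"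
    have \<tau>: "0 < \<tau>" using big by (simp add: \<tau>_def s_def)
    have s: "0 < s" using big L_nonneg unfolding s_def by linarith
    \<comment> \<open>The length \<open>\<tau> = s - 4 * L\<close> maximises
      \<open>\<tau> * s - \<tau>\<^sup>2 / 2 - 4 * L * \<tau>\<close>.\<close>
    define v where "v = (\<tau> / s) *\<^sub>R (p - q)"
    have nv: "norm v = \<tau>" using s \<tau> by (simp add: v_def s_def)
    have "(p - q) \<bullet> v = (\<tau> / s) * (s * s)" unfolding v_def s_def by (simp add: power2_norm_eq_inner[symmetric] power2_eq_square)
    then have pv: "(p - q) \<bullet> v = \<tau> * s" using s by simp
    have "\<phi> x + p \<bullet> (y + v - x) \<le> \<phi> (y + v)" by (rule subgradD[OF has_derivative_subgrad[OF convex_phi dx]])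
    moreover have "\<phi> (y + v) - \<phi> y - q \<bullet> v \<le> \<tau>\<^sup>2 / 2 + 4 * L * \<tau>" using upper_expansion[OF dy, of v] nv by simp
    ultimately have "\<phi> x - \<phi> y + p \<bullet> (y - x) \<le> \<tau>\<^sup>2 / 2 + 4 * L * \<tau> - (p - q) \<bullet> v" by (simp add: inner_simps)
    also have "\<dots> = - \<tau>\<^sup>2 / 2" unfolding pv by (simp add: \<tau>_def power2_eq_square field_simps)
    finally show ?thesis by (simp add: \<tau>_def s_def)
  qed
  have big: "4 * L < norm (p - q)" "4 * L < norm (q - p)" using False by (simp_all add: norm_minus_commute)
  have "(norm (p - q) - 4 * L)\<^sup>2 \<le> (p - q) \<bullet> (x - y)"
    using coercive[OF dx dy big(1)] coercive[OF dy dx big(2)] by (simp add: norm_minus_commute inner_simps)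
  also have "\<dots> \<le> norm (p - q) * norm (x - y)" by (rule norm_cauchy_schwarz)
  finally have "norm (p - q) * norm (p - q) \<le> norm (p - q) * (8 * L + norm (x - y)) - (4 * L)\<^sup>2"
    by (simp add: power2_eq_square algebra_simps)
  also have "\<dots> \<le> norm (p - q) * (8 * L + norm (x - y))" by simp
  finally have "norm (p - q) * norm (p - q) \<le> norm (p - q) * (8 * L + norm (x - y))" .
  moreover have "0 < norm (p - q)" using big(1) L_nonneg by linarith
  ultimately show ?thesis by (rule mult_left_le_imp_le)
qed

end

text \<open>Inverse subdifferentials determine \<psi> only up to an additive constant. Fenchel's
  inequality, with equality along the graph, fixes it and makes values of \<phi> and \<psi>
  comparable.\<close>

locale gauss_transport_legendre = gauss_transport \<phi> \<psi> a b T S L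
  for \<phi> \<psi> :: "'a::euclidean_space \<Rightarrow> real" and a b T S L +
  assumes fenchel: "\<And>x y. x \<bullet> y \<le> \<phi> x + \<psi> y"
    and fenchel_eq: "\<And>x y. subgrad \<phi> x y \<Longrightarrow> \<phi> x + \<psi> y = x \<bullet> y"
begin

text \<open>The gap estimate for \<open>\<psi>\<close> dualises to uniform convexity of \<open>\<phi>\<close>.\<close>
lemma gap_ge:
  assumes t: "0 < t" "t < 1" and big: "4 * L < norm z"
  shows "t * (1 - t) * ((norm z - 4 * L)\<^sup>2 / 2) \<le> (1 - t) * \<phi> x + t * \<phi> (x + z) - \<phi> (x + t *\<^sub>R z)"
proof -
  interpret d: gauss_transport \<psi> \<phi> b a S T L by (rule dual_gauss)
  define \<tau> where "\<tau> = norm z - 4 * L"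
  have z: "0 < norm z" using big L_nonneg by linarith
  have \<tau>: "0 < \<tau>" using big by (simp add: \<tau>_def)
  \<comment> \<open>Parallel to \<open>z\<close>, with the length \<open>norm z - 4 * L\<close> that
    is optimal in the resulting bound.\<close>
  define w where "w = (\<tau> / norm z) *\<^sub>R z"
  have nw: "norm w = \<tau>" using \<tau> z by (simp add: w_def)
  have "z \<bullet> w = (\<tau> / norm z) * (norm z * norm z)" unfolding w_def by (simp add: power2_norm_eq_inner[symmetric] power2_eq_square)
  then have zw: "z \<bullet> w = \<tau> * norm z" using z by simp
  obtain y where y: "subgrad \<phi> (x + t *\<^sub>R z) y" using subgrad_exists[OF convex_phi] .
  \<comment> \<open>Shifted so that the division point between \<open>y0\<close> and
    \<open>y0 + w\<close> is \<open>y\<close>, a slope at \<open>x + t *\<^sub>R z\<close>, where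
    Fenchel's inequality is an equality.\<close>
  define y0 where "y0 = y - t *\<^sub>R w"
  have y1: "y0 + w = y + (1 - t) *\<^sub>R w" and yt: "y0 + t *\<^sub>R w = y" by (simp_all add: y0_def algebra_simps)
  have g: "(1 - t) * \<psi> y0 + t * \<psi> (y0 + w) - \<psi> y \<le> t * (1 - t) * (\<tau>\<^sup>2 / 2 + 4 * L * \<tau>)"
    using d.gap_le[OF t, of y0 w] unfolding yt nw .
  have "(1 - t) * (x \<bullet> y0) + t * ((x + z) \<bullet> (y0 + w)) \<le> (1 - t) * (\<phi> x + \<psi> y0) + t * (\<phi> (x + z) + \<psi> (y0 + w))"
    using t by (intro add_mono mult_left_mono fenchel) auto
  moreover have "(1 - t) * (x \<bullet> y0) + t * ((x + z) \<bullet> (y0 + w)) = (x + t *\<^sub>R z) \<bullet> y + t * (1 - t) * (z \<bullet> w)"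
    unfolding y0_def by (simp add: inner_simps algebra_simps)
  moreover have "\<phi> (x + t *\<^sub>R z) + \<psi> y = (x + t *\<^sub>R z) \<bullet> y" by (rule fenchel_eq[OF y])
  ultimately have "t * (1 - t) * (z \<bullet> w) - t * (1 - t) * (\<tau>\<^sup>2 / 2 + 4 * L * \<tau>) \<le> (1 - t) * \<phi> x + t * \<phi> (x + z) - \<phi> (x + t *\<^sub>R z)"
    using g by (simp only: distrib_left)
  moreover have "z \<bullet> w - (\<tau>\<^sup>2 / 2 + 4 * L * \<tau>) = \<tau>\<^sup>2 / 2" unfolding zw by (simp add: \<tau>_def power2_eq_square field_simps)
  ultimately show ?thesis by (simp only: right_diff_distrib[symmetric] \<tau>_def)
qed

lemma lower_expansion:
  assumes p: "subgrad \<phi> x p" and big: "4 * L < norm z"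
  shows "p \<bullet> z + (norm z - 4 * L)\<^sup>2 / 2 \<le> \<phi> (x + z) - \<phi> x"
proof -
  let ?s = "(norm z - 4 * L)\<^sup>2 / 2"
  have "p \<bullet> z + (1 - t) * ?s \<le> \<phi> (x + z) - \<phi> x" if t: "0 < t" "t < 1" for t
  proof -
    have "\<phi> x + t * (p \<bullet> z) \<le> \<phi> (x + t *\<^sub>R z)" using subgradD[OF p, of "x + t *\<^sub>R z"] by simp
    then have "t * (p \<bullet> z + (1 - t) * ?s) \<le> t * (\<phi> (x + z) - \<phi> x)"
      using gap_ge[OF t big, of x] by (simp add: algebra_simps)
    then show ?thesis using t by simp
  qed
  \<comment> \<open>The offset 2 keeps \<open>t\<close> strictly below 1 for every
    \<open>n\<close>.\<close>
  from this[of "1 / real (n + 2)" for n]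
  have le: "p \<bullet> z + (1 - 1 / real (n + 2)) * ?s \<le> \<phi> (x + z) - \<phi> x" for n by simp
  have "(\<lambda>n. 1 / real (Suc n)) \<longlonglongrightarrow> 0" using LIMSEQ_inverse_real_of_nat by (simp add: inverse_eq_divide)
  from LIMSEQ_Suc[OF this] have "(\<lambda>n. 1 / real (n + 2)) \<longlonglongrightarrow> 0" by simp
  then have "(\<lambda>n. p \<bullet> z + (1 - 1 / real (n + 2)) * ?s) \<longlonglongrightarrow> p \<bullet> z + (1 - 0) * ?s" by (intro tendsto_intros)
  then have "p \<bullet> z + (1 - 0) * ?s \<le> \<phi> (x + z) - \<phi> x" by (rule LIMSEQ_le_const2) (use le in blast)
  then show ?thesis by simp
qed

text \<open>The lower expansions at both points add up to (|x - y| - 4 L)^2 \<le> (p - q) . (x - y);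
  after Cauchy-Schwarz, dropping the square of 4 L leaves the claim. For |x - y| at most 4 L the
  left side is not positive.\<close>

lemma norm_subgrad_diff_ge:
  assumes p: "subgrad \<phi> x p" and q: "subgrad \<phi> y q"
  shows "norm (x - y) - 8 * L \<le> norm (p - q)"
proof (cases "norm (x - y) \<le> 4 * L")
  case True then show ?thesis using L_nonneg norm_ge_zero[of "p - q"] by linarith
next
  case False
  then have big: "4 * L < norm (y - x)" "4 * L < norm (x - y)" by (simp_all add: norm_minus_commute)
  have "(norm (x - y) - 4 * L)\<^sup>2 \<le> (p - q) \<bullet> (x - y)"
    using lower_expansion[OF p big(1)] lower_expansion[OF q big(2)] by (simp add: norm_minus_commute inner_simps)
  also have "\<dots> \<le> norm (p - q) * norm (x - y)" by (rule norm_cauchy_schwarz)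
  finally have "norm (x - y) * (norm (x - y) - 8 * L) + (4 * L)\<^sup>2 \<le> norm (x - y) * norm (p - q)"
    by (simp add: power2_eq_square algebra_simps)
  then have "norm (x - y) * (norm (x - y) - 8 * L) \<le> norm (x - y) * norm (p - q)"
    using zero_le_power2[of "4 * L"] by linarith
  moreover have "0 < norm (x - y)" using big(2) L_nonneg by linarith
  ultimately show ?thesis by (rule mult_left_le_imp_le)
qed

end

lemma gauss_Z_pos:
  fixes a :: "'a::euclidean_space \<Rightarrow> real"
  assumes lip: "L-lipschitz_on UNIV a"
  shows "0 < gauss_Z a"
proof -
  have int: "integrable lborel (\<lambda>x. exp (- a x - (norm x)\<^sup>2 / 2))"
    using integrable_gauss_weight[OF lip, of "\<lambda>_. 1"] by simp
  have "gauss_Z a \<noteq> 0"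
  proof
    assume "gauss_Z a = 0"
    then have "AE x in (lborel :: 'a measure). exp (- a x - (norm x)\<^sup>2 / 2) = 0"
      using integral_nonneg_eq_0_iff_AE[OF int] by (simp add: gauss_Z_def)
    then have "AE x in (lborel :: 'a measure). False" by eventually_elim simp
    then show False by (simp add: eventually_False ae_filter_eq_bot_iff)
  qed
  moreover have "0 \<le> gauss_Z a" unfolding gauss_Z_def by (intro integral_nonneg_AE) simp
  ultimately show ?thesis by simp
qed

lemma gauss_tilt_eq_density:
  fixes a :: "'a::euclidean_space \<Rightarrow> real"
  assumes lip: "L-lipschitz_on UNIV a"
  shows "gauss_tilt a = density lborel (\<lambda>x. ennreal (exp (- (a x + ln (gauss_Z a)) - (norm x)\<^sup>2 / 2)))"
proof -
  have "exp (- (a x + ln (gauss_Z a)) - (norm x)\<^sup>2 / 2) = exp (- a x - (norm x)\<^sup>2 / 2) / gauss_Z a" for x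
  proof -
    have "- (a x + ln (gauss_Z a)) - (norm x)\<^sup>2 / 2 = (- a x - (norm x)\<^sup>2 / 2) - ln (gauss_Z a)" by simp
    then show ?thesis using gauss_Z_pos[OF lip] by (simp only: exp_diff exp_ln)
  qed
  then show ?thesis by (simp add: gauss_tilt_def)
qed

lemma lipschitz_on_add_const:
  fixes a :: "'a::metric_space \<Rightarrow> real"
  assumes "L-lipschitz_on X a" shows "L-lipschitz_on X (\<lambda>x. a x + c)"
  using assms by (simp add: lipschitz_on_def dist_real_def)

definition legendre :: "('a::euclidean_space \<Rightarrow> real) \<Rightarrow> 'a \<Rightarrow> real" where
  "legendre \<phi> y = (SUP x. x \<bullet> y - \<phi> x)"

text \<open>The Legendre transform is finite because the set where it is finite is convex and contains
  \<open>T x\<close> for almost every \<open>x\<close>, and the distribution of \<open>T\<close> charges every half-space.\<close>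
lemma legendre_bdd:
  fixes \<phi> :: "'a::euclidean_space \<Rightarrow> real"
  assumes T: "T \<in> borel_measurable borel" and sub: "AE x in lborel. subgrad \<phi> x (T x)"
    and f: "f \<in> borel_measurable borel" and g: "g \<in> borel_measurable borel" and gpos: "\<And>y. 0 < g y"
    and push: "distr (density lborel (\<lambda>x. ennreal (f x))) borel T = density lborel (\<lambda>x. ennreal (g x))"
  shows "bdd_above (range (\<lambda>x. x \<bullet> y - \<phi> x))"
proof (rule ccontr)
  note [measurable] = T f g
  define Y where "Y = {y. bdd_above (range (\<lambda>x. x \<bullet> y - \<phi> x))}"
  assume "\<not> bdd_above (range (\<lambda>x. x \<bullet> y - \<phi> x))"
  then have y: "y \<notin> Y" by (simp add: Y_def)
  have sY: "p \<in> Y" if "subgrad \<phi> x p" for x p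
  proof -
    have "w \<bullet> p - \<phi> w \<le> x \<bullet> p - \<phi> x" for w
      using subgradD[OF that, of w] by (simp add: inner_simps inner_commute)
    then show ?thesis unfolding Y_def by (auto intro!: bdd_aboveI2)
  qed
  have cY: "convex Y"
  proof (rule convexI)
    fix v w :: 'a and s t :: real
    assume "v \<in> Y" "w \<in> Y" and st: "0 \<le> s" "0 \<le> t" "s + t = 1"
    then obtain B C where B: "\<And>x. x \<bullet> v - \<phi> x \<le> B" and C: "\<And>x. x \<bullet> w - \<phi> x \<le> C"
      unfolding Y_def bdd_above_def by auto
    have "x \<bullet> (s *\<^sub>R v + t *\<^sub>R w) - \<phi> x \<le> s * B + t * C" for x
    proof -
      have "x \<bullet> (s *\<^sub>R v + t *\<^sub>R w) - \<phi> x = s * (x \<bullet> v - \<phi> x) + t * (x \<bullet> w - \<phi> x) + (s + t - 1) * \<phi> x"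
        by (simp add: inner_simps algebra_simps)
      also have "\<dots> \<le> s * B + t * C + (s + t - 1) * \<phi> x" using st by (intro add_mono mult_left_mono B C) auto
      finally show ?thesis using st by simp
    qed
    then show "s *\<^sub>R v + t *\<^sub>R w \<in> Y" unfolding Y_def by (auto intro!: bdd_aboveI2)
  qed
  have AE: "AE x in lborel. T x \<in> Y" using sub by eventually_elim (rule sY)
  then obtain x0 where "T x0 \<in> Y"
    using eventually_happens'[of "ae_filter (lborel :: 'a measure)"] by (auto simp: ae_filter_eq_bot_iff)
  then obtain d c where dc: "d \<noteq> 0" "\<And>v. v \<in> Y \<Longrightarrow> d \<bullet> v \<le> c" "c \<le> d \<bullet> y"
    using separating_hyperplane_sets[OF cY convex_singleton[of y]] y by auto
  have "AE x in density lborel (\<lambda>x. ennreal (f x)). d \<bullet> T x \<le> c"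
    using AE by (subst AE_density) (auto elim!: eventually_mono intro: dc)
  then have "AE v in distr (density lborel (\<lambda>x. ennreal (f x))) borel T. d \<bullet> v \<le> c"
    by (subst AE_distr_iff) auto
  then have "AE v in lborel. d \<bullet> v \<le> c"
    unfolding push AE_density_pos[OF g gpos] .
  then have "{v. c < d \<bullet> v} \<in> null_sets lborel"
    by (subst AE_iff_null_sets) (auto simp: not_less)
  then have "negligible {v. c < d \<bullet> v}" by (simp add: negligible_iff_null_sets null_sets_completionI)
  moreover have "((\<bar>c\<bar> + 1) / (d \<bullet> d)) *\<^sub>R d \<in> {v. c < d \<bullet> v}" using dc(1) by simp
  moreover have "open {v. c < d \<bullet> v}" by (rule open_halfspace_gt)
  ultimately show False using open_not_negligible by blast
qed

lemma right_slope_of_has_derivative: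
  assumes d: "(f has_derivative (\<lambda>h. p \<bullet> h)) (at x)"
  shows "right_slope f v x = p \<bullet> v"
proof -
  have "((\<lambda>s. f (x + s *\<^sub>R v)) has_derivative (\<lambda>s. p \<bullet> (s *\<^sub>R v))) (at 0)"
    by (rule has_derivative_compose[of "\<lambda>s. x + s *\<^sub>R v" _ 0]) (auto intro!: derivative_eq_intros simp: d)
  then have "((\<lambda>s. f (x + s *\<^sub>R v)) has_real_derivative (p \<bullet> v)) (at 0)"
    by (simp add: has_field_derivative_def mult_commute_abs)
  then have "((\<lambda>s. (f (x + s *\<^sub>R v) - f x) / s) \<longlongrightarrow> p \<bullet> v) (at 0)"
    by (simp add: DERIV_def)
  then have l: "((\<lambda>s. (f (x + s *\<^sub>R v) - f x) / s) \<longlongrightarrow> p \<bullet> v) (at_right 0)"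
    by (rule tendsto_mono[rotated]) (simp add: at_le)
  show ?thesis
    using tendsto_unique[OF _ slopes_cauchyD(1)[OF slopes_cauchyI[OF l]] l] by simp
qed

text \<open>The inverse transport is the gradient of the Legendre transform, which exists almost
  everywhere, hence at \<open>T x\<close> for almost every \<open>x\<close> because the image
  measure has a density. There it equals \<open>x\<close>, a subgradient at \<open>T x\<close> by
  duality. So \<open>S (T x) = x\<close> almost everywhere, and \<open>S\<close> pushes the target
  back to the source.\<close>

lemma brenier_map_gauss_transport:
  fixes a b :: "'a::euclidean_space \<Rightarrow> real"
  assumes lip_a: "L-lipschitz_on UNIV a" and lip_b: "L-lipschitz_on UNIV b"
    and br: "brenier_map (gauss_tilt a) (gauss_tilt b) \<phi> T"
  shows "\<exists>S. gauss_transport_legendre \<phi> (legendre \<phi>) (\<lambda>x. a x + ln (gauss_Z a)) (\<lambda>y. b y + ln (gauss_Z b)) T S L"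
proof -
  let ?a = "\<lambda>x. a x + ln (gauss_Z a)" and ?b = "\<lambda>y. b y + ln (gauss_Z b)"
  let ?f = "\<lambda>x. exp (- ?a x - (norm x)\<^sup>2 / 2)" and ?g = "\<lambda>y. exp (- ?b y - (norm y)\<^sup>2 / 2)"
  let ?\<psi> = "legendre \<phi>"
  have la: "L-lipschitz_on UNIV ?a" and lb: "L-lipschitz_on UNIV ?b" by (intro lipschitz_on_add_const lip_a lip_b)+
  have cf: "continuous_on UNIV ?f" and cg: "continuous_on UNIV ?g"
    by (intro continuous_intros lipschitz_on_continuous_on[OF lip_a] lipschitz_on_continuous_on[OF lip_b]; simp)+
  have mf[measurable]: "?f \<in> borel_measurable borel" and mg[measurable]: "?g \<in> borel_measurable borel"
    by (rule borel_measurable_continuous_onI[OF cf], rule borel_measurable_continuous_onI[OF cg])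
  have fi: "integrable lborel ?f" and gi: "integrable lborel ?g"
    using integrable_gauss_weight[OF la, of "\<lambda>_. 1"] integrable_gauss_weight[OF lb, of "\<lambda>_. 1"] by simp_all
  have cv: "convex_on UNIV \<phi>" and mT[measurable]: "T \<in> borel_measurable borel"
    and AEd: "AE x in gauss_tilt a. (\<phi> has_derivative (\<lambda>h. T x \<bullet> h)) (at x)"
    and push: "distr (gauss_tilt a) borel T = gauss_tilt b"
    using br by (auto simp: brenier_map_def)
  note fd = gauss_tilt_eq_density[OF lip_a] and gd = gauss_tilt_eq_density[OF lip_b]
  have AEd': "AE x in lborel. (\<phi> has_derivative (\<lambda>h. T x \<bullet> h)) (at x)"
    using AEd unfolding fd AE_density_pos[OF mf exp_gt_zero] .
  then have AE_T: "AE x in lborel. subgrad \<phi> x (T x)" by eventually_elim (rule has_derivative_subgrad[OF cv])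
  have pushT: "distr (density lborel (\<lambda>x. ennreal (?f x))) borel T = density lborel (\<lambda>x. ennreal (?g x))"
    using push unfolding fd gd .
  have bdd: "bdd_above (range (\<lambda>x. x \<bullet> y - \<phi> x))" for y
    by (rule legendre_bdd[OF mT AE_T mf mg _ pushT]) simp
  have fen: "x \<bullet> y \<le> \<phi> x + ?\<psi> y" for x y
    using cSUP_upper[OF _ bdd[of y], of x] by (simp add: legendre_def)
  have psi_le: "?\<psi> y \<le> B" if "\<And>x. x \<bullet> y - \<phi> x \<le> B" for y B
    unfolding legendre_def by (rule cSUP_least) (use that in auto)
  have fen_eq: "\<phi> x + ?\<psi> y = x \<bullet> y" if "subgrad \<phi> x y" for x y
  proof -
    have "w \<bullet> y - \<phi> w \<le> x \<bullet> y - \<phi> x" for w using subgradD[OF that, of w] by (simp add: inner_simps inner_commute)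
    from psi_le[OF this] fen[of x y] show ?thesis by simp
  qed
  have conj: "subgrad \<phi> x y \<longleftrightarrow> subgrad ?\<psi> y x" for x y
  proof
    assume s: "subgrad \<phi> x y"
    show "subgrad ?\<psi> y x"
      unfolding subgrad_def
    proof
      fix w show "?\<psi> y + x \<bullet> (w - y) \<le> ?\<psi> w" using fen_eq[OF s] fen[of x w] by (simp add: inner_simps)
    qed
  next
    assume s: "subgrad ?\<psi> y x"
    \<comment> \<open>At any slope \<open>p\<close> of \<phi> at \<open>x\<close> Fenchel's equality
      holds; tested there, the supporting inequality of the Legendre transform becomes the reverse
      Fenchel inequality at \<open>x\<close> and \<open>y\<close>.\<close>
    obtain p where p: "subgrad \<phi> x p" using subgrad_exists[OF cv] .
    have "?\<psi> y + x \<bullet> (p - y) \<le> ?\<psi> p" by (rule subgradD[OF s])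
    then have le: "\<phi> x + ?\<psi> y \<le> x \<bullet> y" using fen_eq[OF p] by (simp add: inner_simps)
    show "subgrad \<phi> x y"
      unfolding subgrad_def
    proof
      fix w show "\<phi> x + y \<bullet> (w - x) \<le> \<phi> w" using le fen[of w y] by (simp add: inner_simps inner_commute)
    qed
  qed
  have cpsi: "convex_on UNIV ?\<psi>"
  proof (rule convex_onI)
    fix t :: real and v w :: 'a assume t: "0 < t" "t < 1"
    show "?\<psi> ((1 - t) *\<^sub>R v + t *\<^sub>R w) \<le> (1 - t) * ?\<psi> v + t * ?\<psi> w"
    proof (rule psi_le)
      fix x
      have "(1 - t) * (x \<bullet> v) + t * (x \<bullet> w) \<le> (1 - t) * (\<phi> x + ?\<psi> v) + t * (\<phi> x + ?\<psi> w)"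
        using t by (intro add_mono mult_left_mono fen) auto
      then show "x \<bullet> ((1 - t) *\<^sub>R v + t *\<^sub>R w) - \<phi> x \<le> (1 - t) * ?\<psi> v + t * ?\<psi> w"
        by (simp add: inner_simps algebra_simps)
    qed
  qed simp
  \<comment> \<open>Right slopes along the basis give a map that is Borel on the whole space and
    equals the gradient wherever there is one.\<close>
  define S where "S y = (\<Sum>e\<in>Basis. right_slope ?\<psi> e y *\<^sub>R e)" for y
  have cpsi': "continuous_on UNIV ?\<psi>" by (rule convex_on_UNIV_isCont[OF cpsi])
  have "continuous_on UNIV (slope_seq ?\<psi> e n)" for e n
    unfolding slope_seq_def[abs_def] by (intro continuous_intros continuous_on_compose2[OF cpsi']) auto
  then have "slope_seq ?\<psi> e n \<in> borel_measurable borel" for e n by (rule borel_measurable_continuous_onI)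
  then have "right_slope ?\<psi> e \<in> borel_measurable borel" for e
    unfolding right_slope_def[abs_def] by (rule borel_measurable_lim_metric)
  then have mS[measurable]: "S \<in> borel_measurable borel" unfolding S_def[abs_def] by measurable
  have S_eq: "S y = p" if "(?\<psi> has_derivative (\<lambda>h. p \<bullet> h)) (at y)" for y p
    unfolding S_def using right_slope_of_has_derivative[OF that] by (simp add: euclidean_representation)
  have AE_psi: "AE y in lborel. (?\<psi> has_derivative (\<lambda>h. S y \<bullet> h)) (at y)"
    using AE_differentiable_convex[OF cpsi] by eventually_elim (use S_eq in blast)
  then have AE_S: "AE y in lborel. subgrad ?\<psi> y (S y)" by eventually_elim (rule has_derivative_subgrad[OF cpsi])
  have ST: "AE x in density lborel (\<lambda>x. ennreal (?f x)). S (T x) = x"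
  proof -
    have "AE y in density lborel (\<lambda>x. ennreal (?g x)). (?\<psi> has_derivative (\<lambda>h. S y \<bullet> h)) (at y)"
      using AE_psi unfolding AE_density_pos[OF mg exp_gt_zero] .
    then have "AE y in distr (density lborel (\<lambda>x. ennreal (?f x))) borel T. (?\<psi> has_derivative (\<lambda>h. S y \<bullet> h)) (at y)"
      unfolding pushT .
    then have 1: "AE x in density lborel (\<lambda>x. ennreal (?f x)). (?\<psi> has_derivative (\<lambda>h. S (T x) \<bullet> h)) (at (T x))"
      by (rule AE_distrD[rotated]) simp
    have "AE x in density lborel (\<lambda>x. ennreal (?f x)). subgrad \<phi> x (T x)"
      using AE_T unfolding AE_density_pos[OF mf exp_gt_zero] .
    with 1 show ?thesis
    proof eventually_elim
      case (elim x)
      then have "subgrad ?\<psi> (T x) x" using conj by blast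
      then show ?case using subgrad_of_has_derivative[OF cpsi elim(1)] by simp
    qed
  qed
  have pushS: "distr (density lborel (\<lambda>x. ennreal (?g x))) borel S = density lborel (\<lambda>x. ennreal (?f x))"
  proof -
    have "distr (density lborel (\<lambda>x. ennreal (?g x))) borel S = distr (density lborel (\<lambda>x. ennreal (?f x))) borel (\<lambda>x. S (T x))"
      unfolding pushT[symmetric] by (subst distr_distr) (auto simp: comp_def)
    also have "\<dots> = distr (density lborel (\<lambda>x. ennreal (?f x))) borel (\<lambda>x. x)"
      by (rule distr_cong_AE) (use ST in auto)
    also have "\<dots> = density lborel (\<lambda>x. ennreal (?f x))" by (rule distr_id2) simp
    finally show ?thesis .
  qed
  have "gauss_transport_legendre \<phi> ?\<psi> ?a ?b T S L"
    by unfold_locales (rule cv cpsi conj mT mS cf cg exp_gt_zero fi gi pushT pushS AE_T AE_S la lb fen fen_eq; assumption?)+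
  then show ?thesis by blast
qed

text \<open>Stated for derivatives \<open>p\<close> and \<open>q\<close> of the potential rather
  than for values of \<open>T\<close>, which are arbitrary on a null set.\<close>

lemma brenier_map_almost_isometry:
  fixes a b :: "'a::euclidean_space \<Rightarrow> real"
  assumes lip_a: "L-lipschitz_on UNIV a" and lip_b: "L-lipschitz_on UNIV b"
    and br: "brenier_map (gauss_tilt a) (gauss_tilt b) \<phi> T"
    and dx: "(\<phi> has_derivative (\<lambda>h. p \<bullet> h)) (at x)" and dy: "(\<phi> has_derivative (\<lambda>h. q \<bullet> h)) (at y)"
  shows "- 8 * L + norm (x - y) \<le> norm (p - q) \<and> norm (p - q) \<le> 8 * L + norm (x - y)"
proof -
  obtain S where "gauss_transport_legendre \<phi> (legendre \<phi>) (\<lambda>x. a x + ln (gauss_Z a)) (\<lambda>y. b y + ln (gauss_Z b)) T S L"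
    using brenier_map_gauss_transport[OF lip_a lip_b br] by blast
  then interpret gauss_transport_legendre \<phi> "legendre \<phi>" "\<lambda>x. a x + ln (gauss_Z a)" "\<lambda>y. b y + ln (gauss_Z b)" T S L .
  have "norm (x - y) - 8 * L \<le> norm (p - q)"
    by (rule norm_subgrad_diff_ge) (rule has_derivative_subgrad[OF convex_phi] dx dy)+
  then show ?thesis using norm_gradient_diff_le[OF dx dy] by simp
qed

text \<open>By 1 + r^2 \<le> 8 exp (r^2/8), quadratic growth is covered by the exponential factor
  that the Gaussian weight absorbs.\<close>

lemma integrable_quadratic_gauss_weight:
  fixes a :: "'a::euclidean_space \<Rightarrow> real"
  assumes lip: "L-lipschitz_on UNIV a" and h: "h \<in> borel_measurable borel"
    and hb: "AE x in lborel. \<bar>h x\<bar> \<le> K * (1 + (norm x)\<^sup>2)"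
  shows "integrable lborel (\<lambda>x. h x * exp (- a x - (norm x)\<^sup>2 / 2))"
proof (rule Bochner_Integration.integrable_bound)
  note [measurable] = h
  have [measurable]: "a \<in> borel_measurable borel"
    by (rule borel_measurable_continuous_onI[OF lipschitz_on_continuous_on[OF lip]])
  show "integrable lborel (\<lambda>x. (8 * \<bar>K\<bar>) * (exp ((norm x)\<^sup>2 / 8) * exp (- a x - (norm x)\<^sup>2 / 2)))"
    by (intro integrable_mult_right integrable_gauss_weight[OF lip]) auto
  show "(\<lambda>x. h x * exp (- a x - (norm x)\<^sup>2 / 2)) \<in> borel_measurable lborel" by measurable
  show "AE x in lborel. norm (h x * exp (- a x - (norm x)\<^sup>2 / 2)) \<le> norm ((8 * \<bar>K\<bar>) * (exp ((norm x)\<^sup>2 / 8) * exp (- a x - (norm x)\<^sup>2 / 2)))"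
    using hb
  proof eventually_elim
    case (elim x)
    have "1 + (norm x)\<^sup>2 \<le> 8 * exp ((norm x)\<^sup>2 / 8)" using exp_ge_add_one_self[of "(norm x)\<^sup>2 / 8"] by linarith
    then have "\<bar>K\<bar> * (1 + (norm x)\<^sup>2) \<le> \<bar>K\<bar> * (8 * exp ((norm x)\<^sup>2 / 8))" by (rule mult_left_mono) simp
    moreover have "K * (1 + (norm x)\<^sup>2) \<le> \<bar>K\<bar> * (1 + (norm x)\<^sup>2)" by (intro mult_right_mono) auto
    ultimately have "\<bar>h x\<bar> \<le> 8 * \<bar>K\<bar> * exp ((norm x)\<^sup>2 / 8)" using elim by simp
    then have "\<bar>h x\<bar> * exp (- a x - (norm x)\<^sup>2 / 2) \<le> 8 * \<bar>K\<bar> * exp ((norm x)\<^sup>2 / 8) * exp (- a x - (norm x)\<^sup>2 / 2)"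
      by (rule mult_right_mono) simp
    then show ?case by (simp add: abs_mult mult.assoc)
  qed
qed

lemma distr_lborel_uminus: "distr lborel borel uminus = (lborel :: 'a::euclidean_space measure)"
  using lborel_affine[of "-1" "0::'a"] by (simp add: density_1)

lemma integral_lborel_uminus:
  fixes h :: "'a::euclidean_space \<Rightarrow> real"
  assumes [measurable]: "h \<in> borel_measurable borel"
  shows "(\<integral>x. h (- x) \<partial>lborel) = (\<integral>x. h x \<partial>lborel)"
proof -
  have "(\<integral>x. h x \<partial>lborel) = (\<integral>x. h x \<partial>distr lborel borel uminus)" by (simp add: distr_lborel_uminus)
  also have "\<dots> = (\<integral>x. h (- x) \<partial>lborel)" by (subst integral_distr) auto
  finally show ?thesis ..
qed

lemma AE_lborel_uminus:
  assumes "AE x in lborel. P x"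
  shows "AE x in (lborel :: 'a::euclidean_space measure). P (- x)"
proof -
  have "AE x in distr (lborel :: 'a measure) borel uminus. P x" using assms unfolding distr_lborel_uminus .
  then show ?thesis by (rule AE_distrD[rotated]) simp
qed

context gauss_transport begin

text \<open>The linear bound on subgradients is used at \<open>0\<close> for the lower and at
  \<open>x\<close> for the upper estimate. It makes \<phi>, and \<psi> along the transport,
  integrable against the Gaussian weights.\<close>

lemma quadratic_bound: "\<exists>K\<ge>0. \<forall>x. \<bar>\<phi> x\<bar> \<le> K * (1 + (norm x)\<^sup>2)"
proof -
  obtain C where C: "0 < C" "\<And>x p. subgrad \<phi> x p \<Longrightarrow> norm p \<le> C * (1 + norm x)" using linear_growth by blast
  obtain p0 where p0: "subgrad \<phi> 0 p0" using subgrad_exists[OF convex_phi] .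
  have "\<bar>\<phi> x\<bar> \<le> (\<bar>\<phi> 0\<bar> + 2 * C) * (1 + (norm x)\<^sup>2)" for x
  proof -
    have nx: "(1 + norm x) * norm x \<le> 2 * (1 + (norm x)\<^sup>2)"
    proof -
      define n where "n = norm x"
      have "0 \<le> n" "0 \<le> (n - 1)\<^sup>2" by (simp_all add: n_def)
      then have "(1 + n) * n \<le> 2 * (1 + n\<^sup>2)" by (simp add: power2_eq_square algebra_simps)
      then show ?thesis by (simp add: n_def)
    qed
    have b: "\<bar>q \<bullet> x\<bar> \<le> 2 * C * (1 + (norm x)\<^sup>2)" if "norm q \<le> C * (1 + norm x)" for q
    proof -
      have "\<bar>q \<bullet> x\<bar> \<le> norm q * norm x" by (rule Cauchy_Schwarz_ineq2)
      also have "\<dots> \<le> C * (1 + norm x) * norm x" by (intro mult_right_mono that) simp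
      also have "\<dots> \<le> C * (2 * (1 + (norm x)\<^sup>2))" unfolding mult.assoc using C(1) by (intro mult_left_mono nx) simp
      finally show ?thesis by (simp add: algebra_simps)
    qed
    obtain p where p: "subgrad \<phi> x p" using subgrad_exists[OF convex_phi] .
    have "C * 1 \<le> C * (1 + norm x)" using C(1) by (intro mult_left_mono) auto
    then have "norm p0 \<le> C * (1 + norm x)" using C(2)[OF p0] by simp
    from b[OF this] have lo: "- \<bar>\<phi> 0\<bar> - 2 * C * (1 + (norm x)\<^sup>2) \<le> \<phi> x" using subgradD[OF p0, of x] by simp
    have hi: "\<phi> x \<le> \<bar>\<phi> 0\<bar> + 2 * C * (1 + (norm x)\<^sup>2)" using b[OF C(2)[OF p]] subgradD[OF p, of 0] by simp
    have "\<bar>\<phi> 0\<bar> * 1 \<le> \<bar>\<phi> 0\<bar> * (1 + (norm x)\<^sup>2)" by (intro mult_left_mono) auto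
    with lo hi show ?thesis unfolding distrib_right[of "\<bar>\<phi> 0\<bar>"] abs_le_iff[of "\<phi> x"] by linarith
  qed
  then show ?thesis using C(1) by (intro exI[of _ "\<bar>\<phi> 0\<bar> + 2 * C"]) auto
qed

end

context gauss_transport_legendre begin

text \<open>Both \<open>T\<close> and its reflection maximise the integral of \<open>x \<bullet> T x\<close> among the maps with the same
  image measure, so equality holds in Fenchel's inequality along the reflected map.\<close>
lemma AE_odd:
  assumes even_a: "\<And>x. a (- x) = a x" and even_b: "\<And>x. b (- x) = b x"
  shows "AE x in lborel. T (- x) = - T x"
proof -
  let ?f = "\<lambda>x. exp (- a x - (norm x)\<^sup>2 / 2)" and ?g = "\<lambda>y. exp (- b y - (norm y)\<^sup>2 / 2)"
  interpret d: gauss_transport \<psi> \<phi> b a S T L by (rule dual_gauss)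
  have [measurable]: "\<phi> \<in> borel_measurable borel" "\<psi> \<in> borel_measurable borel"
    by (intro borel_measurable_continuous_onI convex_on_UNIV_isCont convex_phi convex_psi)+
  obtain K where K: "0 \<le> K" "\<And>x. \<bar>\<phi> x\<bar> \<le> K * (1 + (norm x)\<^sup>2)" using quadratic_bound by blast
  obtain M where M: "0 \<le> M" "\<And>y. \<bar>\<psi> y\<bar> \<le> M * (1 + (norm y)\<^sup>2)" using d.quadratic_bound by blast
  obtain C where C: "0 < C" "\<And>x p. subgrad \<phi> x p \<Longrightarrow> norm p \<le> C * (1 + norm x)" using linear_growth by blast
  have T_bound: "AE x in lborel. norm (T x) \<le> C * (1 + norm x)" using AE_T by eventually_elim (rule C)
  have sq: "(1 + norm x)\<^sup>2 \<le> 2 * (1 + (norm x)\<^sup>2)" for x :: 'a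
    using zero_le_power2[of "norm x - 1"] by (simp add: power2_eq_square algebra_simps)
  have T2: "(norm (T x))\<^sup>2 \<le> 2 * C\<^sup>2 * (1 + (norm x)\<^sup>2)" if "norm (T x) \<le> C * (1 + norm x)" for x
  proof -
    have "(norm (T x))\<^sup>2 \<le> (C * (1 + norm x))\<^sup>2" by (intro power_mono that) simp
    also have "\<dots> \<le> C\<^sup>2 * (2 * (1 + (norm x)\<^sup>2))" unfolding power_mult_distrib by (intro mult_left_mono sq) simp
    finally show ?thesis by (simp only: mult.assoc mult.left_commute)
  qed
  have i1: "integrable lborel (\<lambda>x. \<phi> x * ?f x)"
    by (rule integrable_quadratic_gauss_weight[OF lip_a]) (auto intro: K)
  have i2: "integrable lborel (\<lambda>x. \<psi> (s *\<^sub>R T x) * ?f x)" if "s = 1 \<or> s = - 1" for s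
  proof (rule integrable_quadratic_gauss_weight[OF lip_a])
    show "AE x in lborel. \<bar>\<psi> (s *\<^sub>R T x)\<bar> \<le> M * (1 + 2 * C\<^sup>2) * (1 + (norm x)\<^sup>2)"
      using T_bound
    proof eventually_elim
      case (elim x)
      have "\<bar>\<psi> (s *\<^sub>R T x)\<bar> \<le> M * (1 + (norm (T x))\<^sup>2)" using M(2)[of "s *\<^sub>R T x"] that by auto
      also have "\<dots> \<le> M * ((1 + (norm x)\<^sup>2) + 2 * C\<^sup>2 * (1 + (norm x)\<^sup>2))"
        by (rule mult_left_mono[OF add_mono[OF _ T2[OF elim]] M(1)]) simp
      finally show ?case by (simp add: algebra_simps)
    qed
  qed measurable
  have i3: "integrable lborel (\<lambda>x. (x \<bullet> T x) * ?f x)"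
  proof (rule integrable_quadratic_gauss_weight[OF lip_a])
    show "AE x in lborel. \<bar>x \<bullet> T x\<bar> \<le> (1 + 2 * C\<^sup>2) * (1 + (norm x)\<^sup>2)"
      using T_bound
    proof eventually_elim
      case (elim x)
      have "2 * (norm x * norm (T x)) \<le> (norm x)\<^sup>2 + (norm (T x))\<^sup>2"
        using zero_le_power2[of "norm x - norm (T x)"] by (simp add: power2_eq_square algebra_simps)
      moreover have "\<bar>x \<bullet> T x\<bar> \<le> norm x * norm (T x)" by (rule Cauchy_Schwarz_ineq2)
      moreover have "0 \<le> norm x * norm (T x)" by simp
      ultimately have "\<bar>x \<bullet> T x\<bar> \<le> (norm x)\<^sup>2 + (norm (T x))\<^sup>2" by linarith
      also have "\<dots> \<le> (1 + (norm x)\<^sup>2) + 2 * C\<^sup>2 * (1 + (norm x)\<^sup>2)"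
        by (rule add_mono[OF _ T2[OF elim]]) simp
      finally show ?case by (simp add: algebra_simps)
    qed
  qed measurable
  \<comment> \<open>The reflected map; evenness of both weights makes it a transport between the
    same measures.\<close>
  define R where "R x = - T (- x)" for x
  have mR[measurable]: "R \<in> borel_measurable borel" unfolding R_def[abs_def] by measurable
  have refl_int: "(\<integral>x. h (- x) * ?f x \<partial>lborel) = (\<integral>x. h x * ?f x \<partial>lborel)"
    and refl_integrable: "integrable lborel (\<lambda>x. h x * ?f x) \<Longrightarrow> integrable lborel (\<lambda>x. h (- x) * ?f x)"
    if [measurable]: "h \<in> borel_measurable borel" for h :: "'a \<Rightarrow> real"
  proof -
    show "(\<integral>x. h (- x) * ?f x \<partial>lborel) = (\<integral>x. h x * ?f x \<partial>lborel)"
      using integral_lborel_uminus[of "\<lambda>x. h x * ?f x"] by (simp add: even_a)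
    assume "integrable lborel (\<lambda>x. h x * ?f x)"
    then have "integrable (distr lborel borel uminus) (\<lambda>x. h x * ?f x)" unfolding distr_lborel_uminus .
    then show "integrable lborel (\<lambda>x. h (- x) * ?f x)"
      by (subst (asm) integrable_distr_eq) (auto simp: even_a)
  qed
  have j2: "integrable lborel (\<lambda>x. \<psi> (R x) * ?f x)"
    using refl_integrable[of "\<lambda>x. \<psi> (- T x)"] i2[of "- 1"] by (simp add: R_def)
  have j3: "integrable lborel (\<lambda>x. (x \<bullet> R x) * ?f x)"
    using refl_integrable[of "\<lambda>x. x \<bullet> T x"] i3 by (simp add: R_def)
  have "(\<integral>x. \<psi> (R x) * ?f x \<partial>lborel) = (\<integral>x. \<psi> (- T x) * ?f x \<partial>lborel)"
    using refl_int[of "\<lambda>x. \<psi> (- T x)"] by (simp add: R_def)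
  also have "\<dots> = (\<integral>y. \<psi> (- y) * ?g y \<partial>lborel)" by (rule d.integral_push_S[of "\<lambda>y. \<psi> (- y)"]) measurable
  also have "\<dots> = (\<integral>y. \<psi> y * ?g y \<partial>lborel)"
    using integral_lborel_uminus[of "\<lambda>y. \<psi> y * ?g y"] by (simp add: even_b)
  also have "\<dots> = (\<integral>x. \<psi> (T x) * ?f x \<partial>lborel)" by (rule d.integral_push_S[symmetric]) measurable
  finally have e2: "(\<integral>x. \<psi> (R x) * ?f x \<partial>lborel) = (\<integral>x. \<psi> (T x) * ?f x \<partial>lborel)" .
  have e3: "(\<integral>x. (x \<bullet> R x) * ?f x \<partial>lborel) = (\<integral>x. (x \<bullet> T x) * ?f x \<partial>lborel)"
    using refl_int[of "\<lambda>x. x \<bullet> T x"] by (simp add: R_def)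
  have i2': "integrable lborel (\<lambda>x. \<psi> (T x) * ?f x)" using i2[of 1] by simp
  \<comment> \<open>Along \<open>T\<close> Fenchel's inequality is an equality, so its defect has
    integral zero. None of the three integrals changes when \<open>T\<close> is replaced by
    \<open>R\<close>.\<close>
  have "0 = (\<integral>x. \<phi> x * ?f x + \<psi> (T x) * ?f x - (x \<bullet> T x) * ?f x \<partial>lborel)"
  proof -
    have "AE x in lborel. \<phi> x * ?f x + \<psi> (T x) * ?f x - (x \<bullet> T x) * ?f x = 0"
      using AE_T
    proof eventually_elim
      case (elim x)
      show ?case unfolding fenchel_eq[OF elim, symmetric] by (simp add: algebra_simps)
    qed
    then show ?thesis by (rule integral_eq_zero_AE[symmetric])
  qed
  also have "\<dots> = (\<integral>x. \<phi> x * ?f x + \<psi> (R x) * ?f x - (x \<bullet> R x) * ?f x \<partial>lborel)"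
    using i1 i2' i3 j2 j3 e2 e3 by simp
  finally have zero: "(\<integral>x. \<phi> x * ?f x + \<psi> (R x) * ?f x - (x \<bullet> R x) * ?f x \<partial>lborel) = 0" by simp
  have "integrable lborel (\<lambda>x. \<phi> x * ?f x + \<psi> (R x) * ?f x - (x \<bullet> R x) * ?f x)"
    using i1 j2 j3 by (intro Bochner_Integration.integrable_diff Bochner_Integration.integrable_add)
  moreover have factor: "\<phi> x * ?f x + \<psi> (R x) * ?f x - (x \<bullet> R x) * ?f x = (\<phi> x + \<psi> (R x) - x \<bullet> R x) * ?f x" for x
    by (simp add: algebra_simps)
  moreover have "0 \<le> (\<phi> x + \<psi> (R x) - x \<bullet> R x) * ?f x" for x using fenchel[of x "R x"] by simp
  ultimately have "AE x in lborel. (\<phi> x + \<psi> (R x) - x \<bullet> R x) * ?f x = 0"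
    using zero integral_nonneg_eq_0_iff_AE[of lborel "\<lambda>x. (\<phi> x + \<psi> (R x) - x \<bullet> R x) * ?f x"] by simp
  then have "AE x in lborel. R x = T x"
    using AE_T AE_differentiable_convex[OF convex_phi]
  proof eventually_elim
    case (elim x)
    have eq: "\<phi> x + \<psi> (R x) = x \<bullet> R x" using elim(1) by simp
    \<comment> \<open>Equality in Fenchel's inequality makes \<open>R x\<close> a subgradient;
      differentiability at almost every \<open>x\<close> identifies it with
      \<open>T x\<close>.\<close>
    have "subgrad \<phi> x (R x)"
      unfolding subgrad_def
    proof
      fix w show "\<phi> x + R x \<bullet> (w - x) \<le> \<phi> w" using eq fenchel[of w "R x"] by (simp add: inner_simps inner_commute)
    qed
    then show ?case using elim(2,3) subgrad_of_has_derivative[OF convex_phi] by metis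
  qed
  then show ?thesis by eventually_elim (simp add: R_def minus_equation_iff)
qed

end

text \<open>For an odd map the pair \<open>w\<close>, \<open>- w\<close> turns the two-point bound
  into a bound on norms with half the constant. Oddness holds only almost everywhere, so
  \<open>w\<close> is taken near \<open>x\<close>, and continuity of subgradients at a point of
  differentiability brings the bound back to \<open>x\<close>.\<close>

lemma brenier_map_even_norm:
  fixes a b :: "'a::euclidean_space \<Rightarrow> real"
  assumes lip_a: "L-lipschitz_on UNIV a" and lip_b: "L-lipschitz_on UNIV b"
    and even: "\<And>x. a (- x) = a x" "\<And>x. b (- x) = b x"
    and br: "brenier_map (gauss_tilt a) (gauss_tilt b) \<phi> T"
    and dx: "(\<phi> has_derivative (\<lambda>h. p \<bullet> h)) (at x)"
  shows "\<bar>norm p - norm x\<bar> \<le> 4 * L"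
proof (rule field_le_epsilon)
  fix e :: real assume e: "0 < e"
  obtain S where "gauss_transport_legendre \<phi> (legendre \<phi>) (\<lambda>x. a x + ln (gauss_Z a)) (\<lambda>y. b y + ln (gauss_Z b)) T S L"
    using brenier_map_gauss_transport[OF lip_a lip_b br] by blast
  then interpret g: gauss_transport_legendre \<phi> "legendre \<phi>" "\<lambda>x. a x + ln (gauss_Z a)" "\<lambda>y. b y + ln (gauss_Z b)" T S L .
  have convex_phi: "convex_on UNIV \<phi>" by (rule g.convex_phi)
  have "0 < e / 2" using e by simp
  from subgrad_continuous[OF convex_phi dx this] obtain d where
    d: "0 < d" "\<And>w q. dist w x < d \<Longrightarrow> subgrad \<phi> w q \<Longrightarrow> norm (q - p) \<le> e / 2" by blast
  have AE_d: "AE w in lborel. (\<phi> has_derivative (\<lambda>h. T w \<bullet> h)) (at w)"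
    using g.AE_T AE_differentiable_convex[OF convex_phi]
    by eventually_elim (metis subgrad_of_has_derivative[OF convex_phi])
  have AE_w: "AE w in lborel. T (- w) = - T w \<and> (\<phi> has_derivative (\<lambda>h. T w \<bullet> h)) (at w) \<and>
      (\<phi> has_derivative (\<lambda>h. T (- w) \<bullet> h)) (at (- w))"
    using g.AE_odd AE_d AE_lborel_uminus[OF AE_d] by (simp add: even)
  have "\<exists>w\<in>ball x (min d (e/2)). T (- w) = - T w \<and> (\<phi> has_derivative (\<lambda>h. T w \<bullet> h)) (at w) \<and>
      (\<phi> has_derivative (\<lambda>h. T (- w) \<bullet> h)) (at (- w))"
  proof (rule ccontr)
    assume none: "\<not> ?thesis"
    have "AE w in lborel. w \<notin> ball x (min d (e/2))" using AE_w by eventually_elim (use none in blast)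
    then have "ball x (min d (e/2)) \<in> null_sets lborel" by (subst AE_iff_null_sets) auto
    then have "negligible (ball x (min d (e/2)))" by (simp add: negligible_iff_null_sets null_sets_completionI)
    then show False using open_not_negligible[OF open_ball, of x "min d (e/2)"] d(1) e by simp
  qed
  then obtain w where w: "w \<in> ball x (min d (e/2))" "T (- w) = - T w"
    "(\<phi> has_derivative (\<lambda>h. T w \<bullet> h)) (at w)" "(\<phi> has_derivative (\<lambda>h. T (- w) \<bullet> h)) (at (- w))" by blast
  have "- 8 * L + norm (w - - w) \<le> norm (T w - T (- w)) \<and> norm (T w - T (- w)) \<le> 8 * L + norm (w - - w)"
    by (rule brenier_map_almost_isometry[OF lip_a lip_b br w(3,4)])
  moreover have "norm (w - - w) = 2 * norm w" using norm_scaleR[of 2 w] by (simp add: scaleR_2)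
  moreover have "norm (T w - T (- w)) = 2 * norm (T w)" using norm_scaleR[of 2 "T w"] by (simp add: w(2) scaleR_2)
  ultimately have 1: "\<bar>norm (T w) - norm w\<bar> \<le> 4 * L" by (simp add: abs_le_iff)
  have "dist w x < d" and wx: "norm (w - x) \<le> e / 2" using w(1) by (simp_all add: dist_commute dist_norm norm_minus_commute)
  then have "norm (T w - p) \<le> e / 2" using d(2) has_derivative_subgrad[OF convex_phi w(3)] by blast
  then show "\<bar>norm p - norm x\<bar> \<le> 4 * L + e"
    using 1 wx norm_triangle_ineq3[of "T w" p] norm_triangle_ineq3[of w x] by linarith
qed

text \<open>A Brenier map is fixed only almost everywhere. The inequalities are therefore claimed
  where the map is the derivative of its potential, and there without any further exceptional
  set.\<close>

theorem theorem5p15: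
  fixes a b :: "'n::euclidean_space \<Rightarrow> real" and La Lb :: real
  assumes "La-lipschitz_on UNIV a" and "Lb-lipschitz_on UNIV b"
  shows "(\<forall>\<phi> T. brenier_map (gauss_tilt a) (gauss_tilt b) \<phi> T \<longrightarrow>
            (\<forall>x y. (\<phi> has_derivative (\<lambda>h. T x \<bullet> h)) (at x) \<and>
                   (\<phi> has_derivative (\<lambda>h. T y \<bullet> h)) (at y) \<longrightarrow>
               - 8 * max La Lb + norm (x - y) \<le> norm (T x - T y) \<and>
               norm (T x - T y) \<le> 8 * max La Lb + norm (x - y)))
       \<and> (\<forall>\<psi> S. brenier_map (gauss_tilt (\<lambda>_. 0)) (gauss_tilt a) \<psi> S \<longrightarrow>
            (\<forall>x y. (\<psi> has_derivative (\<lambda>h. S x \<bullet> h)) (at x) \<and>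
                   (\<psi> has_derivative (\<lambda>h. S y \<bullet> h)) (at y) \<longrightarrow>
               - 8 * La + norm (x - y) \<le> norm (S x - S y) \<and>
               norm (S x - S y) \<le> 8 * La + norm (x - y)))
       \<and> ((\<forall>x. a (- x) = a x) \<longrightarrow>
          (\<forall>\<psi> S. brenier_map (gauss_tilt (\<lambda>_. 0)) (gauss_tilt a) \<psi> S \<longrightarrow>
            (\<forall>x. (\<psi> has_derivative (\<lambda>h. S x \<bullet> h)) (at x) \<longrightarrow>
               - 8 * La + norm x \<le> norm (S x) \<and> norm (S x) \<le> 8 * La + norm x)))"
proof -
  have La: "0 \<le> La" by (rule lipschitz_on_nonneg[OF assms(1)])
  have max_a: "(max La Lb)-lipschitz_on UNIV a" and max_b: "(max La Lb)-lipschitz_on UNIV b"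
    using assms by (auto intro: lipschitz_on_le)
  \<comment> \<open>The standard Gaussian has weight 0, which is Lipschitz with every nonnegative
    constant, so \<open>La\<close> serves for both weights.\<close>
  have zero: "La-lipschitz_on UNIV (\<lambda>_ :: 'n. 0 :: real)"
    using La by (auto intro!: lipschitz_onI)
  have "- 8 * La + norm x \<le> norm (S x) \<and> norm (S x) \<le> 8 * La + norm x"
    if "\<forall>x. a (- x) = a x" "brenier_map (gauss_tilt (\<lambda>_. 0)) (gauss_tilt a) \<psi> S"
      "(\<psi> has_derivative (\<lambda>h. S x \<bullet> h)) (at x)" for \<psi> S x
    using brenier_map_even_norm[OF zero assms(1) _ _ that(2,3)] that(1) La by (simp add: abs_le_iff)
  then show ?thesis
    using brenier_map_almost_isometry[OF max_a max_b] brenier_map_almost_isometry[OF zero assms(1)] by blast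
qed

end
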